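(* Let $\Sigma$ be a compact connected oriented surface and let $\pi\in\mathcal{G}_n(\Sigma)$, $n\ge0$, with zero set $Z(\pi)=\bigsqcup_{i=1}^n\gamma_i$. Let $\omega$ be the symplectic form on $\Sigma\setminus Z(\pi)$ inverse to $\pi$. For a function $h\in C^\infty(\Sigma)$ vanishing linearly on $\gamma_1,\dots,\gamma_n$ and nonzero elsewhere, and $\varepsilon>0$, put $$V_h^\varepsilon(\pi)=\int_{\{|h|>\varepsilon\}}\omega .$$ Then the limit $V(\pi)=\lim_{\varepsilon\to0}V_h^\varepsilon(\pi)$ exists and is independent of the choice of the function $h$.
   Context: On a surface every smooth bivector field is a Poisson structure. Fix a symplectic form $\omega_0$ compatible with the orientation of $\Sigma$ and let $\pi_0$ be its Poisson bivector (if $\omega_0=dx\wedge dy$ locally then $\pi_0=\partial_x\wedge\partial_y$). Every Poisson structure is $\pi=f\pi_0$, and on $\{f\neq0\}$ the inverse symplectic form is $\omega=\omega_0/f$. A smooth function $h$ vanishes linearly on a curve if $h=0$ and $dh\neq0$ at each of its points; $\pi=f\pi_0$ vanishes linearly on a curve if $f$ does. $\mathcal{G}_n(\Sigma)$ is the set of Poisson structures whose zero set consists of $n$ pairwise disjoint smooth simple closed curves on each of which the structure vanishes linearly. Integrals use the given orientation of $\Sigma$. *)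

theory Defs
  imports "HOL-Analysis.Analysis"
begin

fun Ck_on :: "nat \<Rightarrow> 'a::real_normed_vector set \<Rightarrow> ('a \<Rightarrow> 'b::real_normed_vector) \<Rightarrow> bool" where
  "Ck_on 0 S f \<longleftrightarrow> continuous_on S f"
| "Ck_on (Suc k) S f \<longleftrightarrow> (\<forall>x\<in>S. f differentiable (at x)) \<and>
     (\<forall>v. Ck_on k S (\<lambda>x. frechet_derivative f (at x) v))"

(* Intended for open S. *)
definition smooth_on :: "'a::real_normed_vector set \<Rightarrow> ('a \<Rightarrow> 'b::real_normed_vector) \<Rightarrow> bool" where
  "smooth_on S f \<longleftrightarrow> (\<forall>k. Ck_on k S f)"

definition jacobian :: "(real^2 \<Rightarrow> real^2) \<Rightarrow> real^2 \<Rightarrow> real" where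
  "jacobian F x = det (matrix (frechet_derivative F (at x)))"


(* The values of chart_map outside chart_dom are never used. *)
datatype 'a chart = Chart (chart_dom: "'a set") (chart_map: "'a \<Rightarrow> real^2")

definition chart_img :: "'a chart \<Rightarrow> (real^2) set" where
  "chart_img c = chart_map c ` chart_dom c"

definition chart_inv :: "'a chart \<Rightarrow> real^2 \<Rightarrow> 'a" where
  "chart_inv c = inv_into (chart_dom c) (chart_map c)"

definition is_chart :: "'a::topological_space chart \<Rightarrow> bool" where
  "is_chart c \<longleftrightarrow> open (chart_dom c) \<and> open (chart_img c) \<and>
     homeomorphism (chart_dom c) (chart_img c) (chart_map c) (chart_inv c)"

(* Change of coordinates, meaningful on chart_map c ` (chart_dom c \<inter> chart_dom d). *)
definition transition :: "'a chart \<Rightarrow> 'a chart \<Rightarrow> real^2 \<Rightarrow> real^2" where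
  "transition c d = chart_map d \<circ> chart_inv c"

definition oriented_atlas :: "'a::topological_space chart set \<Rightarrow> bool" where
  "oriented_atlas A \<longleftrightarrow> (\<forall>c\<in>A. is_chart c) \<and> (\<Union>c\<in>A. chart_dom c) = UNIV \<and>
     (\<forall>c\<in>A. \<forall>d\<in>A. smooth_on (chart_map c ` (chart_dom c \<inter> chart_dom d)) (transition c d) \<and>
        (\<forall>p \<in> chart_dom c \<inter> chart_dom d. jacobian (transition c d) (chart_map c p) > 0))"

(* The surface is the whole type; its smooth structure and its orientation are those of A.
   The charts map onto open subsets of the plane, so there is no boundary. *)
definition compact_connected_oriented_surface :: "'a::t2_space chart set \<Rightarrow> bool" where
  "compact_connected_oriented_surface A \<longleftrightarrow>
     compact (UNIV :: 'a set) \<and> connected (UNIV :: 'a set) \<and> oriented_atlas A"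

definition smooth_fun :: "'a chart set \<Rightarrow> ('a \<Rightarrow> real) \<Rightarrow> bool" where
  "smooth_fun A f \<longleftrightarrow> (\<forall>c\<in>A. smooth_on (chart_img c) (f \<circ> chart_inv c))"

definition differential_nonzero :: "'a chart set \<Rightarrow> ('a \<Rightarrow> real) \<Rightarrow> 'a \<Rightarrow> bool" where
  "differential_nonzero A h p \<longleftrightarrow> (\<forall>c\<in>A. p \<in> chart_dom c \<longrightarrow>
     frechet_derivative (h \<circ> chart_inv c) (at (chart_map c p)) \<noteq> (\<lambda>v. 0))"

definition vanishes_linearly :: "'a chart set \<Rightarrow> ('a \<Rightarrow> real) \<Rightarrow> 'a set \<Rightarrow> bool" where
  "vanishes_linearly A h C \<longleftrightarrow> (\<forall>p\<in>C. h p = 0 \<and> differential_nonzero A h p)"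

(* C is the image of an embedded circle, the circle being the reals modulo 1. *)
definition smooth_simple_closed_curve :: "'a::topological_space chart set \<Rightarrow> 'a set \<Rightarrow> bool" where
  "smooth_simple_closed_curve A C \<longleftrightarrow> (\<exists>g :: real \<Rightarrow> 'a.
     continuous_on UNIV g \<and> (\<forall>t. g (t + 1) = g t) \<and> inj_on g {0..<1} \<and> range g = C \<and>
     (\<forall>c\<in>A. smooth_on (g -` chart_dom c) (chart_map c \<circ> g) \<and>
        (\<forall>t \<in> g -` chart_dom c. vector_derivative (chart_map c \<circ> g) (at t) \<noteq> 0)))"


(* Bivector fields and 2-forms are given by their components: in a chart c with coordinates
   (x, y), the bivector field P is P c p times d/dx \<and> d/dy at p, and the 2-form w is
   w c p times dx \<and> dy at p.  Only values with c in the atlas and p in chart_dom c matter. *)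
type_synonym 'a component = "'a chart \<Rightarrow> 'a \<Rightarrow> real"

definition smooth_component :: "'a chart set \<Rightarrow> 'a component \<Rightarrow> bool" where
  "smooth_component A u \<longleftrightarrow> (\<forall>c\<in>A. smooth_on (chart_img c) (u c \<circ> chart_inv c))"

definition bivector_field :: "'a chart set \<Rightarrow> 'a component \<Rightarrow> bool" where
  "bivector_field A P \<longleftrightarrow> smooth_component A P \<and>
     (\<forall>c\<in>A. \<forall>d\<in>A. \<forall>p \<in> chart_dom c \<inter> chart_dom d.
        P d p = jacobian (transition c d) (chart_map c p) * P c p)"

definition two_form :: "'a chart set \<Rightarrow> 'a component \<Rightarrow> bool" where
  "two_form A w \<longleftrightarrow> smooth_component A w \<and>
     (\<forall>c\<in>A. \<forall>d\<in>A. \<forall>p \<in> chart_dom c \<inter> chart_dom d.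
        w c p = jacobian (transition c d) (chart_map c p) * w d p)"

(* In dimension two the Jacobi identity holds for every bivector field. *)
definition poisson_structure :: "'a chart set \<Rightarrow> 'a component \<Rightarrow> bool" where
  "poisson_structure A P \<longleftrightarrow> bivector_field A P"

(* In dimension two every 2-form is closed, and it is nondegenerate where it is nonzero;
   compatibility with the orientation is positivity in the charts of the oriented atlas. *)
definition positive_symplectic_form :: "'a chart set \<Rightarrow> 'a component \<Rightarrow> bool" where
  "positive_symplectic_form A w \<longleftrightarrow> two_form A w \<and> (\<forall>c\<in>A. \<forall>p \<in> chart_dom c. w c p > 0)"

(* Normalised so that dx \<and> dy and d/dx \<and> d/dy are inverse to each other. *)
definition inverse_bivector :: "'a component \<Rightarrow> 'a component" where
  "inverse_bivector w = (\<lambda>c p. 1 / w c p)"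

(* Meaningful off the zero set of P. *)
definition inverse_form :: "'a component \<Rightarrow> 'a component" where
  "inverse_form P = (\<lambda>c p. 1 / P c p)"

definition zero_set :: "'a chart set \<Rightarrow> 'a component \<Rightarrow> 'a set" where
  "zero_set A P = {p. \<forall>c\<in>A. p \<in> chart_dom c \<longrightarrow> P c p = 0}"

definition bivector_vanishes_linearly ::
  "'a chart set \<Rightarrow> 'a component \<Rightarrow> 'a component \<Rightarrow> 'a set \<Rightarrow> bool" where
  "bivector_vanishes_linearly A w0 P C \<longleftrightarrow> (\<exists>f. smooth_fun A f \<and>
     (\<forall>c\<in>A. \<forall>p \<in> chart_dom c. P c p = f p * inverse_bivector w0 c p) \<and>
     vanishes_linearly A f C)"

definition disjoint_closed_curves ::
  "'a::topological_space chart set \<Rightarrow> nat \<Rightarrow> (nat \<Rightarrow> 'a set) \<Rightarrow> bool" where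
  "disjoint_closed_curves A n \<gamma> \<longleftrightarrow>
     disjoint_family_on \<gamma> {1..n} \<and> (\<forall>i\<in>{1..n}. smooth_simple_closed_curve A (\<gamma> i))"

(* The set G_n; it does not depend on the reference form w0. *)
definition linear_poisson_structures ::
  "'a::topological_space chart set \<Rightarrow> 'a component \<Rightarrow> nat \<Rightarrow> 'a component set" where
  "linear_poisson_structures A w0 n = {P. poisson_structure A P \<and>
     (\<exists>\<gamma>. disjoint_closed_curves A n \<gamma> \<and> zero_set A P = (\<Union>i\<in>{1..n}. \<gamma> i) \<and>
        (\<forall>i\<in>{1..n}. bivector_vanishes_linearly A w0 P (\<gamma> i)))}"


(* Finite families suffice because the surfaces considered are compact. *)
definition partition_of_unity ::
  "'a::topological_space chart set \<Rightarrow> nat \<Rightarrow> (nat \<Rightarrow> 'a chart) \<Rightarrow> (nat \<Rightarrow> 'a \<Rightarrow> real) \<Rightarrow> bool" where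
  "partition_of_unity A N c \<rho> \<longleftrightarrow>
     (\<forall>i<N. c i \<in> A \<and> smooth_fun A (\<rho> i) \<and> (\<forall>p. 0 \<le> \<rho> i p) \<and>
        closure {p. \<rho> i p \<noteq> 0} \<subseteq> chart_dom (c i)) \<and>
     (\<forall>p. (\<Sum>i<N. \<rho> i p) = 1)"

(* The value I does not depend on the partition of unity: the transition maps preserve
   orientation, so the coefficient of a 2-form transforms like a density. *)
definition has_form_integral ::
  "'a::topological_space chart set \<Rightarrow> 'a component \<Rightarrow> 'a set \<Rightarrow> real \<Rightarrow> bool" where
  "has_form_integral A w S I \<longleftrightarrow> (\<exists>N c \<rho>. partition_of_unity A N c \<rho> \<and>
     (\<forall>i<N. set_integrable lebesgue (chart_map (c i) ` (chart_dom (c i) \<inter> S))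
        (\<lambda>x. \<rho> i (chart_inv (c i) x) * w (c i) (chart_inv (c i) x))) \<and>
     I = (\<Sum>i<N. set_lebesgue_integral lebesgue (chart_map (c i) ` (chart_dom (c i) \<inter> S))
        (\<lambda>x. \<rho> i (chart_inv (c i) x) * w (c i) (chart_inv (c i) x))))"

definition form_integrable ::
  "'a::topological_space chart set \<Rightarrow> 'a component \<Rightarrow> 'a set \<Rightarrow> bool" where
  "form_integrable A w S \<longleftrightarrow> (\<exists>I. has_form_integral A w S I)"

definition form_integral ::
  "'a::topological_space chart set \<Rightarrow> 'a component \<Rightarrow> 'a set \<Rightarrow> real" where
  "form_integral A w S = (THE I. has_form_integral A w S I)"

definition truncated_volume ::
  "'a::topological_space chart set \<Rightarrow> ('a \<Rightarrow> real) \<Rightarrow> 'a component \<Rightarrow> real \<Rightarrow> real" where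
  "truncated_volume A h P \<epsilon> = form_integral A (inverse_form P) {p. \<bar>h p\<bar> > \<epsilon>}"

end

theory Submission
  imports Defs
begin

text \<open>
  In a chart \<open>\<omega>\<close> is \<open>dx \<and> dy / F\<close> with \<open>F\<close> vanishing linearly, so after localising with a
  partition of unity \<open>\<phi>\<close> and choosing coordinates with \<open>\<partial>F/\<partial>y \<noteq> 0\<close>, the zero set is a
  Lipschitz graph \<open>y = y\<^sub>0 x\<close> and the integrand along the vertical line through \<open>x\<close> is an odd kernel
  of order \<open>1 / t\<close>, where \<open>t = y - y\<^sub>0 x\<close>, plus a bounded term. The truncation \<open>\<bar>h\<bar> > \<epsilon>\<close> agrees with
  the symmetric one \<open>\<bar>t\<bar> > \<epsilon> / \<bar>\<partial>h/\<partial>y\<bar>\<close> up to a set of vanishing relative size, on which the kernel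
  contributes an error tending to \<open>0\<close> uniformly in \<open>x\<close>; symmetric truncations converge to the principal
  value, which does not mention \<open>h\<close>.
\<close>

subsection \<open>Calculus of smooth functions\<close>

text \<open>Since \<open>1 / F\<close> is not integrable across the zero set, the limit could depend
  on the shape of the truncation. It does not, because |h| leaves the curve with the same slope on
  both sides: to first order only the length of the removed interval depends on \<open>h\<close>,
  not its symmetry. Slopes are bounded below by compactness, and this makes the error uniform in x.
  Independence of \<open>h\<close> is a matter of quantifiers: the partition of unity and all local
  limits are fixed before \<open>h\<close> appears, and their sum is the value. That partition must
  be adapted to the boxes in which a local limit is known. The integral of a form is a definite
  description over all partitions of unity, so its independence of the partition has to be
  established before the adapted one may be used. The graph comes from the intermediate value
  theorem and mean value bounds. Its Lipschitz constant is all that the slope argument and Fubini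
  require of it.\<close>

lemma Ck_on_mono: "Ck_on k S f \<Longrightarrow> T \<subseteq> S \<Longrightarrow> Ck_on k T f"
proof (induction k arbitrary: f)
  case 0 then show ?case by (auto intro: continuous_on_subset)
next
  case (Suc k) then show ?case by auto
qed

text \<open>\<open>frechet_derivative\<close> is taken at points of the ambient space, so agreement
  on \<open>S\<close> passes to the derivatives because \<open>S\<close> is open; the induction then
  continues with the derivatives.\<close>

lemma Ck_on_cong:
  assumes "open S" "\<And>x. x \<in> S \<Longrightarrow> f x = g x" "Ck_on k S f"
  shows "Ck_on k S g"
  using assms(2,3)
proof (induction k arbitrary: f g)
  case 0
  then show ?case using continuous_on_cong[of S S f g] by auto
next
  case (Suc k)
  have der: "(g has_derivative frechet_derivative f (at x)) (at x)" if "x \<in> S" for x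
    using Suc.prems that \<open>open S\<close> 
    by (intro has_derivative_transform_within_open[of f _ _ _ S g])
       (auto simp flip: frechet_derivative_works)
  have eq: "frechet_derivative f (at x) = frechet_derivative g (at x)" if "x \<in> S" for x
    using frechet_derivative_at[OF der[OF that]] .
  have "Ck_on k S (\<lambda>x. frechet_derivative g (at x) v)" for v
    by (rule Suc.IH[of "\<lambda>x. frechet_derivative f (at x) v"]) (use Suc.prems eq in auto)
  then show ?case using der by (auto simp: differentiable_def)
qed

lemma Ck_on_Suc_imp: "Ck_on (Suc k) S f \<Longrightarrow> Ck_on k S f"
proof (induction k arbitrary: f)
  case 0
  then show ?case
    unfolding Ck_on.simps
    by (meson continuous_at_imp_continuous_on differentiable_imp_continuous_within)
next
  case (Suc k)
  then show ?case by simp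
qed

lemma Ck_on_UN:
  assumes "\<And>i. i \<in> I \<Longrightarrow> open (S i)" "\<And>i. i \<in> I \<Longrightarrow> Ck_on k (S i) f"
  shows "Ck_on k (\<Union>i\<in>I. S i) f"
  using assms(2)
proof (induction k arbitrary: f)
  case 0
  then show ?case using assms(1) by (auto intro!: continuous_on_open_UN)
next
  case (Suc k)
  then show ?case by auto
qed

text \<open>\<open>frechet_derivative\<close> is a choice operator and awkward to compute with. This
  rule accepts an explicit derivative formula instead, which the inductions over \<open>k\<close>
  below supply.\<close>

lemma Ck_on_SucI:
  assumes "open S" "\<And>x. x \<in> S \<Longrightarrow> (f has_derivative f' x) (at x)"
    "\<And>v. Ck_on k S (\<lambda>x. f' x v)"
  shows "Ck_on (Suc k) S f"
proof -
  have eq: "frechet_derivative f (at x) = f' x" if "x \<in> S" for x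
    using frechet_derivative_at[OF assms(2)[OF that]] by simp
  have "Ck_on k S (\<lambda>x. frechet_derivative f (at x) v)" for v
    by (rule Ck_on_cong[OF assms(1) _ assms(3)[of v]]) (simp add: eq)
  then show ?thesis using assms(2) by (auto simp: differentiable_def)
qed

lemma Ck_on_Suc_derivative:
  assumes "Ck_on (Suc k) S f" "x \<in> S"
  shows "(f has_derivative frechet_derivative f (at x)) (at x)"
  using assms by (auto simp flip: frechet_derivative_works)

lemma Ck_on_const: "open S \<Longrightarrow> Ck_on k S (\<lambda>x. c)"
proof (induction k arbitrary: c)
  case 0 then show ?case by simp
next
  case (Suc k)
  show ?case by (rule Ck_on_SucI[where f' = "\<lambda>x v. 0"]) (use Suc in auto)
qed

lemma Ck_on_bounded_linear:
  assumes "open S" "bounded_linear L"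
  shows "Ck_on k S L"
proof (cases k)
  case 0 then show ?thesis using assms by (simp add: bounded_linear.linear linear_continuous_on)
next
  case (Suc m)
  show ?thesis unfolding Suc
    by (rule Ck_on_SucI[where f' = "\<lambda>x. L"])
       (use assms bounded_linear_imp_has_derivative Ck_on_const in auto)
qed

lemma Ck_on_add:
  assumes "open S" "Ck_on k S f" "Ck_on k S g"
  shows "Ck_on k S (\<lambda>x. f x + g x)"
  using assms(2,3)
proof (induction k arbitrary: f g)
  case 0 then show ?case by (auto intro: continuous_intros)
next
  case (Suc k)
  show ?case
    by (rule Ck_on_SucI[where f' = "\<lambda>x v. frechet_derivative f (at x) v + frechet_derivative g (at x) v"])
       (use Suc assms in \<open>auto intro!: has_derivative_add Ck_on_Suc_derivative\<close>)
qed

lemma Ck_on_sum: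
  assumes "open S" "\<And>i. i \<in> I \<Longrightarrow> Ck_on k S (f i)"
  shows "Ck_on k S (\<lambda>x. \<Sum>i\<in>I. f i x)"
  using assms(2)
  by (induction I rule: infinite_finite_induct) (auto intro: Ck_on_const Ck_on_add assms(1))

lemma Ck_on_scaleR:
  assumes "open S" "Ck_on k S f" "Ck_on k S g"
  shows "Ck_on k S (\<lambda>x. f x *\<^sub>R g x)"
  using assms(2,3)
proof (induction k arbitrary: f g)
  case 0 then show ?case by (auto intro: continuous_intros)
next
  case (Suc k)
  show ?case
  proof (rule Ck_on_SucI[where f' = "\<lambda>x v. f x *\<^sub>R frechet_derivative g (at x) v + frechet_derivative f (at x) v *\<^sub>R g x"])
    show "((\<lambda>x. f x *\<^sub>R g x) has_derivative
          (\<lambda>v. f x *\<^sub>R frechet_derivative g (at x) v + frechet_derivative f (at x) v *\<^sub>R g x)) (at x)"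
      if "x \<in> S" for x
      using Suc.prems that by (intro has_derivative_scaleR Ck_on_Suc_derivative)
    show "Ck_on k S (\<lambda>x. f x *\<^sub>R frechet_derivative g (at x) v + frechet_derivative f (at x) v *\<^sub>R g x)" for v
      using Suc.prems Ck_on_Suc_imp[OF Suc.prems(1)] Ck_on_Suc_imp[OF Suc.prems(2)]
      by (intro Ck_on_add Suc.IH assms(1)) auto
  qed fact
qed

lemmas Ck_on_mult = Ck_on_scaleR[where 'b = real, unfolded real_scaleR_def]

lemma Ck_on_inner_right:
  assumes "open S" "Ck_on k S f"
  shows "Ck_on k S (\<lambda>x. f x \<bullet> b)"
  using assms(2)
proof (induction k arbitrary: f)
  case 0 then show ?case by (auto intro: continuous_intros)
next
  case (Suc k)
  show ?case
    by (rule Ck_on_SucI[where f' = "\<lambda>x v. frechet_derivative f (at x) v \<bullet> b"])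
       (use Suc assms in \<open>auto intro!: has_derivative_inner_left Ck_on_Suc_derivative\<close>)
qed

lemma Ck_on_inverse:
  fixes f :: "'a::real_normed_vector \<Rightarrow> real"
  assumes "open S" "Ck_on k S f" "\<And>x. x \<in> S \<Longrightarrow> f x \<noteq> 0"
  shows "Ck_on k S (\<lambda>x. inverse (f x))"
  using assms(2)
proof (induction k)
  case 0 then show ?case using assms(3) by (auto intro: continuous_intros)
next
  case (Suc k)
  have IH: "Ck_on k S (\<lambda>x. inverse (f x))"
    using Suc Ck_on_Suc_imp by blast
  show ?case
  proof (rule Ck_on_SucI[where f' = "\<lambda>x v. - 1 * (inverse (f x) * frechet_derivative f (at x) v * inverse (f x))"])
    show "((\<lambda>x. inverse (f x)) has_derivative
          (\<lambda>v. - 1 * (inverse (f x) * frechet_derivative f (at x) v * inverse (f x)))) (at x)" if "x \<in> S" for x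
      using Deriv.has_derivative_inverse[OF assms(3)[OF that] Ck_on_Suc_derivative[OF Suc.prems that]]
      by simp
    show "Ck_on k S (\<lambda>x. - 1 * (inverse (f x) * frechet_derivative f (at x) v * inverse (f x)))" for v
      using Suc.prems by (intro Ck_on_mult IH Ck_on_const assms(1)) auto
  qed fact
qed

lemma Ck_on_compose:
  fixes f :: "'b::euclidean_space \<Rightarrow> 'c::real_normed_vector" and g :: "'a::real_normed_vector \<Rightarrow> 'b"
  assumes "open S" "open T" "g ` S \<subseteq> T" "Ck_on k S g" "Ck_on k T f"
  shows "Ck_on k S (f \<circ> g)"
  using assms(4,5)
proof (induction k arbitrary: f)
  case 0 then show ?case using assms(3) 
    by (metis Ck_on.simps(1) continuous_on_compose continuous_on_subset)
next
  case (Suc k)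
  \<comment> \<open>\<open>Ck_on\<close> controls derivatives of \<open>f\<close> in fixed
    directions only. Expanding the direction in the basis turns the chain rule into a sum of
    products to which the induction hypothesis and the product rule apply.\<close>
  let ?D = "\<lambda>x v. \<Sum>b\<in>Basis. (frechet_derivative g (at x) v \<bullet> b) *\<^sub>R ((\<lambda>y. frechet_derivative f (at y) b) \<circ> g) x"
  show ?case
  proof (rule Ck_on_SucI[where f' = ?D])
    show "((f \<circ> g) has_derivative ?D x) (at x)" if "x \<in> S" for x
    proof -
      have g: "(g has_derivative frechet_derivative g (at x)) (at x)"
        using Ck_on_Suc_derivative[OF Suc.prems(1) that] .
      have f: "(f has_derivative frechet_derivative f (at (g x))) (at (g x))"
        using Ck_on_Suc_derivative[OF Suc.prems(2)] that assms(3) by auto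
      have lin: "linear (frechet_derivative f (at (g x)))"
        using f has_derivative_linear by blast
      have "?D x = frechet_derivative f (at (g x)) \<circ> frechet_derivative g (at x)"
      proof
        fix v
        have "(frechet_derivative f (at (g x)) \<circ> frechet_derivative g (at x)) v
           = frechet_derivative f (at (g x)) (\<Sum>b\<in>Basis. (frechet_derivative g (at x) v \<bullet> b) *\<^sub>R b)"
          by (simp add: euclidean_representation)
        also have "\<dots> = ?D x v"
          by (simp only: linear_sum[OF lin] linear_cmul[OF lin] o_def)
        finally show "?D x v = (frechet_derivative f (at (g x)) \<circ> frechet_derivative g (at x)) v" by simp
      qed
      then show ?thesis using diff_chain_at[OF g f] by simp
    qed
    show "Ck_on k S (\<lambda>x. ?D x v)" for v
    proof (intro Ck_on_sum Ck_on_scaleR Ck_on_inner_right assms(1) Suc.IH)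
      show "Ck_on k S g" using Ck_on_Suc_imp[OF Suc.prems(1)] .
    qed (use Suc.prems in auto)
  qed fact
qed

lemma smooth_on_cong:
  "open S \<Longrightarrow> (\<And>x. x \<in> S \<Longrightarrow> f x = g x) \<Longrightarrow> smooth_on S f \<Longrightarrow> smooth_on S g"
  unfolding smooth_on_def by (metis Ck_on_cong)

lemma smooth_on_locally:
  assumes "\<And>x. x \<in> S \<Longrightarrow> \<exists>T. open T \<and> x \<in> T \<and> smooth_on T f"
  shows "smooth_on S f"
  unfolding smooth_on_def
proof
  fix k
  obtain T where T: "\<And>x. x \<in> S \<Longrightarrow> open (T x) \<and> x \<in> T x \<and> smooth_on (T x) f"
    using assms by metis
  have "Ck_on k (\<Union>x\<in>S. T x) f"
    by (rule Ck_on_UN) (use T smooth_on_def in blast)+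
  then show "Ck_on k S f" by (rule Ck_on_mono) (use T in blast)
qed

lemma smooth_on_const: "open S \<Longrightarrow> smooth_on S (\<lambda>x. c)"
  unfolding smooth_on_def by (auto intro: Ck_on_const)

lemma smooth_on_bounded_linear: "open S \<Longrightarrow> bounded_linear L \<Longrightarrow> smooth_on S L"
  unfolding smooth_on_def by (auto intro: Ck_on_bounded_linear)

lemma smooth_on_add: "open S \<Longrightarrow> smooth_on S f \<Longrightarrow> smooth_on S g \<Longrightarrow> smooth_on S (\<lambda>x. f x + g x)"
  unfolding smooth_on_def by (auto intro: Ck_on_add)

lemma smooth_on_sum:
  "open S \<Longrightarrow> (\<And>i. i \<in> I \<Longrightarrow> smooth_on S (f i)) \<Longrightarrow> smooth_on S (\<lambda>x. \<Sum>i\<in>I. f i x)"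
  unfolding smooth_on_def by (auto intro: Ck_on_sum)

lemma smooth_on_mult:
  fixes f g :: "'a::real_normed_vector \<Rightarrow> real"
  shows "open S \<Longrightarrow> smooth_on S f \<Longrightarrow> smooth_on S g \<Longrightarrow> smooth_on S (\<lambda>x. f x * g x)"
  unfolding smooth_on_def by (auto intro: Ck_on_mult)

lemma smooth_on_uminus:
  fixes f :: "'a::real_normed_vector \<Rightarrow> real"
  assumes "open U" "smooth_on U f"
  shows "smooth_on U (\<lambda>z. - f z)"
  using smooth_on_mult[OF assms(1) smooth_on_const[OF assms(1), of "-1"] assms(2)] by simp

lemma smooth_on_inverse:
  fixes f :: "'a::real_normed_vector \<Rightarrow> real"
  shows "open S \<Longrightarrow> smooth_on S f \<Longrightarrow> (\<And>x. x \<in> S \<Longrightarrow> f x \<noteq> 0) \<Longrightarrow> smooth_on S (\<lambda>x. inverse (f x))"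
  unfolding smooth_on_def by (intro allI Ck_on_inverse) auto

lemma smooth_on_compose:
  fixes f :: "'b::euclidean_space \<Rightarrow> 'c::real_normed_vector"
  shows "open S \<Longrightarrow> open T \<Longrightarrow> g ` S \<subseteq> T \<Longrightarrow> smooth_on S g \<Longrightarrow> smooth_on T f \<Longrightarrow> smooth_on S (f \<circ> g)"
  unfolding smooth_on_def by (intro allI Ck_on_compose) auto

lemma smooth_on_imp_continuous_on: "smooth_on S f \<Longrightarrow> continuous_on S f"
  unfolding smooth_on_def by (metis Ck_on.simps(1))

lemma smooth_on_has_derivative:
  "smooth_on S f \<Longrightarrow> x \<in> S \<Longrightarrow> (f has_derivative frechet_derivative f (at x)) (at x)"
  unfolding smooth_on_def by (rule Ck_on_Suc_derivative[of 0]) auto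

lemma smooth_on_frechet_derivative:
  "smooth_on S f \<Longrightarrow> smooth_on S (\<lambda>x. frechet_derivative f (at x) v)"
  unfolding smooth_on_def by (metis Ck_on.simps(2))

section \<open>Functions flat at 0 and smooth bump functions\<close>

definition flat_exp :: "real poly \<Rightarrow> real \<Rightarrow> real" where
  "flat_exp p s = (if s > 0 then poly p (1 / s) * exp (- (1 / s)) else 0)"

lemma poly_times_exp_minus_tendsto_0: "((\<lambda>u::real. poly p u * exp (- u)) \<longlongrightarrow> 0) at_top"
proof -
  have "((\<lambda>u. \<Sum>i\<le>degree p. coeff p i * (u ^ i / exp u)) \<longlongrightarrow> (\<Sum>i\<le>degree p. coeff p i * 0)) at_top"
    by (intro tendsto_sum tendsto_mult_left tendsto_power_div_exp_0)
  then show ?thesis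
    by (simp add: poly_altdef exp_minus field_simps sum_distrib_left sum_divide_distrib)
qed

lemma flat_exp_tendsto_0: "(flat_exp p \<longlongrightarrow> 0) (at 0)"
proof (rule filterlim_split_at_real)
  have "\<forall>\<^sub>F x::real in at_left 0. x < 0" by (rule eventually_at_left_real[of "-1" 0, THEN eventually_mono]) auto
  then show "(flat_exp p \<longlongrightarrow> 0) (at_left 0)"
    by (intro tendsto_eventually) (auto simp: flat_exp_def elim!: eventually_mono)
  have "((\<lambda>s::real. poly p (inverse s) * exp (- inverse s)) \<longlongrightarrow> 0) (at_right 0)"
    by (rule filterlim_compose[OF poly_times_exp_minus_tendsto_0 filterlim_inverse_at_top_right])
  then show "(flat_exp p \<longlongrightarrow> 0) (at_right 0)"
    by (rule Lim_transform_eventually)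
       (auto simp: flat_exp_def eventually_at_right_less inverse_eq_divide
         intro: eventually_mono[OF eventually_at_right_less])
qed

text \<open>With u = 1/s one has d/ds = -u^2 d/du, so p(u) exp(-u) goes to u^2 (p - p')(u) exp(-u),
  and \<open>monom 1 2\<close> is u^2. The family of all \<open>flat_exp p\<close> is thus closed
  under differentiation, and one induction over all \<open>p\<close> gives smoothness.\<close>

lemma flat_exp_has_derivative:
  "(flat_exp p has_real_derivative flat_exp (monom 1 2 * (p - pderiv p)) x) (at x)"
proof -
  consider "x > 0" | "x < 0" | "x = 0" by linarith
  then show ?thesis
  proof cases
    case 1
    have "((\<lambda>s. poly p (1 / s) * exp (- (1 / s))) has_real_derivative
        flat_exp (monom 1 2 * (p - pderiv p)) x) (at x)"
      using 1 by (auto intro!: derivative_eq_intros DERIV_chain2[OF poly_DERIV]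
          simp: flat_exp_def poly_monom field_simps power2_eq_square)
    then show ?thesis
      by (rule has_field_derivative_transform_within_open[of _ _ _ "{0<..}"]) (use 1 in \<open>auto simp: flat_exp_def\<close>)
  next
    case 2
    have "((\<lambda>s. 0) has_real_derivative flat_exp (monom 1 2 * (p - pderiv p)) x) (at x)"
      using 2 by (auto simp: flat_exp_def)
    then show ?thesis
      by (rule has_field_derivative_transform_within_open[of _ _ _ "{..<0}"]) (use 2 in \<open>auto simp: flat_exp_def\<close>)
  next
    case 3
    \<comment> \<open>At 0 the difference quotient is again a member of the family, with polynomial
      u p(u), and so tends to 0.\<close>
    have "flat_exp p y / y = flat_exp (monom 1 1 * p) y" for y
      by (auto simp: flat_exp_def poly_monom)
    then have "((\<lambda>y. (flat_exp p y - flat_exp p 0) / (y - 0)) \<longlongrightarrow> 0) (at 0)"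
      using flat_exp_tendsto_0[of "monom 1 1 * p"] by (simp add: flat_exp_def[of _ 0])
    then show ?thesis using 3 by (simp add: has_field_derivative_iff flat_exp_def[of _ 0])
  qed
qed

lemma flat_exp_smooth: "smooth_on UNIV (flat_exp p)"
  unfolding smooth_on_def
proof
  fix k show "Ck_on k UNIV (flat_exp p)"
  proof (induction k arbitrary: p)
    case 0
    then show ?case using flat_exp_has_derivative DERIV_continuous_on[of UNIV "flat_exp p"]
      by (auto intro!: continuous_at_imp_continuous_on DERIV_isCont)
  next
    case (Suc k)
    show ?case
      by (rule Ck_on_SucI[where f' = "\<lambda>x v. flat_exp (monom 1 2 * (p - pderiv p)) x * v"])
        (use flat_exp_has_derivative in \<open>auto intro!: Ck_on_mult Ck_on_const Suc simp flip: has_field_derivative_def\<close>)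
  qed
qed

text \<open>Composes exp(-1/s) with r^2 - |x - a|^2, which is positive exactly on the ball. The
  squared distance is written out in coordinates so that smoothness reduces to sums and
  products.\<close>

lemma smooth_bump:
  fixes a :: "'a::euclidean_space"
  assumes "r > 0"
  obtains B :: "'a \<Rightarrow> real" where "smooth_on UNIV B" "\<And>x. B x \<ge> 0" "\<And>x. B x > 0 \<longleftrightarrow> x \<in> ball a r"
proof
  let ?q = "\<lambda>x::'a. r\<^sup>2 + - 1 * (\<Sum>b\<in>Basis. ((x \<bullet> b) + - (a \<bullet> b)) * ((x \<bullet> b) + - (a \<bullet> b)))"
  have q: "?q x = r\<^sup>2 - (dist a x)\<^sup>2" for x
  proof -
    have "(dist a x)\<^sup>2 = (x - a) \<bullet> (x - a)"
      by (simp add: dist_norm norm_minus_commute[of a x] power2_norm_eq_inner)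
    also have "\<dots> = (\<Sum>b\<in>Basis. ((x \<bullet> b) + - (a \<bullet> b)) * ((x \<bullet> b) + - (a \<bullet> b)))"
      by (subst euclidean_inner) (simp add: inner_diff_left)
    finally show ?thesis by simp
  qed
  have "smooth_on UNIV ?q"
    by (intro smooth_on_add smooth_on_mult smooth_on_sum smooth_on_const
        smooth_on_bounded_linear bounded_linear_inner_left) auto
  then show "smooth_on UNIV (flat_exp 1 \<circ> ?q)"
    using flat_exp_smooth by (intro smooth_on_compose[of _ UNIV]) auto
  show "(flat_exp 1 \<circ> ?q) x \<ge> 0" for x by (simp add: flat_exp_def)
  show "(flat_exp 1 \<circ> ?q) x > 0 \<longleftrightarrow> x \<in> ball a r" for x
    using assms q[of x] power_mono_iff[of r "dist a x" 2]
    by (auto simp: flat_exp_def not_le[symmetric])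
qed

subsection \<open>Charts and partitions of unity\<close>

lemma
  assumes "is_chart c"
  shows chart_dom_open: "open (chart_dom c)"
    and chart_img_open: "open (chart_img c)"
    and chart_inv_map: "p \<in> chart_dom c \<Longrightarrow> chart_inv c (chart_map c p) = p"
    and chart_map_in_img: "p \<in> chart_dom c \<Longrightarrow> chart_map c p \<in> chart_img c"
    and chart_map_inv: "x \<in> chart_img c \<Longrightarrow> chart_map c (chart_inv c x) = x"
    and chart_inv_in_dom: "x \<in> chart_img c \<Longrightarrow> chart_inv c x \<in> chart_dom c"
    and chart_map_continuous: "continuous_on (chart_dom c) (chart_map c)"
    and chart_inv_continuous: "continuous_on (chart_img c) (chart_inv c)"
  using assms unfolding is_chart_def homeomorphism_def by blast+

lemma chart_map_open_image:
  assumes "is_chart c" "open V" "V \<subseteq> chart_dom c"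
  shows "open (chart_map c ` V)"
proof -
  have "openin (top_of_set (chart_img c)) (chart_map c ` V)"
    using assms by (intro homeomorphism_imp_open_map[of "chart_dom c" _ _ "chart_inv c"])
      (auto simp: is_chart_def openin_open_eq)
  then show ?thesis using chart_img_open[OF assms(1)] by (simp add: openin_open_eq)
qed

lemma chart_map_image_eq:
  assumes "is_chart c" "S \<subseteq> chart_dom c"
  shows "chart_map c ` S = {x \<in> chart_img c. chart_inv c x \<in> S}"
proof (intro equalityI subsetI)
  fix x assume "x \<in> {x \<in> chart_img c. chart_inv c x \<in> S}"
  then show "x \<in> chart_map c ` S"
    using chart_map_inv[OF assms(1), of x] by (metis (lifting) imageI mem_Collect_eq)
qed (use assms(2) chart_inv_map[OF assms(1)] chart_map_in_img[OF assms(1)] in auto)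

lemma
  assumes "oriented_atlas A"
  shows atlas_is_chart: "c \<in> A \<Longrightarrow> is_chart c"
    and atlas_covers: "\<exists>c\<in>A. p \<in> chart_dom c"
    and transition_smooth: "c \<in> A \<Longrightarrow> d \<in> A \<Longrightarrow>
      smooth_on (chart_map c ` (chart_dom c \<inter> chart_dom d)) (transition c d)"
    and transition_jacobian_pos: "c \<in> A \<Longrightarrow> d \<in> A \<Longrightarrow> p \<in> chart_dom c \<inter> chart_dom d \<Longrightarrow>
      jacobian (transition c d) (chart_map c p) > 0"
  using assms unfolding oriented_atlas_def by blast+

lemma overlap_open:
  assumes "oriented_atlas A" "c \<in> A" "d \<in> A"
  shows "open (chart_map c ` (chart_dom c \<inter> chart_dom d))"
  using assms atlas_is_chart[OF assms(1)] by (intro chart_map_open_image open_Int chart_dom_open) auto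

lemma smooth_fun_continuous:
  assumes "oriented_atlas A" "smooth_fun A f"
  shows "continuous_on UNIV f"
proof -
  have "continuous_on (chart_dom c) f" if c: "c \<in> A" for c
  proof -
    have ch: "is_chart c" using atlas_is_chart[OF assms(1) c] .
    have "continuous_on (chart_img c) (f \<circ> chart_inv c)"
      using assms(2) c smooth_on_imp_continuous_on unfolding smooth_fun_def by blast
    then have "continuous_on (chart_dom c) ((f \<circ> chart_inv c) \<circ> chart_map c)"
      using chart_map_continuous[OF ch]
      by (intro continuous_on_compose[of _ "chart_map c" "f \<circ> chart_inv c"]) (simp_all flip: chart_img_def)
    then show ?thesis
      using chart_inv_map[OF ch] by (auto cong: continuous_on_cong)
  qed
  then have "continuous_on (\<Union>c\<in>A. chart_dom c) f"
    using atlas_is_chart[OF assms(1)] chart_dom_open by (intro continuous_on_open_UN) auto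
  then show ?thesis using assms(1) by (simp add: oriented_atlas_def)
qed

text \<open>A bump in the chart is extended by 0. Smoothness is checked locally: at points of
  \<open>chart_dom c\<close> through the transition map, at all others because the function vanishes
  off \<open>K\<close>.\<close>

lemma smooth_bump_fun:
  fixes A :: "'a::t2_space chart set"
  assumes A: "oriented_atlas A" and c: "c \<in> A" and p: "p \<in> chart_dom c"
    and W: "open W" "chart_map c p \<in> W" "W \<subseteq> chart_img c"
  obtains \<beta> where "smooth_fun A \<beta>" "\<And>q. \<beta> q \<ge> 0" "\<beta> p > 0" "closure {q. \<beta> q \<noteq> 0} \<subseteq> chart_dom c"
    "\<And>x. x \<in> chart_img c - W \<Longrightarrow> \<beta> (chart_inv c x) = 0"
proof -
  have ch: "is_chart c" using atlas_is_chart[OF A c] .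
  obtain r where r: "r > 0" "cball (chart_map c p) r \<subseteq> W"
    using W open_contains_cball by metis
  obtain B :: "real^2 \<Rightarrow> real" where B: "smooth_on UNIV B" "\<And>x. B x \<ge> 0"
    "\<And>x. B x > 0 \<longleftrightarrow> x \<in> ball (chart_map c p) r"
    using smooth_bump[OF r(1), of "chart_map c p"] by blast
  have B0: "B x = 0" if "x \<notin> cball (chart_map c p) r" for x
    using B(2,3)[of x] that by force
  define K where "K = chart_inv c ` cball (chart_map c p) r"
  have "cball (chart_map c p) r \<subseteq> chart_img c" using r(2) W(3) by blast
  then have K: "K \<subseteq> chart_dom c" "compact K" "chart_map c ` K \<subseteq> cball (chart_map c p) r"
    using chart_inv_continuous[OF ch] chart_inv_in_dom[OF ch] chart_map_inv[OF ch]
    unfolding K_def by (auto intro!: compact_continuous_image intro: continuous_on_subset)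
  \<comment> \<open>The Hausdorff property enters here: the compact set \<open>K\<close> is closed,
    so its complement is an open set on which the extension is 0.\<close>
  then have Kc: "closed K" by (simp add: compact_imp_closed)
  define \<beta> where "\<beta> q = (if q \<in> chart_dom c then B (chart_map c q) else 0)" for q
  have \<beta>0: "\<beta> q = 0" if "q \<notin> K" for q
    using that B0 chart_inv_map[OF ch] unfolding \<beta>_def K_def by (metis imageI)
  have "closure {q. \<beta> q \<noteq> 0} \<subseteq> K"
    using \<beta>0 by (intro closure_minimal Kc) auto
  moreover have "smooth_fun A \<beta>"
    unfolding smooth_fun_def
  proof (intro ballI smooth_on_locally)
    fix d x assume d: "d \<in> A" and x: "x \<in> chart_img d"
    have cd: "is_chart d" using atlas_is_chart[OF A d] .
    show "\<exists>T. open T \<and> x \<in> T \<and> smooth_on T (\<beta> \<circ> chart_inv d)"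
    proof (cases "chart_inv d x \<in> chart_dom c")
      case True
      let ?T = "chart_map d ` (chart_dom d \<inter> chart_dom c)"
      have "smooth_on ?T (B \<circ> transition d c)"
        by (rule smooth_on_compose[of _ UNIV]) (use overlap_open[OF A d c] transition_smooth[OF A d c] B in auto)
      then have "smooth_on ?T (\<beta> \<circ> chart_inv d)"
        by (rule smooth_on_cong[rotated 2])
          (use overlap_open[OF A d c] chart_inv_map[OF cd] in \<open>auto simp: \<beta>_def transition_def\<close>)
      moreover have "x \<in> ?T"
        using True x chart_inv_in_dom[OF cd] chart_map_inv[OF cd, of x] by (metis IntI imageI)
      ultimately show ?thesis using overlap_open[OF A d c] by blast
    next
      case False
      let ?T = "chart_map d ` (chart_dom d - K)"
      have T: "open ?T"
        using chart_dom_open[OF cd] Kc by (intro chart_map_open_image cd) auto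
      have "smooth_on ?T (\<beta> \<circ> chart_inv d)"
        by (rule smooth_on_cong[OF T _ smooth_on_const[OF T, of 0]])
          (use chart_inv_map[OF cd] \<beta>0 in auto)
      moreover have "x \<in> ?T"
        using False K(1) x chart_inv_in_dom[OF cd] chart_map_inv[OF cd, of x] by (metis DiffI imageI subsetD)
      ultimately show ?thesis using T by blast
    qed
  qed
  moreover have "\<beta> (chart_inv c x) = 0" if "x \<in> chart_img c - W" for x
  proof -
    have "x \<notin> cball (chart_map c p) r" using that r(2) by blast
    then show ?thesis using that B0 chart_map_inv[OF ch] by (auto simp: \<beta>_def simp del: mem_cball)
  qed
  ultimately show thesis
    using that[of \<beta>] K(1) B(2) B(3)[of "chart_map c p"] p r(1) by (auto simp: \<beta>_def)
qed

text \<open>Compactness selects finitely many bumps without a common zero; dividing by their sum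
  gives the weights. Besides being subordinate to charts, weight \<open>i\<close> vanishes off the
  prescribed set \<open>W (q i)\<close>, which will be a place where local limits are known to
  exist.\<close>

lemma ex_partition_of_unity:
  fixes A :: "'a::t2_space chart set"
  assumes A: "oriented_atlas A" and comp: "compact (UNIV :: 'a set)"
    and cc: "\<And>p. cc p \<in> A" "\<And>p. p \<in> chart_dom (cc p)"
    and W: "\<And>p. open (W p)" "\<And>p. chart_map (cc p) p \<in> W p" "\<And>p. W p \<subseteq> chart_img (cc p)"
  obtains N q \<rho> where "partition_of_unity A N (cc \<circ> q) \<rho>"
    "\<And>i x. i < N \<Longrightarrow> x \<in> chart_img (cc (q i)) - W (q i) \<Longrightarrow> \<rho> i (chart_inv (cc (q i)) x) = 0"
proof -
  have "\<exists>\<beta>. smooth_fun A \<beta> \<and> (\<forall>q. \<beta> q \<ge> 0) \<and> \<beta> p > 0 \<and> closure {q. \<beta> q \<noteq> 0} \<subseteq> chart_dom (cc p) \<and>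
    (\<forall>x \<in> chart_img (cc p) - W p. \<beta> (chart_inv (cc p) x) = 0)" for p
    by (rule smooth_bump_fun[OF A cc W, of p]) blast
  then obtain \<beta> where \<beta>: "\<And>p. smooth_fun A (\<beta> p)" "\<And>p q. \<beta> p q \<ge> 0" "\<And>p. \<beta> p p > 0"
    "\<And>p. closure {q. \<beta> p q \<noteq> 0} \<subseteq> chart_dom (cc p)"
    "\<And>p x. x \<in> chart_img (cc p) - W p \<Longrightarrow> \<beta> p (chart_inv (cc p) x) = 0"
    by metis
  have "open {q. \<beta> p q > 0}" for p
    using smooth_fun_continuous[OF A \<beta>(1)] by (intro open_Collect_less) auto
  moreover have "UNIV \<subseteq> (\<Union>p\<in>UNIV. {q. \<beta> p q > 0})" using \<beta>(3) by blast
  ultimately obtain X where X: "finite X" "UNIV \<subseteq> (\<Union>p\<in>X. {q. \<beta> p q > 0})"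
    by (rule compactE_image[OF comp])
  define N where "N = card X"
  obtain q where q: "bij_betw q {0..<N} X"
    using ex_bij_betw_nat_finite[OF X(1)] N_def by blast
  define s where "s x = (\<Sum>i<N. \<beta> (q i) x)" for x
  have s: "s x > 0" for x
  proof -
    obtain p where "p \<in> X" "\<beta> p x > 0" using X(2) by auto
    moreover then obtain i where "i < N" "q i = p"
      using q by (auto simp: bij_betw_def)
    ultimately show ?thesis unfolding s_def by (intro sum_pos2[of _ i]) (simp_all add: \<beta>(2))
  qed
  define \<rho> where "\<rho> i x = \<beta> (q i) x * inverse (s x)" for i x
  have "smooth_fun A (\<rho> i)" for i
    unfolding smooth_fun_def
  proof
    fix c assume c: "c \<in> A"
    have op: "open (chart_img c)" using chart_img_open[OF atlas_is_chart[OF A c]] .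
    have b: "smooth_on (chart_img c) (\<lambda>x. \<beta> p (chart_inv c x))" for p
      using \<beta>(1) c by (auto simp: smooth_fun_def o_def)
    have "smooth_on (chart_img c) (\<lambda>x. \<beta> (q i) (chart_inv c x) * inverse (\<Sum>i<N. \<beta> (q i) (chart_inv c x)))"
      using s by (intro smooth_on_mult smooth_on_inverse smooth_on_sum op b) (simp add: s_def less_imp_neq[symmetric])
    then show "smooth_on (chart_img c) (\<rho> i \<circ> chart_inv c)"
      by (simp add: \<rho>_def s_def o_def)
  qed
  moreover have "{x. \<rho> i x \<noteq> 0} = {x. \<beta> (q i) x \<noteq> 0}" for i
    using s by (auto simp: \<rho>_def less_imp_neq[symmetric])
  moreover have "(\<Sum>i<N. \<rho> i x) = 1" for x
    using s[of x] by (simp add: \<rho>_def s_def[of x] flip: sum_distrib_right)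
  moreover have "\<rho> i x \<ge> 0" for i x
    using \<beta>(2) s[of x] by (simp add: \<rho>_def less_imp_le)
  ultimately have "partition_of_unity A N (cc \<circ> q) \<rho>"
    using cc \<beta>(4) by (auto simp: partition_of_unity_def)
  then show thesis
    by (rule that) (simp add: \<rho>_def \<beta>(5))
qed

subsection \<open>Independence of the integral from the partition of unity\<close>

lemma set_integral_change_of_variables:
  fixes g :: "real^2 \<Rightarrow> real^2" and f :: "real^2 \<Rightarrow> real"
  assumes "S \<in> sets lebesgue" "\<And>x. x \<in> S \<Longrightarrow> (g has_derivative g' x) (at x within S)" "inj_on g S"
  shows "set_integrable lebesgue S (\<lambda>x. \<bar>det (matrix (g' x))\<bar> * f (g x)) \<longleftrightarrow> set_integrable lebesgue (g ` S) f"
    and "set_integrable lebesgue (g ` S) f \<Longrightarrow>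
      (LINT x:S|lebesgue. \<bar>det (matrix (g' x))\<bar> * f (g x)) = (LINT x:g ` S|lebesgue. f x)"
proof -
  \<comment> \<open>The change of variables theorem concerns functions into \<open>real^'n\<close>;
    \<open>vec\<close> turns \<open>f\<close> into one with values in \<open>real^1\<close>.\<close>
  have "set_integrable lebesgue S (\<lambda>x. \<bar>det (matrix (g' x))\<bar> * f (g x)) \<and>
      integral S (\<lambda>x. \<bar>det (matrix (g' x))\<bar> * f (g x)) = b
    \<longleftrightarrow> set_integrable lebesgue (g ` S) f \<and> integral (g ` S) f = b" for b
    using has_absolute_integral_change_of_variables[OF assms, of "\<lambda>x. vec (f x) :: real^1" "vec b"]
    by (simp add: absolutely_integrable_on_1_iff integral_on_1_eq)
  note iff = this
  show *: "set_integrable lebesgue S (\<lambda>x. \<bar>det (matrix (g' x))\<bar> * f (g x)) \<longleftrightarrow> set_integrable lebesgue (g ` S) f"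
    using iff by blast
  show "(LINT x:S|lebesgue. \<bar>det (matrix (g' x))\<bar> * f (g x)) = (LINT x:g ` S|lebesgue. f x)"
    if "set_integrable lebesgue (g ` S) f"
    using iff[of "integral (g ` S) f"] that
      set_lebesgue_integral_eq_integral(2)[OF that]
      set_lebesgue_integral_eq_integral(2)[of S "\<lambda>x. \<bar>det (matrix (g' x))\<bar> * f (g x)"] by simp
qed

text \<open>Applied with \<open>f\<close> a weight of a second partition of unity, read in a
  chart.\<close>

lemma set_integrable_bounded_continuous_mult:
  fixes f g :: "'a::euclidean_space \<Rightarrow> real"
  assumes X: "open X" and f: "continuous_on X f" "\<And>x. x \<in> X \<Longrightarrow> \<bar>f x\<bar> \<le> 1"
    and g: "set_integrable lebesgue X g"
  shows "set_integrable lebesgue X (\<lambda>x. f x * g x)"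
proof (rule set_integrable_bound[OF g])
  have "(\<lambda>x. indicator X x *\<^sub>R f x) \<in> borel_measurable borel"
    using X f(1) by (intro borel_measurable_continuous_on_indicator) auto
  then have "(\<lambda>x. indicator X x *\<^sub>R f x) \<in> borel_measurable lebesgue"
    by (intro measurable_completion) simp
  moreover have "(\<lambda>x. indicator X x *\<^sub>R g x) \<in> borel_measurable lebesgue"
    using g by (auto simp: set_integrable_def)
  ultimately have "(\<lambda>x. (indicator X x *\<^sub>R f x) * (indicator X x *\<^sub>R g x)) \<in> borel_measurable lebesgue"
    by (rule borel_measurable_times)
  moreover have "(\<lambda>x. (indicator X x *\<^sub>R f x) * (indicator X x *\<^sub>R g x)) = (\<lambda>x. indicator X x *\<^sub>R (f x * g x))"
    by (auto simp: indicator_def)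
  ultimately show "set_borel_measurable lebesgue X (\<lambda>x. f x * g x)"
    by (simp only: set_borel_measurable_def)
  show "AE x in lebesgue. x \<in> X \<longrightarrow> norm (f x * g x) \<le> norm (g x)"
    using f(2) by (intro AE_I2) (simp add: abs_mult mult_left_le_one_le)
qed

definition chart_density :: "'a chart \<Rightarrow> ('a \<Rightarrow> real) \<Rightarrow> 'a component \<Rightarrow> real^2 \<Rightarrow> real" where
  "chart_density c u w x = u (chart_inv c x) * w c (chart_inv c x)"

lemma has_form_integral_alt:
  "has_form_integral A w S I \<longleftrightarrow> (\<exists>N c \<rho>. partition_of_unity A N c \<rho> \<and>
     (\<forall>i<N. set_integrable lebesgue (chart_map (c i) ` (chart_dom (c i) \<inter> S)) (chart_density (c i) (\<rho> i) w)) \<and>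
     I = (\<Sum>i<N. set_lebesgue_integral lebesgue (chart_map (c i) ` (chart_dom (c i) \<inter> S)) (chart_density (c i) (\<rho> i) w)))"
  unfolding has_form_integral_def chart_density_def by (rule refl)

text \<open>Change of variables carries the absolute value of the Jacobian, a 2-form the Jacobian
  itself; they agree because the Jacobians of an oriented atlas are positive. Openness of
  \<open>S\<close> makes \<open>X\<close> measurable.\<close>

lemma chart_density_change_chart:
  assumes A: "oriented_atlas A" and c: "c \<in> A" and d: "d \<in> A" and S: "open S"
    and w: "\<And>p. p \<in> chart_dom c \<inter> chart_dom d \<Longrightarrow>
        w c p = jacobian (transition c d) (chart_map c p) * w d p"
  defines "X \<equiv> chart_map c ` (chart_dom c \<inter> chart_dom d \<inter> S)"
    and "Y \<equiv> chart_map d ` (chart_dom c \<inter> chart_dom d \<inter> S)"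
  shows "set_integrable lebesgue X (chart_density c u w) \<longleftrightarrow> set_integrable lebesgue Y (chart_density d u w)" (is ?I)
    and "set_integrable lebesgue Y (chart_density d u w) \<Longrightarrow>
      set_lebesgue_integral lebesgue X (chart_density c u w) = set_lebesgue_integral lebesgue Y (chart_density d u w)"
        (is "_ \<Longrightarrow> ?E")
proof -
  let ?g = "transition c d"
  have cc: "is_chart c" and cd: "is_chart d"
    using atlas_is_chart[OF A] c d by auto
  have op: "open X"
    unfolding X_def using S chart_dom_open[OF cc] chart_dom_open[OF cd]
    by (intro chart_map_open_image[OF cc]) auto
  have X: "X \<in> sets lebesgue" using op by (simp add: borel_open sets_completionI_sets)
  have tr: "?g (chart_map c p) = chart_map d p" if "p \<in> chart_dom c" for p
    using chart_inv_map[OF cc that] by (simp add: transition_def)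
  have gX: "?g ` X = Y"
    unfolding X_def Y_def image_image using tr by (intro image_cong) auto
  have inj: "inj_on ?g X"
  proof (rule inj_onI)
    fix x y assume "x \<in> X" "y \<in> X" and eq: "?g x = ?g y"
    then obtain p q where "p \<in> chart_dom c \<inter> chart_dom d" "x = chart_map c p"
      "q \<in> chart_dom c \<inter> chart_dom d" "y = chart_map c q"
      unfolding X_def by blast
    with eq show "x = y" using tr chart_inv_map[OF cd] by (metis IntD1 IntD2)
  qed
  have der: "(?g has_derivative frechet_derivative ?g (at x)) (at x within X)" if "x \<in> X" for x
  proof -
    have "X \<subseteq> chart_map c ` (chart_dom c \<inter> chart_dom d)" unfolding X_def by blast
    then show ?thesis
      using smooth_on_has_derivative[OF transition_smooth[OF A c d], of x] that
      by (metis has_derivative_at_withinI subsetD)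
  qed
  have eq: "\<bar>det (matrix (frechet_derivative ?g (at x)))\<bar> * chart_density d u w (?g x) = chart_density c u w x"
    if xX: "x \<in> X" for x
  proof -
    obtain p where p: "p \<in> chart_dom c \<inter> chart_dom d" "x = chart_map c p"
      using xX unfolding X_def by blast
    then have "\<bar>det (matrix (frechet_derivative ?g (at x)))\<bar> = jacobian ?g (chart_map c p)"
      using transition_jacobian_pos[OF A c d p(1)] by (simp add: jacobian_def)
    then show ?thesis
      using p tr[of p] w[of p] chart_inv_map[OF cc, of p] chart_inv_map[OF cd, of p]
      by (simp add: chart_density_def)
  qed
  have "set_integrable lebesgue X (\<lambda>x. \<bar>det (matrix (frechet_derivative ?g (at x)))\<bar> * chart_density d u w (?g x))
     \<longleftrightarrow> set_integrable lebesgue X (chart_density c u w)"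
    by (rule set_integrable_cong) (use eq in auto)
  moreover have "(LINT x:X|lebesgue. \<bar>det (matrix (frechet_derivative ?g (at x)))\<bar> * chart_density d u w (?g x))
     = set_lebesgue_integral lebesgue X (chart_density c u w)"
    by (rule set_lebesgue_integral_cong) (use eq X in auto)
  ultimately show ?I "set_integrable lebesgue Y (chart_density d u w) \<Longrightarrow> ?E"
    using set_integral_change_of_variables[OF X der inj, of "chart_density d u w"] gX by simp_all
qed

lemma chart_density_restrict:
  assumes "is_chart c" "\<And>p. p \<notin> D \<Longrightarrow> u p = 0"
  shows "set_integrable lebesgue (chart_map c ` (chart_dom c \<inter> S)) (chart_density c u w)
      \<longleftrightarrow> set_integrable lebesgue (chart_map c ` (chart_dom c \<inter> D \<inter> S)) (chart_density c u w)"
    and "set_lebesgue_integral lebesgue (chart_map c ` (chart_dom c \<inter> S)) (chart_density c u w)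
      = set_lebesgue_integral lebesgue (chart_map c ` (chart_dom c \<inter> D \<inter> S)) (chart_density c u w)"
proof -
  have "(\<lambda>x. indicator (chart_map c ` (chart_dom c \<inter> S)) x *\<^sub>R chart_density c u w x)
      = (\<lambda>x. indicator (chart_map c ` (chart_dom c \<inter> D \<inter> S)) x *\<^sub>R chart_density c u w x)"
    using assms(2) chart_inv_map[OF assms(1)]
    by (force simp: fun_eq_iff indicator_def chart_density_def)
  then show "set_integrable lebesgue (chart_map c ` (chart_dom c \<inter> S)) (chart_density c u w)
      \<longleftrightarrow> set_integrable lebesgue (chart_map c ` (chart_dom c \<inter> D \<inter> S)) (chart_density c u w)"
    "set_lebesgue_integral lebesgue (chart_map c ` (chart_dom c \<inter> S)) (chart_density c u w)
      = set_lebesgue_integral lebesgue (chart_map c ` (chart_dom c \<inter> D \<inter> S)) (chart_density c u w)"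
    by (simp_all add: set_integrable_def set_lebesgue_integral_def)
qed

lemma partition_of_unity_outside:
  assumes "partition_of_unity A N c \<rho>" "i < N" "p \<notin> chart_dom (c i)"
  shows "\<rho> i p = 0"
proof -
  have "closure {p. \<rho> i p \<noteq> 0} \<subseteq> chart_dom (c i)"
    using assms by (simp add: partition_of_unity_def)
  then show ?thesis using assms(3) closure_subset[of "{p. \<rho> i p \<noteq> 0}"] by blast
qed

lemma partition_of_unity_le_1:
  assumes "partition_of_unity A N c \<rho>" "i < N"
  shows "\<bar>\<rho> i p\<bar> \<le> 1"
proof -
  have "\<rho> j p \<ge> 0" if "j < N" for j using assms(1) that by (simp add: partition_of_unity_def)
  moreover have "(\<Sum>j<N. \<rho> j p) = 1" using assms(1) by (simp add: partition_of_unity_def)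
  ultimately show ?thesis using assms(2) member_le_sum[of i "{..<N}" "\<lambda>i. \<rho> i p"] by simp
qed

text \<open>Inserts 1 as the sum of the \<open>\<sigma> j\<close>. The factor
  \<open>\<sigma> j\<close> vanishes off \<open>chart_dom (d j)\<close>, so each resulting piece
  lives on an overlap of two charts and can be moved from one to the other.\<close>

lemma form_integral_refine:
  assumes A: "oriented_atlas A" and S: "open S"
    and \<rho>: "partition_of_unity A N c \<rho>" and \<sigma>: "partition_of_unity A M d \<sigma>"
    and int: "\<And>i. i < N \<Longrightarrow> set_integrable lebesgue (chart_map (c i) ` (chart_dom (c i) \<inter> S)) (chart_density (c i) (\<rho> i) w)"
  shows "i < N \<Longrightarrow> j < M \<Longrightarrow> set_integrable lebesgue
      (chart_map (c i) ` (chart_dom (c i) \<inter> chart_dom (d j) \<inter> S)) (chart_density (c i) (\<lambda>p. \<rho> i p * \<sigma> j p) w)"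
    and "(\<Sum>i<N. set_lebesgue_integral lebesgue (chart_map (c i) ` (chart_dom (c i) \<inter> S)) (chart_density (c i) (\<rho> i) w))
      = (\<Sum>i<N. \<Sum>j<M. set_lebesgue_integral lebesgue
        (chart_map (c i) ` (chart_dom (c i) \<inter> chart_dom (d j) \<inter> S)) (chart_density (c i) (\<lambda>p. \<rho> i p * \<sigma> j p) w))"
proof -
  have ch: "is_chart (c i)" if "i < N" for i
    using \<rho> that by (auto intro!: atlas_is_chart[OF A] simp: partition_of_unity_def)
  have 0: "\<rho> i p * \<sigma> j p = 0" if "i < N" "j < M" "p \<notin> chart_dom (d j)" for i j p
    using partition_of_unity_outside[OF \<sigma> that(2,3)] by simp
  have prod: "chart_density (c i) (\<lambda>p. \<rho> i p * \<sigma> j p) w = (\<lambda>x. \<sigma> j (chart_inv (c i) x) * chart_density (c i) (\<rho> i) w x)" for i j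
    by (auto simp: chart_density_def)
  have I: "set_integrable lebesgue (chart_map (c i) ` (chart_dom (c i) \<inter> S)) (chart_density (c i) (\<lambda>p. \<rho> i p * \<sigma> j p) w)"
    if ij: "i < N" "j < M" for i j
    unfolding prod
  proof (rule set_integrable_bounded_continuous_mult[OF _ _ _ int[OF ij(1)]])
    show "open (chart_map (c i) ` (chart_dom (c i) \<inter> S))"
      using S chart_dom_open[OF ch] ij by (intro chart_map_open_image ch) auto
    have "continuous_on UNIV (\<sigma> j)"
      using \<sigma> ij by (intro smooth_fun_continuous[OF A]) (simp add: partition_of_unity_def)
    then have "continuous_on (chart_img (c i)) (\<lambda>x. \<sigma> j (chart_inv (c i) x))"
      using chart_inv_continuous[OF ch[OF ij(1)]] by (rule continuous_on_compose2) auto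
    then show "continuous_on (chart_map (c i) ` (chart_dom (c i) \<inter> S)) (\<lambda>x. \<sigma> j (chart_inv (c i) x))"
      by (rule continuous_on_subset) (auto simp: chart_img_def)
  qed (use partition_of_unity_le_1[OF \<sigma> ij(2)] in auto)
  show "set_integrable lebesgue (chart_map (c i) ` (chart_dom (c i) \<inter> chart_dom (d j) \<inter> S))
      (chart_density (c i) (\<lambda>p. \<rho> i p * \<sigma> j p) w)" if ij: "i < N" "j < M" for i j
    using I[OF ij] by (subst chart_density_restrict(1)[OF ch[OF ij(1)] 0[OF ij], symmetric])
  show "(\<Sum>i<N. set_lebesgue_integral lebesgue (chart_map (c i) ` (chart_dom (c i) \<inter> S)) (chart_density (c i) (\<rho> i) w))
      = (\<Sum>i<N. \<Sum>j<M. set_lebesgue_integral lebesgue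
        (chart_map (c i) ` (chart_dom (c i) \<inter> chart_dom (d j) \<inter> S)) (chart_density (c i) (\<lambda>p. \<rho> i p * \<sigma> j p) w))"
  proof (rule sum.cong[OF refl])
    fix i assume i: "i \<in> {..<N}"
    have "(\<Sum>j<M. \<sigma> j p) = 1" for p using \<sigma> by (simp add: partition_of_unity_def)
    then have "chart_density (c i) (\<rho> i) w x = (\<Sum>j<M. chart_density (c i) (\<lambda>p. \<rho> i p * \<sigma> j p) w x)" for x
      by (simp add: prod flip: sum_distrib_right)
    then have "set_lebesgue_integral lebesgue (chart_map (c i) ` (chart_dom (c i) \<inter> S)) (chart_density (c i) (\<rho> i) w)
      = (\<Sum>j<M. set_lebesgue_integral lebesgue (chart_map (c i) ` (chart_dom (c i) \<inter> S)) (chart_density (c i) (\<lambda>p. \<rho> i p * \<sigma> j p) w))"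
      using I i by (simp add: set_lebesgue_integral_def sum_distrib_left set_integrable_def
          del: sum_indicator_mult flip: Bochner_Integration.integral_sum)
    also have "\<dots> = (\<Sum>j<M. set_lebesgue_integral lebesgue
        (chart_map (c i) ` (chart_dom (c i) \<inter> chart_dom (d j) \<inter> S)) (chart_density (c i) (\<lambda>p. \<rho> i p * \<sigma> j p) w))"
      using i 0 by (intro sum.cong chart_density_restrict(2) ch) auto
    finally show "set_lebesgue_integral lebesgue (chart_map (c i) ` (chart_dom (c i) \<inter> S)) (chart_density (c i) (\<rho> i) w) = \<dots>" .
  qed
qed

text \<open>Both values refine to double sums over the same products of weights, and the change of
  charts identifies the terms. The law of transformation is assumed in place of
  \<open>two_form\<close> because the form to be integrated blows up at the zero set.\<close>

lemma has_form_integral_unique: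
  assumes A: "oriented_atlas A" and S: "open S"
    and w: "\<And>c d p. c \<in> A \<Longrightarrow> d \<in> A \<Longrightarrow> p \<in> chart_dom c \<inter> chart_dom d \<Longrightarrow>
        w c p = jacobian (transition c d) (chart_map c p) * w d p"
    and I: "has_form_integral A w S I" and I': "has_form_integral A w S I'"
  shows "I = I'"
proof -
  obtain N c \<rho> where \<rho>: "partition_of_unity A N c \<rho>"
    and int\<rho>: "\<And>i. i < N \<Longrightarrow> set_integrable lebesgue (chart_map (c i) ` (chart_dom (c i) \<inter> S)) (chart_density (c i) (\<rho> i) w)"
    and I_eq: "I = (\<Sum>i<N. set_lebesgue_integral lebesgue (chart_map (c i) ` (chart_dom (c i) \<inter> S)) (chart_density (c i) (\<rho> i) w))"
    using I unfolding has_form_integral_alt by blast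
  obtain M d \<sigma> where \<sigma>: "partition_of_unity A M d \<sigma>"
    and int\<sigma>: "\<And>i. i < M \<Longrightarrow> set_integrable lebesgue (chart_map (d i) ` (chart_dom (d i) \<inter> S)) (chart_density (d i) (\<sigma> i) w)"
    and I'_eq: "I' = (\<Sum>i<M. set_lebesgue_integral lebesgue (chart_map (d i) ` (chart_dom (d i) \<inter> S)) (chart_density (d i) (\<sigma> i) w))"
    using I' unfolding has_form_integral_alt by blast
  have "I = (\<Sum>i<N. \<Sum>j<M. set_lebesgue_integral lebesgue
        (chart_map (c i) ` (chart_dom (c i) \<inter> chart_dom (d j) \<inter> S)) (chart_density (c i) (\<lambda>p. \<rho> i p * \<sigma> j p) w))"
    unfolding I_eq by (rule form_integral_refine(2)[OF A S \<rho> \<sigma> int\<rho>])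
  also have "\<dots> = (\<Sum>i<N. \<Sum>j<M. set_lebesgue_integral lebesgue
        (chart_map (d j) ` (chart_dom (d j) \<inter> chart_dom (c i) \<inter> S)) (chart_density (d j) (\<lambda>p. \<sigma> j p * \<rho> i p) w))"
  proof (intro sum.cong refl)
    fix i j assume ij: "i \<in> {..<N}" "j \<in> {..<M}"
    then have cd: "c i \<in> A" "d j \<in> A" using \<rho> \<sigma> by (auto simp: partition_of_unity_def)
    have "set_integrable lebesgue (chart_map (d j) ` (chart_dom (d j) \<inter> chart_dom (c i) \<inter> S)) (chart_density (d j) (\<lambda>p. \<sigma> j p * \<rho> i p) w)"
      using ij by (intro form_integral_refine(1)[OF A S \<sigma> \<rho> int\<sigma>]) auto
    then show "set_lebesgue_integral lebesgue
        (chart_map (c i) ` (chart_dom (c i) \<inter> chart_dom (d j) \<inter> S)) (chart_density (c i) (\<lambda>p. \<rho> i p * \<sigma> j p) w)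
      = set_lebesgue_integral lebesgue
        (chart_map (d j) ` (chart_dom (d j) \<inter> chart_dom (c i) \<inter> S)) (chart_density (d j) (\<lambda>p. \<sigma> j p * \<rho> i p) w)"
      using chart_density_change_chart(2)[where w = w, OF A cd S w[OF cd], of "\<lambda>p. \<rho> i p * \<sigma> j p"]
      by (simp add: mult.commute Int_commute)
  qed
  also have "\<dots> = (\<Sum>j<M. \<Sum>i<N. set_lebesgue_integral lebesgue
        (chart_map (d j) ` (chart_dom (d j) \<inter> chart_dom (c i) \<inter> S)) (chart_density (d j) (\<lambda>p. \<sigma> j p * \<rho> i p) w))"
    by (rule sum.swap)
  also have "\<dots> = I'"
    unfolding I'_eq by (rule form_integral_refine(2)[OF A S \<sigma> \<rho> int\<sigma>, symmetric])
  finally show ?thesis .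
qed

text \<open>\<open>form_integral\<close> is a definite description; uniqueness is what allows
  evaluating it with one conveniently chosen partition of unity.\<close>

lemma form_integral_eq:
  assumes "oriented_atlas A" "open S"
    and "\<And>c d p. c \<in> A \<Longrightarrow> d \<in> A \<Longrightarrow> p \<in> chart_dom c \<inter> chart_dom d \<Longrightarrow>
        w c p = jacobian (transition c d) (chart_map c p) * w d p"
    and "has_form_integral A w S I"
  shows "form_integral A w S = I"
  unfolding form_integral_def
proof (rule the_equality[where P = "has_form_integral A w S", OF assms(4)])
  show "I' = I" if "has_form_integral A w S I'" for I'
    by (rule has_form_integral_unique[OF assms(1,2) assms(3) that assms(4)])
qed

subsection \<open>Principal values on the line\<close>

lemma open_superlevel:
  fixes f :: "'a::topological_space \<Rightarrow> real"
  assumes "open U" "continuous_on U f"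
  shows "open {z \<in> U. c < f z}"
proof -
  from continuous_on_open_vimage[OF assms(1), THEN iffD1, OF assms(2), rule_format, of "{c<..}"]
  show ?thesis by (simp add: vimage_def Int_def conj_commute)
qed

lemma truncated_quotient_measurable:
  fixes F \<phi> h :: "'a::euclidean_space \<Rightarrow> real"
  assumes "open U" "continuous_on U \<phi>" "continuous_on U F" "continuous_on U h"
  shows "(\<lambda>z. indicator {z \<in> U. \<bar>h z\<bar> > \<epsilon>} z *\<^sub>R (\<phi> z / F z)) \<in> borel_measurable borel"
proof -
  have [measurable]: "(\<lambda>z. indicator U z *\<^sub>R \<phi> z) \<in> borel_measurable borel"
    "(\<lambda>z. indicator U z *\<^sub>R F z) \<in> borel_measurable borel"
    using assms by (auto intro!: borel_measurable_continuous_on_indicator simp del: real_scaleR_def)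
  have [measurable]: "{z \<in> U. \<bar>h z\<bar> > \<epsilon>} \<in> sets borel"
    using open_superlevel[OF assms(1) continuous_on_rabs[OF assms(4)]] by simp
  have "(\<lambda>z. indicator {z \<in> U. \<bar>h z\<bar> > \<epsilon>} z *\<^sub>R ((indicator U z *\<^sub>R \<phi> z) / (indicator U z *\<^sub>R F z))) \<in> borel_measurable borel"
    by measurable
  moreover have "(\<lambda>z. indicator {z \<in> U. \<bar>h z\<bar> > \<epsilon>} z *\<^sub>R ((indicator U z *\<^sub>R \<phi> z) / (indicator U z *\<^sub>R F z)))
      = (\<lambda>z. indicator {z \<in> U. \<bar>h z\<bar> > \<epsilon>} z *\<^sub>R (\<phi> z / F z))"
    by (auto simp: fun_eq_iff indicator_def)
  ultimately show ?thesis by simp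
qed

text \<open>Serves two purposes below: integrability of a singular integrand after truncation, and
  smallness of an error concentrated on a small set.\<close>

lemma integral_bounded_support:
  fixes f :: "'a \<Rightarrow> real"
  assumes "f \<in> borel_measurable M" "S \<in> fmeasurable M" "\<And>x. \<bar>f x\<bar> \<le> c * indicator S x"
  shows "integrable M f" "\<bar>integral\<^sup>L M f\<bar> \<le> c * measure M S"
proof -
  have S: "integrable M (\<lambda>x. c * indicator S x)"
    using assms(2) by (intro integrable_mult_right integrable_real_indicator) (auto simp: fmeasurable_def)
  show f: "integrable M f"
    by (rule Bochner_Integration.integrable_bound[OF S assms(1)])
      (intro AE_I2, use assms(3) in \<open>simp add: order.trans[OF _ abs_ge_self]\<close>)
  have "\<bar>integral\<^sup>L M f\<bar> \<le> (\<integral>x. \<bar>f x\<bar> \<partial>M)"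
    using integral_abs_bound by blast
  also have "\<dots> \<le> (\<integral>x. c * indicator S x \<partial>M)"
    using f by (intro integral_mono S assms(3)) auto
  also have "\<dots> = c * measure M S"
    using assms(2) by (simp add: fmeasurable_def Int_absorb2 sets.sets_into_space)
  finally show "\<bar>integral\<^sup>L M f\<bar> \<le> c * measure M S" .
qed

lemma integral_reflect:
  fixes f :: "real \<Rightarrow> real"
  shows "(\<integral>t. f (- t) \<partial>lborel) = (\<integral>t. f t \<partial>lborel)"
  using lborel_integral_real_affine[of "-1" f 0] by simp

text \<open>
  The two truncation sets differ on a set of length \<open>O(\<eta> r)\<close>, on which the kernel is \<open>O(1 / r)\<close>;
  hence an error that does not depend on \<open>r\<close>.
\<close>
lemma principal_value_truncation:
  fixes k :: "real \<Rightarrow> real"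
  assumes k[measurable]: "k \<in> borel_measurable borel" and A[measurable]: "A \<in> sets borel"
    and C: "\<And>t. \<bar>t\<bar> * \<bar>k t\<bar> \<le> C" "\<And>t. \<bar>k t + k (- t)\<bar> \<le> C"
    and supp: "\<And>t. \<bar>t\<bar> \<ge> T \<Longrightarrow> k t = 0"
    and r: "r > 0" and \<eta>: "0 < \<eta>" "\<eta> \<le> 1 / 2"
    and mismatch: "\<And>t. \<bar>t\<bar> < T \<Longrightarrow> (t \<in> A) \<noteq> (\<bar>t\<bar> > r) \<Longrightarrow>
      r / (1 + \<eta>) \<le> \<bar>t\<bar> \<and> \<bar>t\<bar> \<le> r / (1 - \<eta>)"
  shows "integrable lborel (\<lambda>t. indicator A t * k t)"
    and "\<bar>(\<integral>t. indicator A t * k t \<partial>lborel) - (\<integral>t. indicator {0<..} t * (k t + k (- t)) \<partial>lborel)\<bar>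
      \<le> 8 * C * \<eta> + C * r"
proof -
  have C0: "C \<ge> 0" using C(2)[of 0] by linarith
  define \<alpha> \<beta> where "\<alpha> = r / (1 + \<eta>)" and "\<beta> = r / (1 - \<eta>)"
  have \<alpha>\<beta>: "0 < \<alpha>" "\<alpha> < \<beta>" using r \<eta> by (auto simp: \<alpha>_def \<beta>_def field_simps)
  \<comment> \<open>\<open>B\<close> is the symmetric truncation, and \<open>E\<close> the change of
    the integrand when \<open>A\<close> replaces it.\<close>
  define B where "B = {t::real. \<bar>t\<bar> > r}"
  have [measurable]: "B \<in> sets borel" unfolding B_def by measurable
  define E where "E t = (indicator A t - indicator B t) * k t" for t
  have bd: "\<bar>k t\<bar> \<le> C / s" if "s > 0" "\<bar>t\<bar> \<ge> s" for s t
  proof -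
    have "s * \<bar>k t\<bar> \<le> C" using C(1)[of t] mult_right_mono[OF that(2), of "\<bar>k t\<bar>"] by linarith
    then show ?thesis using that by (simp add: field_simps)
  qed
  define S where "S = {\<alpha>..\<beta>} \<union> {-\<beta>..-\<alpha>}"
  have S: "S \<in> fmeasurable lborel" "measure lborel S \<le> 2 * (\<beta> - \<alpha>)"
    using \<alpha>\<beta> measure_Un_le[of "{\<alpha>..\<beta>}" lborel "{-\<beta>..-\<alpha>}"]
      emeasure_bounded_finite[of S]
    by (auto simp: S_def fmeasurable_def)
  have Eb: "\<bar>E t\<bar> \<le> C / \<alpha> * indicator S t" for t
  proof (cases "E t = 0")
    case True then show ?thesis using C0 \<alpha>\<beta> by (simp add: indicator_def)
  next
    case False
    then have "k t \<noteq> 0" "(t \<in> A) \<noteq> (\<bar>t\<bar> > r)"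
      by (auto simp: E_def B_def indicator_def split: if_splits)
    \<comment> \<open>The mismatch hypothesis reaches only to |t| < \<open>T\<close>; beyond that
      \<open>k\<close> vanishes.\<close>
    moreover from this(1) have "\<bar>t\<bar> < T" using supp[of t] by force
    ultimately have *: "\<alpha> \<le> \<bar>t\<bar>" "\<bar>t\<bar> \<le> \<beta>"
      using mismatch[of t] unfolding \<alpha>_def \<beta>_def by blast+
    then have "t \<in> S" by (auto simp: S_def abs_if split: if_splits)
    moreover have "\<bar>E t\<bar> \<le> \<bar>k t\<bar>" by (auto simp: E_def abs_mult indicator_def)
    ultimately show ?thesis using bd[OF \<alpha>\<beta>(1) *(1)] by simp
  qed
  have [measurable]: "E \<in> borel_measurable lborel" unfolding E_def by measurable
  have Eint: "integrable lborel E" "\<bar>integral\<^sup>L lborel E\<bar> \<le> C / \<alpha> * measure lborel S"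
    using integral_bounded_support[OF _ S(1) Eb] by auto
  \<comment> \<open>The quotient (\<beta> - \<alpha>) / \<alpha> is 2 \<eta> / (1 - \<eta>), from
    which \<open>r\<close> has cancelled. The two sides of the origin double it, and 1 - \<eta> is
    at least 1/2; hence the constant 8.\<close>
  have "C / \<alpha> * measure lborel S \<le> C / \<alpha> * (2 * (\<beta> - \<alpha>))"
    using S(2) C0 \<alpha>\<beta> by (intro mult_left_mono) auto
  also have "\<dots> = C * (4 * \<eta> / (1 - \<eta>))"
    using r \<eta> by (simp add: \<alpha>_def \<beta>_def divide_simps) (simp add: algebra_simps)
  also have "\<dots> \<le> C * (8 * \<eta>)"
    using \<eta> C0 by (intro mult_left_mono) (auto simp: divide_simps)
  finally have E: "\<bar>integral\<^sup>L lborel E\<bar> \<le> 8 * C * \<eta>" using Eint(2) by simp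
  have tail: "integrable lborel (\<lambda>t. indicator {r<..} t * k (c * t))" if c: "\<bar>c\<bar> = 1" for c
  proof (rule integral_bounded_support(1)[where S = "{- \<bar>T\<bar>..\<bar>T\<bar>}" and c = "C / r"])
    show "\<bar>indicator {r<..} t * k (c * t)\<bar> \<le> C / r * indicator {- \<bar>T\<bar>..\<bar>T\<bar>} t" for t
      using bd[OF r, of "c * t"] supp[of "c * t"] C0 r c
      by (auto simp: indicator_def abs_mult abs_le_iff split: if_splits)
  qed (auto simp: fmeasurable_def intro!: emeasure_bounded_finite)
  have plus: "integrable lborel (\<lambda>t. indicator {r<..} t * k t)"
    and minus: "integrable lborel (\<lambda>t. indicator {r<..} t * k (- t))"
    using tail[of 1] tail[of "-1"] by simp_all
  have minus': "integrable lborel (\<lambda>t. indicator {r<..} (- t) * k t)"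
    using lborel_integrable_real_affine[OF minus, of "-1" 0] by simp
  \<comment> \<open>Folding the negative half-line onto the positive one brings in the sum
    \<open>k t + k (- t)\<close>, which stays bounded as t tends to 0.\<close>
  have Bsplit: "indicator B t * k t = indicator {r<..} t * k t + indicator {r<..} (- t) * k t" for t
    using r by (auto simp: B_def indicator_def)
  have Bint: "integrable lborel (\<lambda>t. indicator B t * k t)"
    unfolding Bsplit using plus minus' by (rule Bochner_Integration.integrable_add)
  have "(\<integral>t. indicator B t * k t \<partial>lborel)
      = (\<integral>t. indicator {r<..} t * k t \<partial>lborel) + (\<integral>t. indicator {r<..} (- t) * k t \<partial>lborel)"
    unfolding Bsplit using plus minus' by (rule Bochner_Integration.integral_add)
  also have "(\<integral>t. indicator {r<..} (- t) * k t \<partial>lborel) = (\<integral>t. indicator {r<..} t * k (- t) \<partial>lborel)"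
    using integral_reflect[of "\<lambda>t. indicator {r<..} (- t) * k t"] by simp
  also have "(\<integral>t. indicator {r<..} t * k t \<partial>lborel) + \<dots> = (\<integral>t. indicator {r<..} t * (k t + k (- t)) \<partial>lborel)"
    using plus minus by (simp add: distrib_left)
  finally have Beq: "(\<integral>t. indicator B t * k t \<partial>lborel) = (\<integral>t. indicator {r<..} t * (k t + k (- t)) \<partial>lborel)" .
  \<comment> \<open>The integral over all positive t differs from the symmetric truncation by the
    interval up to \<open>r\<close>, where the bounded sum contributes at most
    \<open>C * r\<close>.\<close>
  have m: "{0<..r} \<in> fmeasurable lborel"
    using emeasure_bounded_finite[of "{0<..r}"] by (simp add: fmeasurable_def)
  have "\<bar>indicator {0<..r} t * (k t + k (- t))\<bar> \<le> C * indicator {0<..r} t" for t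
    using C(2) C0 by (simp add: indicator_def)
  from integral_bounded_support[OF _ m this]
  have gap: "integrable lborel (\<lambda>t. indicator {0<..r} t * (k t + k (- t)))"
    "\<bar>\<integral>t. indicator {0<..r} t * (k t + k (- t)) \<partial>lborel\<bar> \<le> C * measure lborel {0<..r}"
    by auto
  have "integrable lborel (\<lambda>t. indicator {r<..} t * (k t + k (- t)))"
    using plus minus by (simp add: distrib_left)
  then have "(\<integral>t. indicator {0<..r} t * (k t + k (- t)) + indicator {r<..} t * (k t + k (- t)) \<partial>lborel)
      = (\<integral>t. indicator {0<..r} t * (k t + k (- t)) \<partial>lborel) + (\<integral>t. indicator {r<..} t * (k t + k (- t)) \<partial>lborel)"
    using gap(1) by (intro Bochner_Integration.integral_add)
  moreover have "indicator {0<..r} t * (k t + k (- t)) + indicator {r<..} t * (k t + k (- t))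
      = indicator {0<..} t * (k t + k (- t))" for t
    using r by (auto simp: indicator_def)
  moreover have AE: "indicator A t * k t = E t + indicator B t * k t" for t
    by (simp add: E_def algebra_simps)
  moreover have "(\<integral>t. E t + indicator B t * k t \<partial>lborel) = integral\<^sup>L lborel E + (\<integral>t. indicator B t * k t \<partial>lborel)"
    using Eint(1) Bint by (rule Bochner_Integration.integral_add)
  ultimately show "\<bar>(\<integral>t. indicator A t * k t \<partial>lborel) - (\<integral>t. indicator {0<..} t * (k t + k (- t)) \<partial>lborel)\<bar>
      \<le> 8 * C * \<eta> + C * r"
    using E gap(2) Beq r by simp
  show "integrable lborel (\<lambda>t. indicator A t * k t)"
    unfolding AE using Eint(1) Bint by (rule Bochner_Integration.integrable_add)
qed

subsection \<open>A box in which the zero set is a graph\<close>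

definition deriv_x :: "(real \<times> real \<Rightarrow> real) \<Rightarrow> real \<times> real \<Rightarrow> real" where
  "deriv_x G z = frechet_derivative G (at z) (1, 0)"

definition deriv_y :: "(real \<times> real \<Rightarrow> real) \<Rightarrow> real \<times> real \<Rightarrow> real" where
  "deriv_y G z = frechet_derivative G (at z) (0, 1)"

lemma smooth_on_deriv_x: "smooth_on U G \<Longrightarrow> smooth_on U (deriv_x G)"
  and smooth_on_deriv_y: "smooth_on U G \<Longrightarrow> smooth_on U (deriv_y G)"
  unfolding deriv_x_def[abs_def] deriv_y_def[abs_def] by (fact smooth_on_frechet_derivative)+

lemma frechet_derivative_pair:
  assumes "smooth_on U G" "z \<in> U"
  shows "frechet_derivative G (at z) (s, t) = s * deriv_x G z + t * deriv_y G z"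
proof -
  have "linear (frechet_derivative G (at z))"
    using smooth_on_has_derivative[OF assms] has_derivative_linear by blast
  from linear_add[OF this, of "s *\<^sub>R (1, 0)" "t *\<^sub>R (0, 1)"] linear_cmul[OF this, of s "(1, 0)"]
    linear_cmul[OF this, of t "(0, 1)"]
  show ?thesis by (simp add: deriv_x_def deriv_y_def)
qed

lemma has_derivative_pair:
  assumes "smooth_on U G" "z \<in> U"
  shows "(G has_derivative (\<lambda>(s, t). s * deriv_x G z + t * deriv_y G z)) (at z)"
proof -
  have "frechet_derivative G (at z) = (\<lambda>(s, t). s * deriv_x G z + t * deriv_y G z)"
    using frechet_derivative_pair[OF assms] by auto
  then show ?thesis using smooth_on_has_derivative[OF assms] by simp
qed

lemma has_real_derivative_vertical:
  assumes "smooth_on U G" "(x, y) \<in> U"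
  shows "((\<lambda>y. G (x, y)) has_real_derivative deriv_y G (x, y)) (at y within T)"
proof -
  have "((\<lambda>y. (x, y)) has_derivative (\<lambda>t. (0, t))) (at y within T)"
    by (auto intro!: derivative_eq_intros)
  from diff_chain_within[OF this has_derivative_at_withinI[OF has_derivative_pair[OF assms]]]
  show ?thesis by (simp add: has_field_derivative_def o_def mult.commute[of _ "deriv_y G (x, y)"])
qed

lemma has_real_derivative_horizontal:
  assumes "smooth_on U G" "(x, y) \<in> U"
  shows "((\<lambda>x. G (x, y)) has_real_derivative deriv_x G (x, y)) (at x within T)"
proof -
  have "((\<lambda>x. (x, y)) has_derivative (\<lambda>s. (s, 0))) (at x within T)"
    by (auto intro!: derivative_eq_intros)
  from diff_chain_within[OF this has_derivative_at_withinI[OF has_derivative_pair[OF assms]]]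
  show ?thesis by (simp add: has_field_derivative_def o_def mult.commute[of _ "deriv_x G (x, y)"])
qed

lemma vertical_increment_le:
  assumes "smooth_on U G" "\<And>y. y \<in> J \<Longrightarrow> (x, y) \<in> U \<and> \<bar>deriv_y G (x, y)\<bar> \<le> B"
    and "convex J" "y \<in> J" "y' \<in> J"
  shows "\<bar>G (x, y) - G (x, y')\<bar> \<le> B * \<bar>y - y'\<bar>"
proof -
  have "norm (G (x, y) - G (x, y')) \<le> B * norm (y - y')"
    by (rule field_differentiable_bound[of J "\<lambda>y. G (x, y)" "\<lambda>y. deriv_y G (x, y)"])
      (use assms has_real_derivative_vertical[OF assms(1)] in auto)
  then show ?thesis by simp
qed

lemma horizontal_increment_le:
  assumes "smooth_on U G" "\<And>x. x \<in> J \<Longrightarrow> (x, y) \<in> U \<and> \<bar>deriv_x G (x, y)\<bar> \<le> B"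
    and "convex J" "x \<in> J" "x' \<in> J"
  shows "\<bar>G (x, y) - G (x', y)\<bar> \<le> B * \<bar>x - x'\<bar>"
proof -
  have "norm (G (x, y) - G (x', y)) \<le> B * norm (x - x')"
    by (rule field_differentiable_bound[of J "\<lambda>x. G (x, y)" "\<lambda>x. deriv_x G (x, y)"])
      (use assms has_real_derivative_horizontal[OF assms(1)] in auto)
  then show ?thesis by simp
qed

text \<open>Mean value inequality for \<open>G\<close> minus its linear part along the vertical,
  whose derivative is at most \<open>B * \<bar>t\<bar>\<close> on the segment. This gives the
  constant \<open>B\<close> instead of the sharp \<open>B / 2\<close>.\<close>

lemma vertical_taylor:
  assumes G: "smooth_on U G" and J: "\<And>y. y \<in> J \<Longrightarrow> (x, y) \<in> U \<and> \<bar>deriv_y (deriv_y G) (x, y)\<bar> \<le> B"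
    and "convex J" "y \<in> J" "y + t \<in> J"
  shows "\<bar>G (x, y + t) - G (x, y) - deriv_y G (x, y) * t\<bar> \<le> B * t\<^sup>2"
proof -
  let ?S = "closed_segment y (y + t)"
  have S: "?S \<subseteq> J" using assms by (simp add: closed_segment_subset)
  have B: "B \<ge> 0" using J[of y] assms(4) by force
  have "norm ((G (x, y + t) - deriv_y G (x, y) * (y + t)) - (G (x, y) - deriv_y G (x, y) * y))
      \<le> B * \<bar>t\<bar> * norm (y + t - y)"
  proof (rule field_differentiable_bound[of ?S "\<lambda>s. G (x, s) - deriv_y G (x, y) * s" "\<lambda>s. deriv_y G (x, s) - deriv_y G (x, y)"])
    fix s assume s: "s \<in> ?S"
    then have "(x, s) \<in> U" using S J by blast
    then show "((\<lambda>s. G (x, s) - deriv_y G (x, y) * s) has_field_derivative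
        deriv_y G (x, s) - deriv_y G (x, y)) (at s within ?S)"
      by (auto intro!: derivative_eq_intros has_real_derivative_vertical[OF G])
    have "\<bar>deriv_y G (x, s) - deriv_y G (x, y)\<bar> \<le> B * \<bar>s - y\<bar>"
      by (rule vertical_increment_le[OF smooth_on_deriv_y[OF G] J]) (use assms S s in auto)
    also have "\<dots> \<le> B * \<bar>t\<bar>"
      using s B by (intro mult_left_mono) (auto simp: closed_segment_eq_real_ivl split: if_splits)
    finally show "norm (deriv_y G (x, s) - deriv_y G (x, y)) \<le> B * \<bar>t\<bar>" by simp
  qed auto
  then show ?thesis by (simp add: algebra_simps power2_eq_square abs_mult)
qed

text \<open>Test functions will be supported in \<open>W\<close>, within \<delta> of height b, and
  the graph also stays within \<delta> of b. Relevant offsets from the graph are therefore shorter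
  than 2 \<delta>, and both an offset and its reflection stay within 3 \<delta> of b: hence the
  height of \<open>R\<close>. The value 0 off \<open>X\<close> makes \<open>y\<^sub>0\<close> a
  Borel function on the whole line.\<close>

locale graph_box =
  fixes U :: "(real \<times> real) set" and F :: "real \<times> real \<Rightarrow> real"
    and a b \<eta> \<delta> m :: real and y\<^sub>0 :: "real \<Rightarrow> real" and X Y R W
  defines "X \<equiv> {a - \<eta>..a + \<eta>}" and "Y \<equiv> {b - 3 * \<delta>..b + 3 * \<delta>}" and "R \<equiv> X \<times> Y"
    and "W \<equiv> {a - \<eta><..<a + \<eta>} \<times> {b - \<delta><..<b + \<delta>}"
  assumes U: "open U" and F: "smooth_on U F"
    and pos: "\<eta> > 0" "\<delta> > 0" "m > 0"
    and box: "R \<subseteq> U"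
    and F_y: "\<And>z. z \<in> R \<Longrightarrow> m \<le> deriv_y F z"
    and y\<^sub>0_mem: "\<And>x. x \<in> X \<Longrightarrow> y\<^sub>0 x \<in> {b - \<delta><..<b + \<delta>}"
    and y\<^sub>0_zero: "\<And>x. x \<in> X \<Longrightarrow> F (x, y\<^sub>0 x) = 0"
    and y\<^sub>0_outside: "\<And>x. x \<notin> X \<Longrightarrow> y\<^sub>0 x = 0"
begin

lemma compact_R: "compact R"
  by (simp add: R_def X_def Y_def compact_Times)

lemma W_subset_R: "W \<subseteq> R"
  using pos by (auto simp: W_def R_def X_def Y_def)

lemma shifted_mem_Y: "x \<in> X \<Longrightarrow> \<bar>t\<bar> < 2 * \<delta> \<Longrightarrow> y\<^sub>0 x + t \<in> Y"
  using y\<^sub>0_mem[of x] by (auto simp: Y_def abs_if split: if_splits)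

lemma y\<^sub>0_mem_Y: "x \<in> X \<Longrightarrow> y\<^sub>0 x \<in> Y"
  using shifted_mem_Y[of x 0] pos by simp

lemma shifted_notin_W: "x \<in> X \<Longrightarrow> \<bar>t\<bar> \<ge> 2 * \<delta> \<Longrightarrow> (x', y\<^sub>0 x + t) \<notin> W"
  using y\<^sub>0_mem[of x] by (auto simp: W_def abs_if split: if_splits)

lemma bounded_on_R:
  fixes G :: "real \<times> real \<Rightarrow> real"
  assumes "smooth_on U G"
  obtains B where "B > 0" "\<And>z. z \<in> R \<Longrightarrow> \<bar>G z\<bar> \<le> B"
proof -
  have "compact (G ` R)"
    using smooth_on_imp_continuous_on[OF assms] box compact_R
    by (intro compact_continuous_image) (auto intro: continuous_on_subset)
  then obtain B where "B > 0" "\<forall>y\<in>G ` R. norm y \<le> B"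
    using compact_imp_bounded bounded_pos by blast
  then show thesis using that[of B] by simp
qed

text \<open>The mean value theorem turns the lower bound on the vertical derivative into linear
  growth. Uniqueness of the zero, the Lipschitz bound for the graph and the order 1/|t| of the
  kernel all rest on it.\<close>

lemma F_lower:
  assumes "x \<in> X" "y \<in> Y" "y' \<in> Y"
  shows "m * \<bar>y - y'\<bar> \<le> \<bar>F (x, y) - F (x, y')\<bar>"
  using assms(2,3)
proof (induction y y' rule: linorder_wlog)
  case (le y y')
  show ?case
  proof (cases "y = y'")
    case False
    have "\<exists>z. z > y \<and> z < y' \<and> F (x, y') - F (x, y) = (y' - y) * deriv_y F (x, z)"
      using False le box assms(1)
      by (intro MVT2 has_real_derivative_vertical[OF F]) (auto simp: R_def Y_def)
    then obtain z where z: "z > y" "z < y'" "F (x, y') - F (x, y) = (y' - y) * deriv_y F (x, z)" by blast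
    then have "m \<le> deriv_y F (x, z)"
      using le assms(1) by (intro F_y) (auto simp: R_def Y_def)
    then have "(y' - y) * m \<le> F (x, y') - F (x, y)"
      unfolding z(3) using le by (intro mult_left_mono) auto
    then show ?thesis using le by (simp add: abs_if mult.commute split: if_splits)
  qed simp
next
  case (sym y y')
  then show ?case by (simp add: abs_minus_commute)
qed

lemma F_lower_shifted: "x \<in> X \<Longrightarrow> \<bar>t\<bar> < 2 * \<delta> \<Longrightarrow> m * \<bar>t\<bar> \<le> \<bar>F (x, y\<^sub>0 x + t)\<bar>"
  using F_lower[of x "y\<^sub>0 x + t" "y\<^sub>0 x"] shifted_mem_Y[of x t] y\<^sub>0_mem_Y[of x] y\<^sub>0_zero[of x] by simp

lemma F_eq_0_iff: "x \<in> X \<Longrightarrow> y \<in> Y \<Longrightarrow> F (x, y) = 0 \<longleftrightarrow> y = y\<^sub>0 x"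
  using F_lower[of x y "y\<^sub>0 x"] y\<^sub>0_mem_Y[of x] y\<^sub>0_zero[of x] pos
  by (auto simp: mult_le_0_iff)

lemma y\<^sub>0_lipschitz:
  obtains K where "K > 0" "\<And>x x'. x \<in> X \<Longrightarrow> x' \<in> X \<Longrightarrow> \<bar>y\<^sub>0 x - y\<^sub>0 x'\<bar> \<le> K * \<bar>x - x'\<bar>"
proof -
  obtain B where B: "B > 0" "\<And>z. z \<in> R \<Longrightarrow> \<bar>deriv_x F z\<bar> \<le> B"
    using bounded_on_R[OF smooth_on_deriv_x[OF F]] by blast
  have "\<bar>y\<^sub>0 x - y\<^sub>0 x'\<bar> \<le> B / m * \<bar>x - x'\<bar>" if x: "x \<in> X" "x' \<in> X" for x x'
  proof -
    have "m * \<bar>y\<^sub>0 x - y\<^sub>0 x'\<bar> \<le> \<bar>F (x, y\<^sub>0 x) - F (x, y\<^sub>0 x')\<bar>"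
      using x by (intro F_lower y\<^sub>0_mem_Y)
    \<comment> \<open>\<open>F\<close> vanishes at the graph points over x and over x', so a
      vertical increment over x equals a horizontal one at height
      \<open>y\<^sub>0 x'\<close>.\<close>
    also have "\<dots> = \<bar>F (x, y\<^sub>0 x') - F (x', y\<^sub>0 x')\<bar>"
      using y\<^sub>0_zero x by simp
    also have "\<dots> \<le> B * \<bar>x - x'\<bar>"
      by (rule horizontal_increment_le[OF F, of X])
        (use x box B(2) y\<^sub>0_mem_Y[of x'] in \<open>auto simp: R_def X_def\<close>)
    finally show ?thesis using pos by (simp add: field_simps)
  qed
  then show thesis using that[of "B / m"] B(1) pos by simp
qed

lemma y\<^sub>0_continuous: "continuous_on X y\<^sub>0"
proof -
  obtain K where K: "K > 0" "\<And>x x'. x \<in> X \<Longrightarrow> x' \<in> X \<Longrightarrow> \<bar>y\<^sub>0 x - y\<^sub>0 x'\<bar> \<le> K * \<bar>x - x'\<bar>"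
    using y\<^sub>0_lipschitz by blast
  have "K-lipschitz_on X y\<^sub>0"
    using K by (intro lipschitz_onI) (auto simp: dist_real_def)
  then show ?thesis by (rule lipschitz_on_continuous_on)
qed

lemma y\<^sub>0_measurable [measurable]: "y\<^sub>0 \<in> borel_measurable borel"
proof -
  have "(\<lambda>x. indicator X x *\<^sub>R y\<^sub>0 x) \<in> borel_measurable borel"
    using y\<^sub>0_continuous by (intro borel_measurable_continuous_on_indicator) (auto simp: X_def)
  moreover have "(\<lambda>x. indicator X x *\<^sub>R y\<^sub>0 x) = y\<^sub>0"
    using y\<^sub>0_outside by (auto simp: fun_eq_iff indicator_def)
  ultimately show ?thesis by simp
qed

text \<open>
  The curve \<open>y = y\<^sub>0 x\<close> is Lipschitz and \<open>h\<close> vanishes on it, so if the vertical derivative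
  of \<open>h\<close> were zero at one of its points, then so would be the horizontal one.
\<close>
lemma deriv_y_nonzero:
  assumes h: "smooth_on U h" "\<And>z. z \<in> U \<Longrightarrow> h z = 0 \<longleftrightarrow> F z = 0"
    and x: "x \<in> X" and nz: "frechet_derivative h (at (x, y\<^sub>0 x)) \<noteq> (\<lambda>v. 0)"
  shows "deriv_y h (x, y\<^sub>0 x) \<noteq> 0"
proof
  assume y0: "deriv_y h (x, y\<^sub>0 x) = 0"
  let ?z = "(x, y\<^sub>0 x)"
  have in_U: "(x, y\<^sub>0 x) \<in> U" if "x \<in> X" for x
    using that box y\<^sub>0_mem_Y[of x] by (auto simp: R_def)
  have h0: "h (x, y\<^sub>0 x) = 0" if "x \<in> X" for x
    using h(2)[OF in_U] y\<^sub>0_zero that by simp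
  define \<alpha> where "\<alpha> = deriv_x h ?z"
  have "\<alpha> \<noteq> 0"
    using nz frechet_derivative_pair[OF h(1) in_U[OF x]] y0 by (auto simp: \<alpha>_def fun_eq_iff)
  obtain K where K: "K > 0" "\<And>x x'. x \<in> X \<Longrightarrow> x' \<in> X \<Longrightarrow> \<bar>y\<^sub>0 x - y\<^sub>0 x'\<bar> \<le> K * \<bar>x - x'\<bar>"
    using y\<^sub>0_lipschitz by blast
  \<comment> \<open>A step s in x displaces the graph point by at most s (1 + K). With this
    tolerance the differentiability error is at most s |\<alpha>| / 2, half of the linear term it
    has to account for.\<close>
  define e where "e = \<bar>\<alpha>\<bar> / (2 * (1 + K))"
  have e: "e > 0" using \<open>\<alpha> \<noteq> 0\<close> K(1) by (simp add: e_def)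
  obtain d where d: "d > 0" "\<And>z. norm (z - ?z) < d \<Longrightarrow>
      norm (h z - h ?z - (\<lambda>(s, t). s * deriv_x h ?z + t * deriv_y h ?z) (z - ?z)) \<le> e * norm (z - ?z)"
    using has_derivative_pair[OF h(1) in_U[OF x]] e unfolding has_derivative_at_alt by meson
  define s where "s = min \<eta> (d / (2 * (1 + K)))"
  have "s \<le> d / (2 * (1 + K))" by (simp add: s_def)
  then have "s * (1 + K) \<le> d / 2" using K(1) by (simp add: field_simps)
  then have s: "s > 0" "s \<le> \<eta>" "s * (1 + K) < d" using pos d(1) K(1) by (auto simp: s_def)
  \<comment> \<open>Moving towards the centre of \<open>X\<close> by at most \<eta> does not leave
    the interval.\<close>
  define x' where "x' = (if x \<le> a then x + s else x - s)"
  have x': "x' \<in> X" "\<bar>x' - x\<bar> = s" using s x by (auto simp: x'_def X_def)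
  let ?z' = "(x', y\<^sub>0 x')"
  have "norm (?z' - ?z) \<le> \<bar>x' - x\<bar> + \<bar>y\<^sub>0 x' - y\<^sub>0 x\<bar>"
    using norm_Pair_le[of "x' - x" "y\<^sub>0 x' - y\<^sub>0 x"] by simp
  also have "\<dots> \<le> s * (1 + K)" using K(2)[OF x'(1) x] x'(2) by (simp add: algebra_simps)
  finally have n: "norm (?z' - ?z) \<le> s * (1 + K)" .
  then have "norm (h ?z' - h ?z - (\<lambda>(s, t). s * deriv_x h ?z + t * deriv_y h ?z) (?z' - ?z)) \<le> e * norm (?z' - ?z)"
    using s by (intro d) simp
  then have "s * \<bar>\<alpha>\<bar> \<le> e * norm (?z' - ?z)"
    using h0[OF x'(1)] h0[OF x] y0 x'(2) by (simp add: \<alpha>_def abs_mult)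
  also have "\<dots> \<le> e * (s * (1 + K))" using n e by (intro mult_left_mono) auto
  also have "\<dots> = s * \<bar>\<alpha>\<bar> / 2" using K(1) by (simp add: e_def divide_simps)
  finally show False using s(1) \<open>\<alpha> \<noteq> 0\<close> by simp
qed

end

section \<open>Kernel estimates along vertical lines and comparison of truncations\<close>

context graph_box
begin

text \<open>The integrand on the vertical line through x, recentred at the zero of \<open>F\<close>.
  Extension by 0 makes it jointly Borel in x and t on the whole plane, as integration over t with
  parameter x requires.\<close>

definition kernel :: "(real \<times> real \<Rightarrow> real) \<Rightarrow> real \<Rightarrow> real \<Rightarrow> real" where
  "kernel \<phi> x t = (if x \<in> {a - \<eta><..<a + \<eta>} \<and> (x, y\<^sub>0 x + t) \<in> U
     then \<phi> (x, y\<^sub>0 x + t) / F (x, y\<^sub>0 x + t) else 0)"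

lemma quotient_measurable:
  assumes "smooth_on U \<phi>"
  shows "(\<lambda>z. if z \<in> U then \<phi> z / F z else 0) \<in> borel_measurable borel"
proof -
  have [measurable]: "(\<lambda>z. indicator U z *\<^sub>R \<phi> z) \<in> borel_measurable borel"
    "(\<lambda>z. indicator U z *\<^sub>R F z) \<in> borel_measurable borel"
    using U smooth_on_imp_continuous_on[OF assms] smooth_on_imp_continuous_on[OF F]
    by (auto intro!: borel_measurable_continuous_on_indicator simp del: real_scaleR_def)
  have "(\<lambda>z. (indicator U z *\<^sub>R \<phi> z) / (indicator U z *\<^sub>R F z)) \<in> borel_measurable borel"
    by measurable
  moreover have "(\<lambda>z. (indicator U z *\<^sub>R \<phi> z) / (indicator U z *\<^sub>R F z)) = (\<lambda>z. if z \<in> U then \<phi> z / F z else 0)"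
    by (auto simp: fun_eq_iff)
  ultimately show ?thesis by simp
qed

lemma kernel_measurable:
  assumes "smooth_on U \<phi>"
  shows "case_prod (kernel \<phi>) \<in> borel_measurable (borel \<Otimes>\<^sub>M borel)"
proof -
  note [measurable] = quotient_measurable[OF assms]
  have "(\<lambda>p. indicator {a - \<eta><..<a + \<eta>} (fst p) *
      (\<lambda>z. if z \<in> U then \<phi> z / F z else 0) (fst p, y\<^sub>0 (fst p) + snd p)) \<in> borel_measurable (borel \<Otimes>\<^sub>M borel)"
    by measurable
  moreover have "(\<lambda>p. indicator {a - \<eta><..<a + \<eta>} (fst p) *
      (\<lambda>z. if z \<in> U then \<phi> z / F z else 0) (fst p, y\<^sub>0 (fst p) + snd p)) = case_prod (kernel \<phi>)"
    by (auto simp: fun_eq_iff kernel_def)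
  ultimately show ?thesis by simp
qed

text \<open>The bound of order 1/|t| is the linear growth of \<open>F\<close>. The bound on the
  symmetrised kernel is the cancellation that makes principal values exist: over the common
  denominator, which is at least of order t^2, the numerator is also O(t^2), because the linear
  terms of \<open>F\<close> on the two sides of the curve cancel.\<close>

lemma kernel_bounds:
  assumes \<phi>: "smooth_on U \<phi>" "\<And>z. z \<in> U - W \<Longrightarrow> \<phi> z = 0"
  obtains C where "C > 0" "\<And>x t. \<bar>t\<bar> * \<bar>kernel \<phi> x t\<bar> \<le> C" "\<And>x t. \<bar>kernel \<phi> x t + kernel \<phi> x (- t)\<bar> \<le> C"
    "\<And>x t. \<bar>t\<bar> \<ge> 2 * \<delta> \<Longrightarrow> kernel \<phi> x t = 0"
proof -
  obtain B where B: "B > 0" "\<And>z. z \<in> R \<Longrightarrow> \<bar>\<phi> z\<bar> \<le> B"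
    using bounded_on_R[OF \<phi>(1)] by blast
  obtain B' where B': "B' > 0" "\<And>z. z \<in> R \<Longrightarrow> \<bar>deriv_y \<phi> z\<bar> \<le> B'"
    using bounded_on_R[OF smooth_on_deriv_y[OF \<phi>(1)]] by blast
  obtain L where L: "L > 0" "\<And>z. z \<in> R \<Longrightarrow> \<bar>deriv_y F z\<bar> \<le> L"
    using bounded_on_R[OF smooth_on_deriv_y[OF F]] by blast
  obtain M where M: "M > 0" "\<And>z. z \<in> R \<Longrightarrow> \<bar>deriv_y (deriv_y F) z\<bar> \<le> M"
    using bounded_on_R[OF smooth_on_deriv_y[OF smooth_on_deriv_y[OF F]]] by blast
  define C\<^sub>1 C\<^sub>2 where "C\<^sub>1 = B / m" and "C\<^sub>2 = (2 * B * M + 2 * B' * L) / m\<^sup>2"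
  have C: "C\<^sub>1 > 0" "C\<^sub>2 > 0" using B(1) B'(1) L(1) M(1) pos by (auto simp: C\<^sub>1_def C\<^sub>2_def intro!: add_pos_pos divide_pos_pos)
  have far: "kernel \<phi> x t = 0" if "\<bar>t\<bar> \<ge> 2 * \<delta>" for x t
    using shifted_notin_W[OF _ that, of x x] \<phi>(2)[of "(x, y\<^sub>0 x + t)"]
    by (auto simp: kernel_def X_def)
  have outside: "kernel \<phi> x t = 0" if "x \<notin> X" for x t
    using that by (auto simp: kernel_def X_def)
  have shifted_R: "(x, y\<^sub>0 x + t) \<in> R" if "x \<in> X" "\<bar>t\<bar> < 2 * \<delta>" for x t
    using shifted_mem_Y[OF that] that by (simp add: R_def)
  have "\<bar>t\<bar> * \<bar>kernel \<phi> x t\<bar> \<le> C\<^sub>1" for x t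
  proof (cases "x \<in> X \<and> \<bar>t\<bar> < 2 * \<delta> \<and> t \<noteq> 0")
    case True
    let ?z = "(x, y\<^sub>0 x + t)"
    have "\<bar>kernel \<phi> x t\<bar> \<le> \<bar>\<phi> ?z\<bar> / \<bar>F ?z\<bar>"
      by (simp add: kernel_def)
    also have "\<dots> \<le> B / (m * \<bar>t\<bar>)"
      using True B pos shifted_R[of x t] F_lower_shifted[of x t] by (intro frac_le) auto
    finally show ?thesis using True pos by (simp add: C\<^sub>1_def field_simps)
  qed (use far[of t x] outside[of x t] C in auto)
  moreover have "\<bar>kernel \<phi> x t + kernel \<phi> x (- t)\<bar> \<le> C\<^sub>2" for x t
  proof (cases "x \<in> {a - \<eta><..<a + \<eta>} \<and> \<bar>t\<bar> < 2 * \<delta> \<and> t \<noteq> 0")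
    case True
    then have x: "x \<in> X" and t: "\<bar>t\<bar> < 2 * \<delta>" "\<bar>- t\<bar> < 2 * \<delta>" "t \<noteq> 0" by (auto simp: X_def)
    let ?p = "(x, y\<^sub>0 x + t)" and ?n = "(x, y\<^sub>0 x + - t)" and ?o = "(x, y\<^sub>0 x)"
    have Y: "y\<^sub>0 x \<in> Y" "y\<^sub>0 x + t \<in> Y" "y\<^sub>0 x + - t \<in> Y"
      using y\<^sub>0_mem_Y shifted_mem_Y x t by blast+
    have R: "?p \<in> R" "?n \<in> R" "?o \<in> R" "\<And>y. y \<in> Y \<Longrightarrow> (x, y) \<in> R"
      using Y x by (auto simp: R_def)
    have cY: "convex Y" by (simp add: Y_def)
    have F_le: "\<bar>F ?p\<bar> \<le> L * \<bar>t\<bar>" "\<bar>F ?n\<bar> \<le> L * \<bar>t\<bar>"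
      using vertical_increment_le[OF F, of Y x L "y\<^sub>0 x + t" "y\<^sub>0 x"]
        vertical_increment_le[OF F, of Y x L "y\<^sub>0 x + - t" "y\<^sub>0 x"] R L(2) box Y cY y\<^sub>0_zero[OF x] by auto
    have \<phi>_le: "\<bar>\<phi> ?p - \<phi> ?o\<bar> \<le> B' * \<bar>t\<bar>" "\<bar>\<phi> ?n - \<phi> ?o\<bar> \<le> B' * \<bar>t\<bar>"
      using vertical_increment_le[OF \<phi>(1), of Y x B' "y\<^sub>0 x + t" "y\<^sub>0 x"]
        vertical_increment_le[OF \<phi>(1), of Y x B' "y\<^sub>0 x + - t" "y\<^sub>0 x"] R B'(2) box Y cY by auto
    have "\<bar>F ?p - deriv_y F ?o * t\<bar> \<le> M * t\<^sup>2" "\<bar>F ?n + deriv_y F ?o * t\<bar> \<le> M * t\<^sup>2"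
      using vertical_taylor[OF F, of Y x M "y\<^sub>0 x" t] vertical_taylor[OF F, of Y x M "y\<^sub>0 x" "- t"]
        R M(2) box Y cY y\<^sub>0_zero[OF x] by auto
    then have F_sum: "\<bar>F ?p + F ?n\<bar> \<le> 2 * M * t\<^sup>2" by linarith
    have F_ge: "m * \<bar>t\<bar> \<le> \<bar>F ?p\<bar>" "m * \<bar>t\<bar> \<le> \<bar>F ?n\<bar>"
      using F_lower_shifted[OF x t(1)] F_lower_shifted[OF x t(2)] by auto
    have "m * \<bar>t\<bar> > 0" using pos t by simp
    then have F_nz: "F ?p \<noteq> 0" "F ?n \<noteq> 0" using F_ge by auto
    have "(m * \<bar>t\<bar>) * (m * \<bar>t\<bar>) \<le> \<bar>F ?p\<bar> * \<bar>F ?n\<bar>"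
      using F_ge pos by (intro mult_mono) auto
    then have den: "m\<^sup>2 * t\<^sup>2 \<le> \<bar>F ?p * F ?n\<bar>"
      by (simp add: abs_mult power2_eq_square mult_ac)
    \<comment> \<open>Splitting off the value of \<phi> on the curve leaves
      \<open>F ?p + F ?n\<close>, quadratic in t by Taylor, and products of two factors each of
      order t.\<close>
    have "\<bar>\<phi> ?p * F ?n + \<phi> ?n * F ?p\<bar>
        = \<bar>\<phi> ?o * (F ?p + F ?n) + (\<phi> ?p - \<phi> ?o) * F ?n + (\<phi> ?n - \<phi> ?o) * F ?p\<bar>"
      by (simp add: algebra_simps)
    also have "\<dots> \<le> \<bar>\<phi> ?o\<bar> * \<bar>F ?p + F ?n\<bar> + \<bar>\<phi> ?p - \<phi> ?o\<bar> * \<bar>F ?n\<bar> + \<bar>\<phi> ?n - \<phi> ?o\<bar> * \<bar>F ?p\<bar>"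
      unfolding abs_mult[symmetric] by linarith
    also have "\<dots> \<le> B * (2 * M * t\<^sup>2) + (B' * \<bar>t\<bar>) * (L * \<bar>t\<bar>) + (B' * \<bar>t\<bar>) * (L * \<bar>t\<bar>)"
      by (intro add_mono mult_mono B(2) R(3) F_sum \<phi>_le F_le) (use B(1) B'(1) in simp_all)
    also have "\<dots> = (2 * B * M + 2 * B' * L) * t\<^sup>2"
      by (simp add: power2_eq_square algebra_simps)
    finally have num: "\<bar>\<phi> ?p * F ?n + \<phi> ?n * F ?p\<bar> \<le> (2 * B * M + 2 * B' * L) * t\<^sup>2" .
    have "\<bar>kernel \<phi> x t + kernel \<phi> x (- t)\<bar> = \<bar>\<phi> ?p / F ?p + \<phi> ?n / F ?n\<bar>"
      using True R box by (auto simp: kernel_def)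
    also have "\<dots> = \<bar>\<phi> ?p * F ?n + \<phi> ?n * F ?p\<bar> / \<bar>F ?p * F ?n\<bar>"
      using F_nz by (simp add: add_frac_eq abs_divide)
    also have "\<dots> \<le> ((2 * B * M + 2 * B' * L) * t\<^sup>2) / (m\<^sup>2 * t\<^sup>2)"
      using num den pos t by (intro frac_le) auto
    also have "\<dots> = C\<^sub>2" using t by (simp add: C\<^sub>2_def)
    finally show ?thesis .
  next
    case False
    then consider "x \<notin> {a - \<eta><..<a + \<eta>}" | "\<bar>t\<bar> \<ge> 2 * \<delta>" | "t = 0" by fastforce
    then show ?thesis
    proof cases
      case 1
      then have "kernel \<phi> x s = 0" for s by (auto simp: kernel_def)
      then show ?thesis using C by simp
    next
      case 2 then show ?thesis using far[of t x] far[of "- t" x] C by simp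
    next
      \<comment> \<open>On the curve the denominator is 0, and division by zero yields 0.\<close>
      case 3 then show ?thesis using y\<^sub>0_zero[of x] C by (simp add: kernel_def X_def)
    qed
  qed
  ultimately show thesis
    using C far by (intro that[of "max C\<^sub>1 C\<^sub>2"]) (auto simp: le_max_iff_disj less_max_iff_disj)
qed

text \<open>\<open>deriv_y_nonzero\<close> gives a nonzero slope at each point of the curve;
  continuity of the graph and compactness of \<open>X\<close> make the bound uniform. The symmetric
  truncation radii are then at most \<epsilon> / \<mu>.\<close>

lemma slope_bounds:
  assumes h: "smooth_on U h" "\<And>z. z \<in> U \<Longrightarrow> h z = 0 \<longleftrightarrow> F z = 0"
    "\<And>z. z \<in> U \<Longrightarrow> F z = 0 \<Longrightarrow> frechet_derivative h (at z) \<noteq> (\<lambda>v. 0)"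
  obtains \<mu> where "\<mu> > 0" "\<And>x. x \<in> X \<Longrightarrow> \<mu> \<le> \<bar>deriv_y h (x, y\<^sub>0 x)\<bar>"
proof -
  have in_U: "(x, y\<^sub>0 x) \<in> U" if "x \<in> X" for x
    using that box y\<^sub>0_mem_Y[of x] by (auto simp: R_def)
  have "continuous_on X (\<lambda>x. deriv_y h (x, y\<^sub>0 x))"
    using in_U by (intro continuous_on_compose2[OF smooth_on_imp_continuous_on[OF smooth_on_deriv_y[OF h(1)]]]
        continuous_intros y\<^sub>0_continuous) auto
  then have "continuous_on X (\<lambda>x. \<bar>deriv_y h (x, y\<^sub>0 x)\<bar>)" by (rule continuous_on_rabs)
  moreover have "compact X" "X \<noteq> {}" using pos by (auto simp: X_def)
  ultimately obtain x\<^sub>0 where x\<^sub>0: "x\<^sub>0 \<in> X" "\<forall>x\<in>X. \<bar>deriv_y h (x\<^sub>0, y\<^sub>0 x\<^sub>0)\<bar> \<le> \<bar>deriv_y h (x, y\<^sub>0 x)\<bar>"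
    using continuous_attains_inf by blast
  moreover have "deriv_y h (x\<^sub>0, y\<^sub>0 x\<^sub>0) \<noteq> 0"
    using x\<^sub>0(1) by (intro deriv_y_nonzero h in_U y\<^sub>0_zero)
  ultimately show thesis by (intro that[of "\<bar>deriv_y h (x\<^sub>0, y\<^sub>0 x\<^sub>0)\<bar>"]) auto
qed

text \<open>Near the curve, with g the slope, Taylor puts |h| within \<theta> g |t| of g |t|, so the
  two conditions can disagree only for g |t| between \<epsilon> / (1 + \<theta>) and \<epsilon> / (1
  - \<theta>). Away from the curve |h| has a positive minimum, and for small \<epsilon> both
  conditions hold.\<close>

lemma truncation_mismatch:
  assumes h: "smooth_on U h" "\<And>z. z \<in> U \<Longrightarrow> h z = 0 \<longleftrightarrow> F z = 0"
    and \<mu>: "\<mu> > 0" "\<And>x. x \<in> X \<Longrightarrow> \<mu> \<le> \<bar>deriv_y h (x, y\<^sub>0 x)\<bar>"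
    and \<theta>: "0 < \<theta>" "\<theta> \<le> 1 / 2"
  obtains \<epsilon>\<^sub>0 where "\<epsilon>\<^sub>0 > 0"
    "\<And>\<epsilon> x t. 0 < \<epsilon> \<Longrightarrow> \<epsilon> < \<epsilon>\<^sub>0 \<Longrightarrow> x \<in> X \<Longrightarrow> \<bar>t\<bar> < 2 * \<delta> \<Longrightarrow>
      (\<bar>h (x, y\<^sub>0 x + t)\<bar> > \<epsilon>) \<noteq> (\<bar>t\<bar> > \<epsilon> / \<bar>deriv_y h (x, y\<^sub>0 x)\<bar>) \<Longrightarrow>
      \<epsilon> / \<bar>deriv_y h (x, y\<^sub>0 x)\<bar> / (1 + \<theta>) \<le> \<bar>t\<bar> \<and> \<bar>t\<bar> \<le> \<epsilon> / \<bar>deriv_y h (x, y\<^sub>0 x)\<bar> / (1 - \<theta>)"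
proof -
  obtain H where H: "H > 0" "\<And>z. z \<in> R \<Longrightarrow> \<bar>deriv_y (deriv_y h) z\<bar> \<le> H"
    using bounded_on_R[OF smooth_on_deriv_y[OF smooth_on_deriv_y[OF h(1)]]] by blast
  \<comment> \<open>With this radius the Taylor error H t^2 is at most \<theta> \<mu> |t|.\<close>
  define r where "r = \<theta> * \<mu> / H"
  have r: "r > 0" using \<theta> \<mu> H by (simp add: r_def)
  define K where "K = {z \<in> R. r \<le> \<bar>snd z - y\<^sub>0 (fst z)\<bar>}"
  have "continuous_on R (\<lambda>z. y\<^sub>0 (fst z))"
    by (rule continuous_on_compose2[OF y\<^sub>0_continuous]) (auto intro!: continuous_intros simp: R_def)
  then have "continuous_on R (\<lambda>z. \<bar>snd z - y\<^sub>0 (fst z)\<bar>)"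
    by (intro continuous_intros)
  from continuous_closedin_preimage[OF this, of "{r..}"]
  have "closedin (top_of_set R) K"
    by (simp add: K_def vimage_def Int_def)
  then have "compact K" by (rule closedin_compact[OF compact_R])
  have KU: "K \<subseteq> U" "\<And>z. z \<in> K \<Longrightarrow> h z \<noteq> 0"
  proof -
    show "K \<subseteq> U" using box by (auto simp: K_def)
    then show "h z \<noteq> 0" if "z \<in> K" for z
      using h(2)[of z] F_eq_0_iff[of "fst z" "snd z"] that r by (auto simp: K_def R_def)
  qed
  obtain \<nu> where \<nu>: "\<nu> > 0" "\<And>z. z \<in> K \<Longrightarrow> \<nu> \<le> \<bar>h z\<bar>"
  proof (cases "K = {}")
    case True then show thesis using that[of 1] by simp
  next
    case False
    have "continuous_on K (\<lambda>z. \<bar>h z\<bar>)"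
      using continuous_on_subset[OF smooth_on_imp_continuous_on[OF h(1)] KU(1)] by (rule continuous_on_rabs)
    then obtain z where "z \<in> K" "\<forall>z'\<in>K. \<bar>h z\<bar> \<le> \<bar>h z'\<bar>"
      using continuous_attains_inf[OF \<open>compact K\<close> False] by blast
    then show thesis using that[of "\<bar>h z\<bar>"] KU(2) by auto
  qed
  show thesis
  proof (rule that[of "min \<nu> (r * \<mu>)"])
    show "min \<nu> (r * \<mu>) > 0" using \<nu> r \<mu> by simp
    fix \<epsilon> x t
    assume \<epsilon>: "0 < \<epsilon>" "\<epsilon> < min \<nu> (r * \<mu>)" and x: "x \<in> X" and t: "\<bar>t\<bar> < 2 * \<delta>"
      and mis: "(\<bar>h (x, y\<^sub>0 x + t)\<bar> > \<epsilon>) \<noteq> (\<bar>t\<bar> > \<epsilon> / \<bar>deriv_y h (x, y\<^sub>0 x)\<bar>)"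
    define g where "g = \<bar>deriv_y h (x, y\<^sub>0 x)\<bar>"
    have g: "\<mu> \<le> g" "g > 0" using \<mu> x by (force simp: g_def)+
    have Y: "y\<^sub>0 x + t \<in> Y" "y\<^sub>0 x \<in> Y" using x t shifted_mem_Y y\<^sub>0_mem_Y by blast+
    have XR: "(x, y) \<in> R" if "y \<in> Y" for y using that x by (simp add: R_def)
    have mis': "(\<bar>h (x, y\<^sub>0 x + t)\<bar> > \<epsilon>) \<noteq> (g * \<bar>t\<bar> > \<epsilon>)"
      using mis g by (simp add: g_def[symmetric] divide_less_eq mult.commute)
    \<comment> \<open>At distance \<open>r\<close> or more both conditions hold: the minimum
      \<open>\<nu>\<close> settles the one on \<open>h\<close>, and \<open>r * \<mu>\<close> the one
      on t. No mismatch is possible there.\<close>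
    have "\<bar>t\<bar> < r"
    proof (rule ccontr)
      assume "\<not> \<bar>t\<bar> < r"
      then have rt: "r \<le> \<bar>t\<bar>" by simp
      then have "(x, y\<^sub>0 x + t) \<in> K" using XR Y by (simp add: K_def)
      then have "\<epsilon> < \<bar>h (x, y\<^sub>0 x + t)\<bar>" using \<nu>(2) \<epsilon> by force
      moreover have "r * \<mu> \<le> \<bar>t\<bar> * g" using rt g r \<mu> by (intro mult_mono) auto
      ultimately show False using mis' \<epsilon> by (simp add: mult.commute)
    qed
    have h0: "h (x, y\<^sub>0 x) = 0" using h(2)[of "(x, y\<^sub>0 x)"] XR[OF Y(2)] box y\<^sub>0_zero[OF x] by auto
    have "\<bar>h (x, y\<^sub>0 x + t) - h (x, y\<^sub>0 x) - deriv_y h (x, y\<^sub>0 x) * t\<bar> \<le> H * t\<^sup>2"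
      by (rule vertical_taylor[OF h(1), of Y]) (use Y XR box H(2) in \<open>auto simp: Y_def\<close>)
    also have "H * t\<^sup>2 = H * \<bar>t\<bar> * \<bar>t\<bar>" by (simp add: power2_eq_square)
    also have "\<dots> \<le> H * r * \<bar>t\<bar>"
      using \<open>\<bar>t\<bar> < r\<close> H(1) by (intro mult_right_mono mult_left_mono) auto
    also have "\<dots> = \<theta> * \<mu> * \<bar>t\<bar>" using H(1) by (simp add: r_def)
    also have "\<dots> \<le> \<theta> * g * \<bar>t\<bar>" using \<theta> g by (intro mult_right_mono mult_left_mono) auto
    finally have "\<bar>h (x, y\<^sub>0 x + t) - deriv_y h (x, y\<^sub>0 x) * t\<bar> \<le> \<theta> * g * \<bar>t\<bar>" using h0 by simp
    moreover have "\<bar>deriv_y h (x, y\<^sub>0 x) * t\<bar> = g * \<bar>t\<bar>" by (simp add: g_def abs_mult)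
    ultimately have "\<bar>\<bar>h (x, y\<^sub>0 x + t)\<bar> - g * \<bar>t\<bar>\<bar> \<le> \<theta> * (g * \<bar>t\<bar>)" by (simp add: mult.assoc)
    moreover have "0 \<le> \<theta> * (g * \<bar>t\<bar>)" using \<theta> g by simp
    ultimately have "\<epsilon> \<le> g * \<bar>t\<bar> * (1 + \<theta>)" "g * \<bar>t\<bar> * (1 - \<theta>) \<le> \<epsilon>"
      using mis' by (auto simp: algebra_simps not_less)
    then show "\<epsilon> / \<bar>deriv_y h (x, y\<^sub>0 x)\<bar> / (1 + \<theta>) \<le> \<bar>t\<bar> \<and> \<bar>t\<bar> \<le> \<epsilon> / \<bar>deriv_y h (x, y\<^sub>0 x)\<bar> / (1 - \<theta>)"
      unfolding g_def[symmetric] using g \<theta> by (simp add: pos_divide_le_eq pos_le_divide_eq mult_ac)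
  qed
qed

end

section \<open>Passage to the limit in a box\<close>

context graph_box
begin

text \<open>Fubini reduces the truncated integral to vertical lines, on which
  \<open>principal_value_truncation\<close> compares it with \<open>pv x\<close>, with an error
  independent of x. The limit is the integral of \<open>pv\<close>, which is built from \<phi> and
  \<open>F\<close> before \<open>h\<close> is introduced.\<close>

lemma truncated_integral_limit:
  assumes \<phi>: "smooth_on U \<phi>" "\<And>z. z \<in> U - W \<Longrightarrow> \<phi> z = 0"
  obtains L where "\<And>h :: real \<times> real \<Rightarrow> real. smooth_on U h \<Longrightarrow> (\<And>z. z \<in> U \<Longrightarrow> h z = 0 \<longleftrightarrow> F z = 0) \<Longrightarrow>
    (\<And>z. z \<in> U \<Longrightarrow> F z = 0 \<Longrightarrow> frechet_derivative h (at z) \<noteq> (\<lambda>v. 0)) \<Longrightarrow>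
    ((\<lambda>\<epsilon>. LINT z:{z \<in> U. \<bar>h z\<bar> > \<epsilon>}|lborel. \<phi> z / F z) \<longlongrightarrow> L) (at_right 0)"
proof -
  define I where "I = {a - \<eta><..<a + \<eta>}"
  have IX: "I \<subseteq> X" by (auto simp: I_def X_def)
  have I_fm: "I \<in> fmeasurable lborel" "measure lborel I = 2 * \<eta>"
    using emeasure_bounded_finite[of I] pos by (auto simp: fmeasurable_def I_def)
  obtain C where C: "C > 0" "\<And>x t. \<bar>t\<bar> * \<bar>kernel \<phi> x t\<bar> \<le> C" "\<And>x t. \<bar>kernel \<phi> x t + kernel \<phi> x (- t)\<bar> \<le> C"
    "\<And>x t. \<bar>t\<bar> \<ge> 2 * \<delta> \<Longrightarrow> kernel \<phi> x t = 0"
    using kernel_bounds[OF \<phi>] by blast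
  have kernel_outside: "kernel \<phi> x t = 0" if "x \<notin> I" for x t
    using that by (auto simp: kernel_def I_def)
  note [measurable] = kernel_measurable[OF \<phi>(1)] quotient_measurable[OF \<phi>(1)] U
  have ker1 [measurable]: "kernel \<phi> x \<in> borel_measurable borel" for x
    using measurable_Pair2[OF kernel_measurable[OF \<phi>(1)], of x] by simp
  define pv where "pv x = (\<integral>t. indicator {0<..} t * (kernel \<phi> x t + kernel \<phi> x (- t)) \<partial>lborel)" for x
  have "(\<lambda>(x, t). indicator {0<..} t * (kernel \<phi> x t + kernel \<phi> x (- t))) \<in> borel_measurable (borel \<Otimes>\<^sub>M lborel)"
    by measurable
  then have pv_meas: "pv \<in> borel_measurable borel"
    unfolding pv_def[abs_def] by (rule lborel.borel_measurable_lebesgue_integral)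
  have T_fm: "{- 2 * \<delta>..2 * \<delta>} \<in> fmeasurable lborel" "measure lborel {- 2 * \<delta>..2 * \<delta>} = 4 * \<delta>"
    using emeasure_bounded_finite[of "{- 2 * \<delta>..2 * \<delta>}"] pos by (auto simp: fmeasurable_def)
  have "\<bar>pv x\<bar> \<le> C * (4 * \<delta>)" for x
  proof -
    have "\<bar>indicator {0<..} t * (kernel \<phi> x t + kernel \<phi> x (- t))\<bar> \<le> C * indicator {- 2 * \<delta>..2 * \<delta>} t" for t
      using C(1,3) C(4)[of t x] C(4)[of "- t" x] by (auto simp: indicator_def)
    from integral_bounded_support(2)[OF _ T_fm(1) this]
    have "\<bar>pv x\<bar> \<le> C * measure lborel {- 2 * \<delta>..2 * \<delta>}" by (simp add: pv_def)
    then show ?thesis by (simp only: T_fm(2))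
  qed
  then have pv_le: "\<bar>pv x\<bar> \<le> C * (4 * \<delta>) * indicator I x" for x
    using kernel_outside[of x] by (cases "x \<in> I") (auto simp: pv_def)
  have pv_int: "integrable lborel pv"
    using integral_bounded_support(1)[OF _ I_fm(1) pv_le] pv_meas by simp
  show thesis
  proof (rule that[of "integral\<^sup>L lborel pv"])
    fix h :: "real \<times> real \<Rightarrow> real"
    assume h: "smooth_on U h" "\<And>z. z \<in> U \<Longrightarrow> h z = 0 \<longleftrightarrow> F z = 0"
      "\<And>z. z \<in> U \<Longrightarrow> F z = 0 \<Longrightarrow> frechet_derivative h (at z) \<noteq> (\<lambda>v. 0)"
    obtain \<mu> where \<mu>: "\<mu> > 0" "\<And>x. x \<in> X \<Longrightarrow> \<mu> \<le> \<bar>deriv_y h (x, y\<^sub>0 x)\<bar>"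
      using slope_bounds[OF h] by blast
    obtain H where H: "H > 0" "\<And>z. z \<in> R \<Longrightarrow> \<bar>deriv_y h z\<bar> \<le> H"
      using bounded_on_R[OF smooth_on_deriv_y[OF h(1)]] by blast
    obtain B where B: "B > 0" "\<And>z. z \<in> R \<Longrightarrow> \<bar>\<phi> z\<bar> \<le> B"
      using bounded_on_R[OF \<phi>(1)] by blast
    define Q where "Q \<epsilon> z = indicator {z \<in> U. \<bar>h z\<bar> > \<epsilon>} z * (if z \<in> U then \<phi> z / F z else 0)" for \<epsilon> z
    have op: "open {z \<in> U. \<bar>h z\<bar> > \<epsilon>}" for \<epsilon>
      by (intro open_superlevel U continuous_on_rabs smooth_on_imp_continuous_on h(1))
    have [measurable]: "{z \<in> U. \<bar>h z\<bar> > \<epsilon>} \<in> sets borel" for \<epsilon> using op by simp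
    have Q_meas: "Q \<epsilon> \<in> borel_measurable borel" for \<epsilon>
      unfolding Q_def[abs_def] by measurable
    have Q_W: "Q \<epsilon> z = 0" if "z \<notin> W" for \<epsilon> z
      using \<phi>(2)[of z] that by (auto simp: Q_def)
    have W_fm: "W \<in> fmeasurable lborel"
    proof -
      have "bounded W" using compact_imp_bounded[OF compact_R] W_subset_R bounded_subset by blast
      moreover have "open W" unfolding W_def by (intro open_Times) auto
      ultimately show ?thesis using emeasure_bounded_finite[of W] by (simp add: fmeasurable_def)
    qed
    \<comment> \<open>The truncation forces a vertical distance of more than \<epsilon> / H from the
      curve, hence |F| at least m \<epsilon> / H. For each fixed \<epsilon> the integrand is
      therefore bounded, and Fubini applies.\<close>
    have Q_int: "integrable lborel (Q \<epsilon>)" if \<epsilon>: "\<epsilon> > 0" for \<epsilon>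
    proof (rule integral_bounded_support(1)[OF _ W_fm])
      show "\<bar>Q \<epsilon> z\<bar> \<le> B * H / (m * \<epsilon>) * indicator W z" for z
      proof (cases "z \<in> W \<and> z \<in> U \<and> \<bar>h z\<bar> > \<epsilon>")
        case True
        obtain x y where z: "z = (x, y)" by (cases z)
        have R: "z \<in> R" "x \<in> X" "y \<in> Y" "y\<^sub>0 x \<in> Y"
          using True W_subset_R z y\<^sub>0_mem_Y by (auto simp: R_def)
        have h0: "h (x, y\<^sub>0 x) = 0"
          using h(2)[of "(x, y\<^sub>0 x)"] R box y\<^sub>0_zero[of x] by (auto simp: R_def)
        have "\<epsilon> < \<bar>h (x, y) - h (x, y\<^sub>0 x)\<bar>" using True z h0 by simp
        also have "\<dots> \<le> H * \<bar>y - y\<^sub>0 x\<bar>"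
          by (rule vertical_increment_le[OF h(1), of Y]) (use R box H(2) in \<open>auto simp: R_def Y_def\<close>)
        finally have "m * \<epsilon> \<le> H * (m * \<bar>y - y\<^sub>0 x\<bar>)" using pos by simp
        also have "\<dots> \<le> H * \<bar>F z\<bar>"
          using F_lower[OF R(2-4)] H(1) y\<^sub>0_zero[OF R(2)] z by simp
        finally have "m * \<epsilon> / H \<le> \<bar>F z\<bar>" using H(1) by (simp add: field_simps)
        then have "\<bar>\<phi> z\<bar> / \<bar>F z\<bar> \<le> B / (m * \<epsilon> / H)"
          using B R pos \<epsilon> H(1) by (intro frac_le) auto
        then show ?thesis using True by (simp add: Q_def)
      next
        case False
        then have "Q \<epsilon> z = 0"
          using Q_W[of z \<epsilon>] by (cases "z \<in> W") (auto simp: Q_def indicator_def)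
        then show ?thesis using B(1) H(1) pos \<epsilon> by simp
      qed
    qed (use Q_meas in simp)
    define J where "J \<epsilon> x = (\<integral>y. Q \<epsilon> (x, y) \<partial>lborel)" for \<epsilon> x
    have J: "integrable lborel (J \<epsilon>)" "integral\<^sup>L lborel (J \<epsilon>) = integral\<^sup>L lborel (Q \<epsilon>)" if "\<epsilon> > 0" for \<epsilon>
      using lborel_pair.integrable_fst'[of "Q \<epsilon>"] lborel_pair.integral_fst'[of "Q \<epsilon>"] Q_int[OF that]
      by (simp_all add: J_def[abs_def] lborel_prod)
    have J_eq: "J \<epsilon> x = (\<integral>t. indicator {t. (x, y\<^sub>0 x + t) \<in> {z \<in> U. \<bar>h z\<bar> > \<epsilon>}} t * kernel \<phi> x t \<partial>lborel)"
      if "x \<in> I" for \<epsilon> x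
    proof -
      have "J \<epsilon> x = (\<integral>t. Q \<epsilon> (x, y\<^sub>0 x + t) \<partial>lborel)"
        using lborel_integral_real_affine[of 1 "\<lambda>y. Q \<epsilon> (x, y)" "y\<^sub>0 x"] by (simp add: J_def)
      also have "(\<lambda>t. Q \<epsilon> (x, y\<^sub>0 x + t)) = (\<lambda>t. indicator {t. (x, y\<^sub>0 x + t) \<in> {z \<in> U. \<bar>h z\<bar> > \<epsilon>}} t * kernel \<phi> x t)"
        using that by (auto simp: fun_eq_iff Q_def kernel_def I_def indicator_def)
      finally show ?thesis .
    qed
    \<comment> \<open>The tolerance \<theta> is chosen before \<epsilon>, since the threshold for
      \<epsilon> depends on it. The factor 2 \<eta> is the length of \<open>I\<close>.\<close>
    have key: "\<exists>\<epsilon>\<^sub>0>0. \<forall>\<epsilon>. 0 < \<epsilon> \<longrightarrow> \<epsilon> < \<epsilon>\<^sub>0 \<longrightarrow>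
        \<bar>integral\<^sup>L lborel (Q \<epsilon>) - integral\<^sup>L lborel pv\<bar> \<le> (8 * C * \<theta> + C * (\<epsilon> / \<mu>)) * (2 * \<eta>)"
      if \<theta>: "0 < \<theta>" "\<theta> \<le> 1 / 2" for \<theta>
    proof -
      obtain \<epsilon>\<^sub>0 where \<epsilon>\<^sub>0: "\<epsilon>\<^sub>0 > 0"
        "\<And>\<epsilon> x t. 0 < \<epsilon> \<Longrightarrow> \<epsilon> < \<epsilon>\<^sub>0 \<Longrightarrow> x \<in> X \<Longrightarrow> \<bar>t\<bar> < 2 * \<delta> \<Longrightarrow>
        (\<bar>h (x, y\<^sub>0 x + t)\<bar> > \<epsilon>) \<noteq> (\<bar>t\<bar> > \<epsilon> / \<bar>deriv_y h (x, y\<^sub>0 x)\<bar>) \<Longrightarrow>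
        \<epsilon> / \<bar>deriv_y h (x, y\<^sub>0 x)\<bar> / (1 + \<theta>) \<le> \<bar>t\<bar> \<and> \<bar>t\<bar> \<le> \<epsilon> / \<bar>deriv_y h (x, y\<^sub>0 x)\<bar> / (1 - \<theta>)"
        using truncation_mismatch[OF h(1,2) \<mu> \<theta>] by blast
      have "\<bar>integral\<^sup>L lborel (Q \<epsilon>) - integral\<^sup>L lborel pv\<bar> \<le> (8 * C * \<theta> + C * (\<epsilon> / \<mu>)) * (2 * \<eta>)"
        if \<epsilon>: "0 < \<epsilon>" "\<epsilon> < \<epsilon>\<^sub>0" for \<epsilon>
      proof -
        have "\<bar>J \<epsilon> x - pv x\<bar> \<le> (8 * C * \<theta> + C * (\<epsilon> / \<mu>)) * indicator I x" for x
        proof (cases "x \<in> I")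
          case True
          then have x: "x \<in> X" using IX by blast
          let ?A = "{t. (x, y\<^sub>0 x + t) \<in> {z \<in> U. \<bar>h z\<bar> > \<epsilon>}}"
          let ?r = "\<epsilon> / \<bar>deriv_y h (x, y\<^sub>0 x)\<bar>"
          have g: "0 < \<bar>deriv_y h (x, y\<^sub>0 x)\<bar>" using \<mu>(2)[OF x] \<mu>(1) by linarith
          have "open ((\<lambda>t. (x, y\<^sub>0 x + t)) -` {z \<in> U. \<bar>h z\<bar> > \<epsilon>})"
            by (intro open_vimage op continuous_intros)
          then have A: "?A \<in> sets borel" by (simp add: vimage_def)
          have "\<bar>(\<integral>t. indicator ?A t * kernel \<phi> x t \<partial>lborel)
              - (\<integral>t. indicator {0<..} t * (kernel \<phi> x t + kernel \<phi> x (- t)) \<partial>lborel)\<bar> \<le> 8 * C * \<theta> + C * ?r"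
          proof (rule principal_value_truncation(2)[where T = "2 * \<delta>", OF ker1 A C(2,3,4)])
            fix t assume t: "\<bar>t\<bar> < 2 * \<delta>" and mis: "(t \<in> ?A) \<noteq> (\<bar>t\<bar> > ?r)"
            have "(x, y\<^sub>0 x + t) \<in> U" using shifted_mem_Y[OF x t] x box by (auto simp: R_def)
            then show "?r / (1 + \<theta>) \<le> \<bar>t\<bar> \<and> \<bar>t\<bar> \<le> ?r / (1 - \<theta>)"
              using \<epsilon>\<^sub>0(2)[OF \<epsilon> x t] mis by simp
          qed (use \<epsilon> g \<theta> in auto)
          moreover have "C * ?r \<le> C * (\<epsilon> / \<mu>)"
            using \<mu>(1) \<mu>(2)[OF x] \<epsilon> C(1) by (intro mult_left_mono frac_le) auto
          ultimately show ?thesis using J_eq[OF True, of \<epsilon>] True by (simp add: pv_def)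
        next
          case False
          then have "Q \<epsilon> (x, y) = 0" for y by (intro Q_W) (auto simp: W_def I_def)
          then show ?thesis using False pv_le[of x] by (simp add: J_def)
        qed
        moreover have "(\<lambda>x. J \<epsilon> x - pv x) \<in> borel_measurable lborel"
          using J(1)[OF \<epsilon>(1)] pv_int by auto
        ultimately have "\<bar>\<integral>x. J \<epsilon> x - pv x \<partial>lborel\<bar> \<le> (8 * C * \<theta> + C * (\<epsilon> / \<mu>)) * measure lborel I"
          by (intro integral_bounded_support(2)[OF _ I_fm(1)])
        then show ?thesis
          using J[OF \<epsilon>(1)] pv_int I_fm(2) by simp
      qed
      then show ?thesis using \<epsilon>\<^sub>0(1) by blast
    qed
    have "((\<lambda>\<epsilon>. integral\<^sup>L lborel (Q \<epsilon>)) \<longlongrightarrow> integral\<^sup>L lborel pv) (at_right 0)"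
    proof (rule tendstoI)
      fix e :: real assume e: "e > 0"
      \<comment> \<open>The error has the two terms 16 C \<theta> \<eta> and 2 C (\<epsilon> /
        \<mu>) \<eta>. The 64 here and the 8 in the later bound on \<epsilon> make each of them at
        most e / 4.\<close>
      define \<theta> where "\<theta> = min (1 / 2) (e / (64 * C * \<eta>))"
      have \<theta>: "0 < \<theta>" "\<theta> \<le> 1 / 2" using e C(1) pos by (auto simp: \<theta>_def)
      have "\<theta> \<le> e / (64 * C * \<eta>)" by (simp add: \<theta>_def)
      then have \<theta>e: "16 * C * \<theta> * \<eta> \<le> e / 4" using C(1) pos by (simp add: field_simps)
      obtain \<epsilon>\<^sub>0 where \<epsilon>\<^sub>0: "\<epsilon>\<^sub>0 > 0" "\<And>\<epsilon>. 0 < \<epsilon> \<Longrightarrow> \<epsilon> < \<epsilon>\<^sub>0 \<Longrightarrow>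
          \<bar>integral\<^sup>L lborel (Q \<epsilon>) - integral\<^sup>L lborel pv\<bar> \<le> (8 * C * \<theta> + C * (\<epsilon> / \<mu>)) * (2 * \<eta>)"
        using key[OF \<theta>] by blast
      define \<epsilon>\<^sub>1 where "\<epsilon>\<^sub>1 = min \<epsilon>\<^sub>0 (e * \<mu> / (8 * C * \<eta>))"
      have "\<epsilon>\<^sub>1 > 0" using \<epsilon>\<^sub>0(1) e C(1) pos \<mu>(1) by (simp add: \<epsilon>\<^sub>1_def)
      moreover have "dist (integral\<^sup>L lborel (Q \<epsilon>)) (integral\<^sup>L lborel pv) < e" if \<epsilon>: "0 < \<epsilon>" "\<epsilon> < \<epsilon>\<^sub>1" for \<epsilon>
      proof -
        have "\<epsilon> \<le> e * \<mu> / (8 * C * \<eta>)" using \<epsilon> by (simp add: \<epsilon>\<^sub>1_def)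
        then have "2 * C * (\<epsilon> / \<mu>) * \<eta> \<le> e / 4" using C(1) pos \<mu>(1) by (simp add: field_simps)
        moreover have "\<bar>integral\<^sup>L lborel (Q \<epsilon>) - integral\<^sup>L lborel pv\<bar> \<le> 16 * C * \<theta> * \<eta> + 2 * C * (\<epsilon> / \<mu>) * \<eta>"
          using \<epsilon>\<^sub>0(2)[of \<epsilon>] \<epsilon> by (simp add: \<epsilon>\<^sub>1_def algebra_simps)
        ultimately show ?thesis using \<theta>e e by (simp add: dist_real_def)
      qed
      ultimately show "\<forall>\<^sub>F \<epsilon> in at_right 0. dist (integral\<^sup>L lborel (Q \<epsilon>)) (integral\<^sup>L lborel pv) < e"
        unfolding eventually_at_right_field by blast
    qed
    moreover have "(LINT z:{z \<in> U. \<bar>h z\<bar> > \<epsilon>}|lborel. \<phi> z / F z) = integral\<^sup>L lborel (Q \<epsilon>)" for \<epsilon>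
      unfolding set_lebesgue_integral_def Q_def by (intro Bochner_Integration.integral_cong) auto
    ultimately show "((\<lambda>\<epsilon>. LINT z:{z \<in> U. \<bar>h z\<bar> > \<epsilon>}|lborel. \<phi> z / F z) \<longlongrightarrow> integral\<^sup>L lborel pv) (at_right 0)"
      by simp
  qed
qed

end

subsection \<open>Regularized integrals near a point of the plane\<close>

text \<open>One \<open>L\<close> serves every admissible \<open>h\<close>, so independence of the
  truncating function is part of the notion and survives summation over a partition of
  unity.\<close>

definition truncation_limit :: "'a::euclidean_space set \<Rightarrow> ('a \<Rightarrow> real) \<Rightarrow> ('a \<Rightarrow> real) \<Rightarrow> real \<Rightarrow> bool" where
  "truncation_limit U F \<phi> L \<longleftrightarrow> (\<forall>h::'a \<Rightarrow> real. smooth_on U h \<longrightarrow> (\<forall>z\<in>U. h z = 0 \<longleftrightarrow> F z = 0) \<longrightarrow>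
     (\<forall>z\<in>U. F z = 0 \<longrightarrow> frechet_derivative h (at z) \<noteq> (\<lambda>v. 0)) \<longrightarrow>
     ((\<lambda>\<epsilon>. LINT z:{z \<in> U. \<bar>h z\<bar> > \<epsilon>}|lborel. \<phi> z / F z) \<longlongrightarrow> L) (at_right 0))"

text \<open>The neighbourhood may shrink with the point while \<phi> ranges over all smooth
  functions vanishing off it; weights of a partition of unity can be fed into this form.\<close>

definition regularizable :: "'a::euclidean_space set \<Rightarrow> ('a \<Rightarrow> real) \<Rightarrow> 'a \<Rightarrow> bool" where
  "regularizable U F z\<^sub>0 \<longleftrightarrow> (\<exists>W. open W \<and> z\<^sub>0 \<in> W \<and> W \<subseteq> U \<and>
     (\<forall>\<phi>. smooth_on U \<phi> \<longrightarrow> (\<forall>z\<in>U - W. \<phi> z = 0) \<longrightarrow> (\<exists>L. truncation_limit U F \<phi> L)))"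

lemma truncation_limitD:
  fixes h :: "'a::euclidean_space \<Rightarrow> real"
  assumes "truncation_limit U F \<phi> L" "smooth_on U h" "\<And>z. z \<in> U \<Longrightarrow> h z = 0 \<longleftrightarrow> F z = 0"
    "\<And>z. z \<in> U \<Longrightarrow> F z = 0 \<Longrightarrow> frechet_derivative h (at z) \<noteq> (\<lambda>v. 0)"
  shows "((\<lambda>\<epsilon>. LINT z:{z \<in> U. \<bar>h z\<bar> > \<epsilon>}|lborel. \<phi> z / F z) \<longlongrightarrow> L) (at_right 0)"
  by (rule assms(1)[unfolded truncation_limit_def, rule_format, OF assms(2)]) (use assms(3,4) in auto)

lemma (in graph_box) regularizable:
  assumes "z\<^sub>0 \<in> W"
  shows "regularizable U F z\<^sub>0"
  unfolding regularizable_def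
proof (intro exI[of _ W] conjI allI impI)
  show "open W" unfolding W_def by (intro open_Times) auto
  show "W \<subseteq> U" using W_subset_R box by blast
  fix \<phi> :: "real \<times> real \<Rightarrow> real" assume "smooth_on U \<phi>" "\<forall>z\<in>U - W. \<phi> z = 0"
  then obtain L where "\<And>h :: real \<times> real \<Rightarrow> real. smooth_on U h \<Longrightarrow> (\<And>z. z \<in> U \<Longrightarrow> h z = 0 \<longleftrightarrow> F z = 0) \<Longrightarrow>
    (\<And>z. z \<in> U \<Longrightarrow> F z = 0 \<Longrightarrow> frechet_derivative h (at z) \<noteq> (\<lambda>v. 0)) \<Longrightarrow>
    ((\<lambda>\<epsilon>. LINT z:{z \<in> U. \<bar>h z\<bar> > \<epsilon>}|lborel. \<phi> z / F z) \<longlongrightarrow> L) (at_right 0)"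
    using truncated_integral_limit[of \<phi>] by blast
  then show "\<exists>L. truncation_limit U F \<phi> L"
    unfolding truncation_limit_def by (intro exI[of _ L] allI impI) simp
qed (fact assms)

text \<open>The intermediate value theorem provides a zero on each vertical, picked by choice; its
  uniqueness and continuity in x are consequences of \<open>graph_box\<close>. The width is chosen
  after the height: \<open>F\<close> is positive at (a, b + \<delta>) and negative at (a, b -
  \<delta>), and \<eta> is small enough for these signs to persist over the whole interval.\<close>

lemma regularizable_deriv_y_pos:
  assumes U: "open U" and F: "smooth_on U F" and ab: "(a, b) \<in> U" "F (a, b) = 0" "deriv_y F (a, b) > 0"
  shows "regularizable U F (a, b)"
proof -
  define m where "m = deriv_y F (a, b) / 2"
  have m: "m > 0" using ab by (simp add: m_def)
  have cF: "continuous_on U F" and cF_y: "continuous_on U (deriv_y F)"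
    using smooth_on_imp_continuous_on F smooth_on_deriv_y by blast+
  have "(a, b) \<in> {z \<in> U. m < deriv_y F z}" using ab by (simp add: m_def)
  with open_superlevel[OF U cF_y, of m] obtain r where r: "r > 0" "cball (a, b) r \<subseteq> {z \<in> U. m < deriv_y F z}"
    using open_contains_cball by blast
  have near: "(x, y) \<in> cball (p, q) s" if "\<bar>x - p\<bar> + \<bar>y - q\<bar> \<le> s" for x y p q s :: real
    using norm_Pair_le[of "p - x" "q - y"] that by (simp add: dist_norm)
  \<comment> \<open>Half-width \<delta> and half-height 3 \<delta> add up to r, so the box fits into
    the ball on which the derivative exceeds \<open>m\<close>.\<close>
  define \<delta> where "\<delta> = r / 4"
  have \<delta>: "\<delta> > 0" using r by (simp add: \<delta>_def)
  have inner: "(x, y) \<in> U" "m < deriv_y F (x, y)" if "\<bar>x - a\<bar> \<le> \<delta>" "\<bar>y - b\<bar> \<le> 3 * \<delta>" for x y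
    using near[of x a y b r] that r(2) by (auto simp: \<delta>_def)
  have mono: "F (a, y) < F (a, y')" if "b - \<delta> \<le> y" "y < y'" "y' \<le> b + \<delta>" for y y'
  proof (rule DERIV_pos_imp_increasing[OF that(2)])
    fix s assume "y \<le> s" "s \<le> y'"
    then have "\<bar>s - b\<bar> \<le> 3 * \<delta>" using that \<delta> by (auto simp: abs_le_iff)
    then show "\<exists>d. ((\<lambda>y. F (a, y)) has_real_derivative d) (at s) \<and> 0 < d"
      using inner[of a s] m \<delta> has_real_derivative_vertical[OF F, of a s] by force
  qed
  have "F (a, b + \<delta>) > 0" "- F (a, b - \<delta>) > 0"
    using mono[of b "b + \<delta>"] mono[of "b - \<delta>" b] ab \<delta> by auto
  then have "(a, b + \<delta>) \<in> {z \<in> U. 0 < F z}" "(a, b - \<delta>) \<in> {z \<in> U. 0 < - F z}"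
    using inner[of a "b + \<delta>"] inner[of a "b - \<delta>"] \<delta> by auto
  moreover have "open {z \<in> U. 0 < F z}" "open {z \<in> U. 0 < - F z}"
    using cF by (intro open_superlevel U continuous_intros; simp)+
  ultimately obtain r\<^sub>1 r\<^sub>2 where r12: "r\<^sub>1 > 0" "cball (a, b + \<delta>) r\<^sub>1 \<subseteq> {z \<in> U. 0 < F z}"
    "r\<^sub>2 > 0" "cball (a, b - \<delta>) r\<^sub>2 \<subseteq> {z \<in> U. 0 < - F z}"
    by (meson open_contains_cball)
  define \<eta> where "\<eta> = min \<delta> (min r\<^sub>1 r\<^sub>2)"
  have \<eta>: "\<eta> > 0" "\<eta> \<le> \<delta>" "\<eta> \<le> r\<^sub>1" "\<eta> \<le> r\<^sub>2" using \<delta> r12 by (auto simp: \<eta>_def)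
  have "\<exists>y. y \<in> {b - \<delta><..<b + \<delta>} \<and> F (x, y) = 0" if x: "x \<in> {a - \<eta>..a + \<eta>}" for x
  proof -
    have xa: "\<bar>x - a\<bar> \<le> \<eta>" using x by (auto simp: abs_le_iff)
    have pos: "F (x, b + \<delta>) > 0" "F (x, b - \<delta>) < 0"
      using near[of x a "b + \<delta>" "b + \<delta>" r\<^sub>1] near[of x a "b - \<delta>" "b - \<delta>" r\<^sub>2] xa \<eta> r12 by auto
    have "continuous_on {b - \<delta>..b + \<delta>} (\<lambda>y. F (x, y))"
      using inner(1)[of x] xa \<eta> \<delta>
      by (intro continuous_on_compose2[OF cF] continuous_intros) (auto simp: abs_le_iff)
    then obtain y where y: "b - \<delta> \<le> y" "y \<le> b + \<delta>" "F (x, y) = 0"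
      using IVT'[of "\<lambda>y. F (x, y)" "b - \<delta>" 0 "b + \<delta>"] pos \<delta> by auto
    then have "y \<noteq> b - \<delta>" "y \<noteq> b + \<delta>" using pos by auto
    with y have "b - \<delta> < y" "y < b + \<delta>" by linarith+
    then show ?thesis using y by auto
  qed
  then obtain y where y: "\<And>x. x \<in> {a - \<eta>..a + \<eta>} \<Longrightarrow> y x \<in> {b - \<delta><..<b + \<delta>} \<and> F (x, y x) = 0"
    by metis
  have "graph_box U F a b \<eta> \<delta> m (\<lambda>x. if x \<in> {a - \<eta>..a + \<eta>} then y x else 0)"
  proof
    show "{a - \<eta>..a + \<eta>} \<times> {b - 3 * \<delta>..b + 3 * \<delta>} \<subseteq> U"
      using inner(1) \<eta> by (auto simp: abs_le_iff)
    show "m \<le> deriv_y F z" if "z \<in> {a - \<eta>..a + \<eta>} \<times> {b - 3 * \<delta>..b + 3 * \<delta>}" for z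
      using inner(2)[of "fst z" "snd z"] that \<eta> by (auto simp: abs_le_iff)
  qed (use U F \<eta> \<delta> m y in auto)
  then show ?thesis by (rule graph_box.regularizable) (use \<eta> \<delta> in auto)
qed

lemma regularizable_deriv_y:
  assumes U: "open U" and F: "smooth_on U F" and z: "z \<in> U" "F z = 0" "deriv_y F z \<noteq> 0"
  shows "regularizable U F z"
proof (cases "deriv_y F z > 0")
  case True
  then show ?thesis using regularizable_deriv_y_pos[OF U F, of "fst z" "snd z"] z by simp
next
  case False
  have "((\<lambda>z. - F z) has_derivative (\<lambda>v. - frechet_derivative F (at z) v)) (at z)"
    by (rule has_derivative_minus[OF smooth_on_has_derivative[OF F z(1)]])
  from frechet_derivative_at[OF this, symmetric]
  have "deriv_y (\<lambda>z. - F z) z = - deriv_y F z"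
    by (simp add: deriv_y_def)
  then have "regularizable U (\<lambda>z. - F z) z"
    using regularizable_deriv_y_pos[OF U smooth_on_uminus[OF U F], of "fst z" "snd z"] False z by simp
  then obtain W where W: "open W" "z \<in> W" "W \<subseteq> U"
    "\<And>\<phi>. smooth_on U \<phi> \<Longrightarrow> (\<forall>z\<in>U - W. \<phi> z = 0) \<Longrightarrow>
       (\<exists>L. truncation_limit U (\<lambda>z. - F z) \<phi> L)"
    unfolding regularizable_def by blast
  show ?thesis
    unfolding regularizable_def
  proof (intro exI[of _ W] conjI allI impI W(1-3))
    fix \<phi> :: "real \<times> real \<Rightarrow> real" assume \<phi>: "smooth_on U \<phi>" "\<forall>z\<in>U - W. \<phi> z = 0"
    \<comment> \<open>Negating both \<phi> and \<open>F\<close> changes neither the quotient nor the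
      conditions on \<open>h\<close>.\<close>
    show "\<exists>L. truncation_limit U F \<phi> L"
      using W(4)[OF smooth_on_uminus[OF U \<phi>(1)]] \<phi>(2) by (simp add: truncation_limit_def)
  qed
qed

text \<open>The box argument lives on \<open>real \<times> real\<close>, the charts in
  \<open>real^2\<close>. A measure-preserving linear isomorphism carries integrals, smoothness and
  zero sets across; nonvanishing of derivatives survives because \<open>e\<close> is onto.\<close>

lemma regularizable_transfer:
  fixes e :: "'a::euclidean_space \<Rightarrow> 'b::euclidean_space" and F :: "'b \<Rightarrow> real"
  assumes U: "open U" and F: "smooth_on U F"
    and e: "bounded_linear e" "bounded_linear e'" "\<And>z. e (e' z) = z" "\<And>z. e' (e z) = z"
    and distr: "distr lborel borel e = lborel"
    and reg: "regularizable (e -` U) (F \<circ> e) (e' z\<^sub>0)"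
  shows "regularizable U F z\<^sub>0"
proof -
  have ce: "continuous_on UNIV e" "continuous_on UNIV e'"
    using e by (auto intro: linear_continuous_on)
  have U': "open (e -` U)" using U ce(1) by (rule open_vimage)
  have smooth_comp: "smooth_on (e -` U) (g \<circ> e)" if "smooth_on U g" for g :: "'b \<Rightarrow> real"
    by (rule smooth_on_compose[OF U' U _ smooth_on_bounded_linear[OF U' e(1)] that]) auto
  obtain W where W: "open W" "e' z\<^sub>0 \<in> W" "W \<subseteq> e -` U"
    "\<And>\<phi>. smooth_on (e -` U) \<phi> \<Longrightarrow> (\<forall>z\<in>e -` U - W. \<phi> z = 0) \<Longrightarrow>
       (\<exists>L. truncation_limit (e -` U) (F \<circ> e) \<phi> L)"
    using reg unfolding regularizable_def by blast
  show ?thesis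
    unfolding regularizable_def
  proof (intro exI[of _ "e' -` W"] conjI allI impI)
    show "open (e' -` W)" using W(1) ce(2) by (rule open_vimage)
    show "z\<^sub>0 \<in> e' -` W" using W(2) by simp
    show "e' -` W \<subseteq> U" using W(3) e(3) by force
    fix \<phi> :: "'b \<Rightarrow> real" assume \<phi>: "smooth_on U \<phi>" "\<forall>z\<in>U - e' -` W. \<phi> z = 0"
    have "\<forall>z\<in>e -` U - W. (\<phi> \<circ> e) z = 0" using \<phi>(2) e(4) by auto
    from W(4)[OF smooth_comp[OF \<phi>(1)] this]
    obtain L where L: "truncation_limit (e -` U) (F \<circ> e) (\<phi> \<circ> e) L" by blast
    show "\<exists>L. truncation_limit U F \<phi> L"
    unfolding truncation_limit_def
    proof (intro exI[of _ L] allI impI)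
      fix h :: "_ \<Rightarrow> real" assume h: "smooth_on U h" "\<forall>z\<in>U. h z = 0 \<longleftrightarrow> F z = 0"
        "\<forall>z\<in>U. F z = 0 \<longrightarrow> frechet_derivative h (at z) \<noteq> (\<lambda>v. 0)"
      have nz: "frechet_derivative (h \<circ> e) (at z) \<noteq> (\<lambda>v. 0)" if z: "e z \<in> U" "F (e z) = 0" for z
      proof
        assume 0: "frechet_derivative (h \<circ> e) (at z) = (\<lambda>v. 0)"
        have "((h \<circ> e) has_derivative frechet_derivative h (at (e z)) \<circ> e) (at z)"
          using diff_chain_at[OF bounded_linear_imp_has_derivative[OF e(1)] smooth_on_has_derivative[OF h(1) z(1)]] .
        from frechet_derivative_at[OF this] 0 have "frechet_derivative h (at (e z)) (e v) = 0" for v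
          by (simp add: fun_eq_iff)
        then have "frechet_derivative h (at (e z)) v = 0" for v using e(3) by metis
        then show False using h(3) z by auto
      qed
      have "((\<lambda>\<epsilon>. LINT z:{z \<in> e -` U. \<bar>(h \<circ> e) z\<bar> > \<epsilon>}|lborel. (\<phi> \<circ> e) z / (F \<circ> e) z) \<longlongrightarrow> L) (at_right 0)"
        by (rule truncation_limitD[OF L smooth_comp[OF h(1)]]) (use h(2) in simp, rule nz, simp_all)
      moreover have "(LINT z:{z \<in> e -` U. \<bar>(h \<circ> e) z\<bar> > \<epsilon>}|lborel. (\<phi> \<circ> e) z / (F \<circ> e) z)
          = (LINT z:{z \<in> U. \<bar>h z\<bar> > \<epsilon>}|lborel. \<phi> z / F z)" for \<epsilon>
      proof -
        have "(LINT z:{z \<in> U. \<bar>h z\<bar> > \<epsilon>}|lborel. \<phi> z / F z)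
            = (\<integral>z. indicator {z \<in> U. \<bar>h z\<bar> > \<epsilon>} z *\<^sub>R (\<phi> z / F z) \<partial>distr lborel borel e)"
          by (simp add: set_lebesgue_integral_def distr)
        also have "\<dots> = (\<integral>z. indicator {z \<in> U. \<bar>h z\<bar> > \<epsilon>} (e z) *\<^sub>R (\<phi> (e z) / F (e z)) \<partial>lborel)"
          using ce(1) \<phi>(1) F h(1)
          by (intro integral_distr truncated_quotient_measurable[OF U] smooth_on_imp_continuous_on)
             (auto intro: borel_measurable_continuous_onI)
        finally show ?thesis by (simp add: set_lebesgue_integral_def indicator_def)
      qed
      ultimately show "((\<lambda>\<epsilon>. LINT z:{z \<in> U. \<bar>h z\<bar> > \<epsilon>}|lborel. \<phi> z / F z) \<longlongrightarrow> L) (at_right 0)"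
        by simp
    qed
  qed
qed

lemma bounded_linear_vec2:
  "bounded_linear (\<lambda>(x, y). vector [x, y] :: real^2)" "bounded_linear (\<lambda>(x, y). vector [y, x] :: real^2)"
  unfolding linear_conv_bounded_linear[symmetric]
  by (auto intro!: linearI simp: vec_eq_iff forall_2)

text \<open>The preimage of a box is a rectangle with the same side lengths, and the values on boxes
  determine the measure. Exchanging the coordinates reverses orientation, which the measure does not
  see.\<close>

lemma lborel_vec2:
  shows "distr lborel borel (\<lambda>(x, y). vector [x, y] :: real^2) = lborel"
    and "distr lborel borel (\<lambda>(x, y). vector [y, x] :: real^2) = lborel"
proof -
  have B: "(Basis :: (real^2) set) = {axis 1 1, axis 2 1}"
    by (auto simp: Basis_vec_def UNIV_2)
  have ne: "axis 1 1 \<noteq> (axis 2 1 :: real^2)"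
    by (simp add: axis_eq_axis)
  have c: "(\<lambda>(x, y). vector [x, y] :: real^2) \<in> borel_measurable lborel"
    "(\<lambda>(x, y). vector [y, x] :: real^2) \<in> borel_measurable lborel"
    using linear_continuous_on[OF bounded_linear_vec2(1)] linear_continuous_on[OF bounded_linear_vec2(2)]
    by (auto intro: borel_measurable_continuous_onI)
  have Times: "emeasure lborel ({l<..<u} \<times> {l'<..<u'}) = ennreal ((u - l) * (u' - l'))"
    if "l \<le> u" "l' \<le> u'" for l u l' u' :: real
    using that by (simp flip: lborel_prod add: lborel.emeasure_pair_measure_Times ennreal_mult)
  show "distr lborel borel (\<lambda>(x, y). vector [x, y] :: real^2) = lborel"
  proof (rule lborel_eqI[symmetric])
    fix l u :: "real^2" assume le: "\<And>b. b \<in> Basis \<Longrightarrow> l \<bullet> b \<le> u \<bullet> b"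
    have "(\<lambda>(x, y). vector [x, y] :: real^2) -` box l u = {l $ 1<..<u $ 1} \<times> {l $ 2<..<u $ 2}"
      by (auto simp: mem_box B inner_axis)
    then show "emeasure (distr lborel borel (\<lambda>(x, y). vector [x, y] :: real^2)) (box l u) = (\<Prod>b\<in>Basis. (u - l) \<bullet> b)"
      using Times[of "l $ 1" "u $ 1" "l $ 2" "u $ 2"] le[of "axis 1 1"] le[of "axis 2 1"] c ne by (simp add: emeasure_distr B inner_axis)
  qed simp
  show "distr lborel borel (\<lambda>(x, y). vector [y, x] :: real^2) = lborel"
  proof (rule lborel_eqI[symmetric])
    fix l u :: "real^2" assume le: "\<And>b. b \<in> Basis \<Longrightarrow> l \<bullet> b \<le> u \<bullet> b"
    have "(\<lambda>(x, y). vector [y, x] :: real^2) -` box l u = {l $ 2<..<u $ 2} \<times> {l $ 1<..<u $ 1}"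
      by (auto simp: mem_box B inner_axis)
    then show "emeasure (distr lborel borel (\<lambda>(x, y). vector [y, x] :: real^2)) (box l u) = (\<Prod>b\<in>Basis. (u - l) \<bullet> b)"
      using Times[of "l $ 2" "u $ 2" "l $ 1" "u $ 1"] le[of "axis 1 1"] le[of "axis 2 1"] c ne by (simp add: emeasure_distr B inner_axis mult.commute)
  qed simp
qed

text \<open>A nonzero differential is nonzero on one of the two coordinate vectors; the matching
  identification with \<open>real \<times> real\<close> makes that direction vertical.\<close>

lemma regularizable_zero:
  fixes F :: "real^2 \<Rightarrow> real"
  assumes U: "open U" and F: "smooth_on U F" and z: "z \<in> U" "F z = 0"
    and nz: "frechet_derivative F (at z) \<noteq> (\<lambda>v. 0)"
  shows "regularizable U F z"
proof -
  let ?D = "frechet_derivative F (at z)"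
  have lin: "linear ?D" using smooth_on_has_derivative[OF F z(1)] has_derivative_linear by blast
  have coord: "regularizable U F z"
    if e: "bounded_linear e" "bounded_linear e'" "\<And>z. e (e' z) = z" "\<And>z. e' (e z) = z"
      "distr lborel borel e = lborel" and D: "?D (e (0, 1)) \<noteq> 0"
    for e :: "real \<times> real \<Rightarrow> real^2" and e'
  proof (rule regularizable_transfer[OF U F e])
    have ce: "continuous_on UNIV e" using e(1) by (rule linear_continuous_on)
    have U': "open (e -` U)" using U ce by (rule open_vimage)
    have "((F \<circ> e) has_derivative ?D \<circ> e) (at (e' z))"
      using diff_chain_at[OF bounded_linear_imp_has_derivative[OF e(1)], of F ?D "e' z"]
        smooth_on_has_derivative[OF F z(1)] e(3) by simp
    from frechet_derivative_at[OF this, symmetric]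
    have "deriv_y (F \<circ> e) (e' z) = ?D (e (0, 1))" by (simp add: deriv_y_def)
    moreover have "smooth_on (e -` U) (F \<circ> e)"
      by (rule smooth_on_compose[OF U' U _ smooth_on_bounded_linear[OF U' e(1)] F]) auto
    ultimately show "regularizable (e -` U) (F \<circ> e) (e' z)"
      using U' z D e(3) by (intro regularizable_deriv_y) auto
  qed
  obtain v where v: "?D v \<noteq> 0" using nz by auto
  have "v = (v $ 1) *\<^sub>R vector [1, 0] + (v $ 2) *\<^sub>R vector [0, 1]"
    by (simp add: vec_eq_iff forall_2)
  then have "?D v = v $ 1 * ?D (vector [1, 0]) + v $ 2 * ?D (vector [0, 1])"
    using linear_add[OF lin, of "v $ 1 *\<^sub>R vector [1, 0]" "v $ 2 *\<^sub>R vector [0, 1]"]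
      linear_cmul[OF lin, of "v $ 1" "vector [1, 0]"] linear_cmul[OF lin, of "v $ 2" "vector [0, 1]"] by simp
  then have "?D (vector [1, 0]) \<noteq> 0 \<or> ?D (vector [0, 1]) \<noteq> 0" using v by auto
  moreover have bl: "bounded_linear (\<lambda>v::real^2. (v $ 1, v $ 2))" "bounded_linear (\<lambda>v::real^2. (v $ 2, v $ 1))"
    by (intro bounded_linear_Pair bounded_linear_vec_nth)+
  moreover have "(\<lambda>(x, y). vector [x, y] :: real^2) (v $ 1, v $ 2) = v" "(\<lambda>(x, y). vector [y, x] :: real^2) (v $ 2, v $ 1) = v" for v
    by (simp_all add: vec_eq_iff forall_2)
  ultimately show ?thesis
    using coord[OF bounded_linear_vec2(1) bl(1) _ _ lborel_vec2(1)]
      coord[OF bounded_linear_vec2(2) bl(2) _ _ lborel_vec2(2)] by force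
qed

text \<open>On a closed ball free of zeros |h| has a positive minimum. For \<epsilon> below it the
  truncation removes nothing where \<phi> is nonzero, so the integral is constant in
  \<epsilon>.\<close>

lemma regularizable_nonzero:
  fixes F :: "'a::euclidean_space \<Rightarrow> real"
  assumes U: "open U" and F: "continuous_on U F" and z: "z \<in> U" "F z \<noteq> 0"
  shows "regularizable U F z"
proof -
  have "open {z \<in> U. 0 < \<bar>F z\<bar>}" using open_superlevel[OF U continuous_on_rabs[OF F]] .
  then obtain r where r: "r > 0" "cball z r \<subseteq> {z \<in> U. 0 < \<bar>F z\<bar>}"
    using z open_contains_cball[of "{z \<in> U. 0 < \<bar>F z\<bar>}"] by force
  show ?thesis
    unfolding regularizable_def
  proof (intro exI[of _ "ball z r"] conjI allI impI)
    show "ball z r \<subseteq> U" using r ball_subset_cball[of z r] by blast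
    fix \<phi> :: "'a \<Rightarrow> real" assume \<phi>: "smooth_on U \<phi>" "\<forall>z'\<in>U - ball z r. \<phi> z' = 0"
    show "\<exists>L. truncation_limit U F \<phi> L"
    unfolding truncation_limit_def
    proof (intro exI[of _ "LINT z:U|lborel. \<phi> z / F z"] allI impI)
      fix h :: "'a \<Rightarrow> real" assume h: "smooth_on U h" "\<forall>z\<in>U. h z = 0 \<longleftrightarrow> F z = 0"
      have "continuous_on (cball z r) (\<lambda>z. \<bar>h z\<bar>)"
        using r by (intro continuous_on_rabs continuous_on_subset[OF smooth_on_imp_continuous_on[OF h(1)]]) blast
      moreover have "cball z r \<noteq> {}" using r(1) by auto
      ultimately obtain z' where z': "z' \<in> cball z r" "\<forall>y\<in>cball z r. \<bar>h z'\<bar> \<le> \<bar>h y\<bar>"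
        using continuous_attains_inf[OF compact_cball] by blast
      have "F z' \<noteq> 0" "z' \<in> U" using z'(1) r(2) by auto
      then have pos: "\<bar>h z'\<bar> > 0" using h(2) by simp
      have "(LINT z:{z \<in> U. \<bar>h z\<bar> > \<epsilon>}|lborel. \<phi> z / F z) = (LINT z:U|lborel. \<phi> z / F z)"
        if "\<epsilon> < \<bar>h z'\<bar>" for \<epsilon>
        unfolding set_lebesgue_integral_def
      proof (intro Bochner_Integration.integral_cong refl)
        fix y
        have "\<epsilon> < \<bar>h y\<bar>" if "y \<in> ball z r"
          using z'(2) that \<open>\<epsilon> < \<bar>h z'\<bar>\<close> less_le_trans[of \<epsilon> "\<bar>h z'\<bar>" "\<bar>h y\<bar>"] by simp
        then show "indicator {z \<in> U. \<bar>h z\<bar> > \<epsilon>} y *\<^sub>R (\<phi> y / F y) = indicator U y *\<^sub>R (\<phi> y / F y)"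
          using \<phi>(2) by (cases "y \<in> ball z r") (auto simp: indicator_def)
      qed
      then have "\<forall>\<^sub>F \<epsilon> in at_right 0. (LINT z:{z \<in> U. \<bar>h z\<bar> > \<epsilon>}|lborel. \<phi> z / F z) = (LINT z:U|lborel. \<phi> z / F z)"
        using pos unfolding eventually_at_right_field by blast
      then show "((\<lambda>\<epsilon>. LINT z:{z \<in> U. \<bar>h z\<bar> > \<epsilon>}|lborel. \<phi> z / F z) \<longlongrightarrow> (LINT z:U|lborel. \<phi> z / F z)) (at_right 0)"
        by (rule tendsto_eventually)
    qed
  qed (use r in auto)
qed

subsection \<open>Poisson structures with linear zeros\<close>

lemma zero_set_iff:
  assumes P: "bivector_field A P" and c: "c \<in> A" "p \<in> chart_dom c"
  shows "p \<in> zero_set A P \<longleftrightarrow> P c p = 0"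
proof
  assume 0: "P c p = 0"
  have "P d p = 0" if "d \<in> A" "p \<in> chart_dom d" for d
  proof -
    have "P d p = jacobian (transition c d) (chart_map c p) * P c p"
      using P c that unfolding bivector_field_def by blast
    then show ?thesis using 0 by simp
  qed
  then show "p \<in> zero_set A P" by (simp add: zero_set_def)
qed (use c in \<open>simp add: zero_set_def\<close>)

lemma inverse_form_change_chart:
  assumes A: "oriented_atlas A" and P: "bivector_field A P"
    and c: "c \<in> A" "d \<in> A" "p \<in> chart_dom c \<inter> chart_dom d"
  shows "inverse_form P c p = jacobian (transition c d) (chart_map c p) * inverse_form P d p"
proof -
  have "P d p = jacobian (transition c d) (chart_map c p) * P c p"
    using P c unfolding bivector_field_def by blast
  moreover have "jacobian (transition c d) (chart_map c p) > 0"
    by (rule transition_jacobian_pos[OF A c])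
  ultimately show ?thesis by (simp add: inverse_form_def)
qed

text \<open>Linear vanishing is given for the function f, but the local theory needs it for the
  chart component of \<pi>. In the chart f is \<pi> times the component of
  \<open>\<omega>\<^sub>0\<close>; as \<pi> is 0 at p, a vanishing derivative of \<pi> would by the
  product rule force that of f to vanish.\<close>

lemma linear_zero_derivative:
  assumes A: "oriented_atlas A" and \<omega>: "positive_symplectic_form A \<omega>\<^sub>0"
    and \<pi>: "bivector_field A \<pi>"
    and C: "bivector_vanishes_linearly A \<omega>\<^sub>0 \<pi> C" "p \<in> C"
    and c: "c \<in> A" "p \<in> chart_dom c"
  shows "frechet_derivative (\<pi> c \<circ> chart_inv c) (at (chart_map c p)) \<noteq> (\<lambda>v. 0)"
proof
  assume 0: "frechet_derivative (\<pi> c \<circ> chart_inv c) (at (chart_map c p)) = (\<lambda>v. 0)"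
  have ch: "is_chart c" by (rule atlas_is_chart[OF A c(1)])
  let ?x = "chart_map c p"
  have x: "?x \<in> chart_img c" by (rule chart_map_in_img[OF ch c(2)])
  obtain f where f: "\<And>q. q \<in> chart_dom c \<Longrightarrow> \<pi> c q = f q * inverse_bivector \<omega>\<^sub>0 c q"
      "vanishes_linearly A f C"
    using C(1) c(1) unfolding bivector_vanishes_linearly_def by blast
  have f0: "f p = 0" "frechet_derivative (f \<circ> chart_inv c) (at ?x) \<noteq> (\<lambda>v. 0)"
    using f(2) C(2) c unfolding vanishes_linearly_def differential_nonzero_def by blast+
  have "smooth_on (chart_img c) (\<pi> c \<circ> chart_inv c)" "smooth_on (chart_img c) (\<omega>\<^sub>0 c \<circ> chart_inv c)"
    using \<pi> \<omega> c(1)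
    by (auto simp: bivector_field_def positive_symplectic_form_def two_form_def smooth_component_def)
  from has_derivative_mult[OF smooth_on_has_derivative[OF this(1) x] smooth_on_has_derivative[OF this(2) x]]
  have "((\<lambda>y. (\<pi> c \<circ> chart_inv c) y * (\<omega>\<^sub>0 c \<circ> chart_inv c) y) has_derivative (\<lambda>v. 0)) (at ?x)"
    using f(1)[OF c(2)] f0(1) 0 chart_inv_map[OF ch c(2)] by simp
  then have "(f \<circ> chart_inv c has_derivative (\<lambda>v. 0)) (at ?x)"
  proof (rule has_derivative_transform_within_open[OF _ chart_img_open[OF ch] x])
    fix y assume "y \<in> chart_img c"
    then have y: "chart_inv c y \<in> chart_dom c" by (rule chart_inv_in_dom[OF ch])
    then have "\<omega>\<^sub>0 c (chart_inv c y) > 0"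
      using \<omega> c(1) by (simp add: positive_symplectic_form_def)
    then show "(\<pi> c \<circ> chart_inv c) y * (\<omega>\<^sub>0 c \<circ> chart_inv c) y = (f \<circ> chart_inv c) y"
      using f(1)[OF y] by (simp add: inverse_bivector_def)
  qed
  from frechet_derivative_at[OF this] f0(2) show False by simp
qed

lemma chart_truncation_image:
  fixes h :: "'a::topological_space \<Rightarrow> real"
  assumes "is_chart c"
  shows "chart_map c ` (chart_dom c \<inter> {p. \<bar>h p\<bar> > \<epsilon>}) = {z \<in> chart_img c. \<bar>(h \<circ> chart_inv c) z\<bar> > \<epsilon>}"
  using chart_inv_in_dom[OF assms] by (auto simp: chart_map_image_eq[OF assms])

text \<open>Where |h| is at least \<epsilon>, \<pi> has no zero, and together with the closed
  support of the weight this cuts out a compact set, so the quotient is bounded there. The second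
  claim passes from \<open>lebesgue\<close>, used to define the integral, to \<open>lborel\<close>,
  on which the local limits are stated.\<close>

lemma truncated_density_integrable:
  fixes A :: "'a::t2_space chart set"
  assumes A: "oriented_atlas A" and comp: "compact (UNIV :: 'a set)"
    and P: "bivector_field A P" and \<rho>: "partition_of_unity A N c \<rho>" and i: "i < N"
    and h: "smooth_fun A h" "\<And>p. p \<in> zero_set A P \<Longrightarrow> h p = 0" and \<epsilon>: "\<epsilon> > 0"
  defines "S \<equiv> {z \<in> chart_img (c i). \<bar>(h \<circ> chart_inv (c i)) z\<bar> > \<epsilon>}"
    and "q \<equiv> \<lambda>z. (\<rho> i \<circ> chart_inv (c i)) z / (P (c i) \<circ> chart_inv (c i)) z"
  shows "set_integrable lebesgue S q" "(LINT z:S|lebesgue. q z) = (LINT z:S|lborel. q z)"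
proof -
  have ci: "c i \<in> A" "smooth_fun A (\<rho> i)" "closure {p. \<rho> i p \<noteq> 0} \<subseteq> chart_dom (c i)"
    using \<rho> i by (auto simp: partition_of_unity_def)
  have ch: "is_chart (c i)" by (rule atlas_is_chart[OF A ci(1)])
  let ?U = "chart_img (c i)"
  have cont: "continuous_on ?U (\<rho> i \<circ> chart_inv (c i))" "continuous_on ?U (P (c i) \<circ> chart_inv (c i))"
    "continuous_on ?U (h \<circ> chart_inv (c i))"
    using ci(1,2) h(1) P
    by (auto simp: smooth_fun_def bivector_field_def smooth_component_def simp del: o_apply
        intro!: smooth_on_imp_continuous_on)
  have meas: "(\<lambda>z. indicator S z *\<^sub>R q z) \<in> borel_measurable borel"
    unfolding S_def q_def by (rule truncated_quotient_measurable[OF chart_img_open[OF ch] cont])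
  \<comment> \<open>The weak inequality makes \<open>K\<close> closed, hence compact, while it still
    contains the truncated support.\<close>
  define K where "K = closure {p. \<rho> i p \<noteq> 0} \<inter> {p. \<bar>h p\<bar> \<ge> \<epsilon>}"
  have "closed {p. \<bar>h p\<bar> \<ge> \<epsilon>}"
    using smooth_fun_continuous[OF A h(1)] by (intro closed_Collect_le continuous_intros) auto
  then have "compact K"
    using compact_Int_closed[OF comp, of K] by (simp add: K_def closed_Int)
  have K: "K \<subseteq> chart_dom (c i)" using ci(3) by (auto simp: K_def)
  let ?K = "chart_map (c i) ` K"
  have cK: "compact ?K"
    using \<open>compact K\<close> continuous_on_subset[OF chart_map_continuous[OF ch] K] by (rule compact_continuous_image[rotated])
  have KU: "?K \<subseteq> ?U" using K by (auto simp: chart_img_def)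
  have "(P (c i) \<circ> chart_inv (c i)) z \<noteq> 0" if "z \<in> ?K" for z
  proof -
    obtain p where p: "p \<in> K" "z = chart_map (c i) p" using \<open>z \<in> ?K\<close> by blast
    then have "h p \<noteq> 0" using \<epsilon> by (auto simp: K_def)
    then have "P (c i) p \<noteq> 0" using h(2) zero_set_iff[OF P ci(1), of p] p(1) K by auto
    then show ?thesis using p K chart_inv_map[OF ch, of p] by auto
  qed
  then have "continuous_on ?K q"
    unfolding q_def using continuous_on_subset[OF cont(1) KU] continuous_on_subset[OF cont(2) KU]
    by (intro continuous_on_divide) auto
  then obtain B where B: "B > 0" "\<And>z. z \<in> ?K \<Longrightarrow> \<bar>q z\<bar> \<le> B"
    using compact_imp_bounded[OF compact_continuous_image[OF _ cK, of q]] by (auto simp: bounded_pos)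
  have bound: "\<bar>indicator S z *\<^sub>R q z\<bar> \<le> B * indicator ?K z" for z
  proof (cases "z \<in> ?K")
    case True then show ?thesis using B by (simp add: indicator_def)
  next
    case False
    have "indicator S z *\<^sub>R q z = 0"
    proof (rule ccontr)
      assume "indicator S z *\<^sub>R q z \<noteq> 0"
      then have z: "z \<in> S" "\<rho> i (chart_inv (c i) z) \<noteq> 0" by (auto simp: q_def indicator_def split: if_splits)
      then have "chart_inv (c i) z \<in> K"
        using closure_subset[of "{p. \<rho> i p \<noteq> 0}"] by (auto simp: K_def S_def)
      then have "chart_map (c i) (chart_inv (c i) z) \<in> ?K" by (rule imageI)
      then show False using False z(1) chart_map_inv[OF ch, of z] by (simp add: S_def)
    qed
    then show ?thesis using B(1) by (simp add: indicator_def)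
  qed
  have fm: "?K \<in> fmeasurable lborel"
    using borel_compact[OF cK] emeasure_bounded_finite[OF compact_imp_bounded[OF cK]] by (simp add: fmeasurable_def)
  have meas': "(\<lambda>z. indicator S z *\<^sub>R q z) \<in> borel_measurable lborel"
    using meas by (simp only: measurable_lborel2)
  have int: "integrable lborel (\<lambda>z. indicator S z *\<^sub>R q z)"
    by (rule integral_bounded_support(1)[OF meas' fm bound])
  show "set_integrable lebesgue S q"
    unfolding set_integrable_def using integrable_completion[OF meas'] int by (rule iffD2)
  show "(LINT z:S|lebesgue. q z) = (LINT z:S|lborel. q z)"
    unfolding set_lebesgue_integral_def by (rule integral_completion[OF meas'])
qed

theorem theorem2:
  fixes A :: "'a::t2_space chart set" and \<omega>\<^sub>0 \<pi> :: "'a component"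
    and n :: nat and \<gamma> :: "nat \<Rightarrow> 'a set"
  assumes "compact_connected_oriented_surface A"
    and "positive_symplectic_form A \<omega>\<^sub>0"
    and "\<pi> \<in> linear_poisson_structures A \<omega>\<^sub>0 n"
    and "disjoint_closed_curves A n \<gamma>"
    and "zero_set A \<pi> = (\<Union>i\<in>{1..n}. \<gamma> i)"
  shows "\<exists>V. \<forall>h. smooth_fun A h \<longrightarrow> (\<forall>i\<in>{1..n}. vanishes_linearly A h (\<gamma> i)) \<longrightarrow>
           (\<forall>p. p \<notin> (\<Union>i\<in>{1..n}. \<gamma> i) \<longrightarrow> h p \<noteq> 0) \<longrightarrow>
           (\<forall>\<epsilon>>0. form_integrable A (inverse_form \<pi>) {p. \<bar>h p\<bar> > \<epsilon>}) \<and>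
           (truncated_volume A h \<pi> \<longlongrightarrow> V) (at_right 0)"
proof -
  have A: "oriented_atlas A" and comp: "compact (UNIV :: 'a set)"
    using assms(1) by (auto simp: compact_connected_oriented_surface_def)
  have \<pi>: "bivector_field A \<pi>"
    using assms(3) by (auto simp: linear_poisson_structures_def poisson_structure_def)
  let ?F = "\<lambda>c. \<pi> c \<circ> chart_inv c"
  have F: "smooth_on (chart_img c) (?F c)" if "c \<in> A" for c
    using \<pi> that by (simp add: bivector_field_def smooth_component_def)
  have reg: "regularizable (chart_img c) (?F c) (chart_map c p)" if c: "c \<in> A" "p \<in> chart_dom c" for c p
  proof -
    have ch: "is_chart c" by (rule atlas_is_chart[OF A c(1)])
    have x: "chart_map c p \<in> chart_img c" "?F c (chart_map c p) = \<pi> c p"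
      using chart_map_in_img[OF ch c(2)] chart_inv_map[OF ch c(2)] by simp_all
    show ?thesis
    proof (cases "\<pi> c p = 0")
      case True
      then have "p \<in> zero_set A \<pi>" using zero_set_iff[OF \<pi> c] by simp
      then obtain C where C: "p \<in> C" "bivector_vanishes_linearly A \<omega>\<^sub>0 \<pi> C"
        using assms(3) unfolding linear_poisson_structures_def by blast
      have "frechet_derivative (?F c) (at (chart_map c p)) \<noteq> (\<lambda>v. 0)"
        by (rule linear_zero_derivative[OF A assms(2) \<pi> C(2,1) c])
      then show ?thesis
        using x True by (intro regularizable_zero chart_img_open[OF ch] F c(1)) simp_all
    next
      case False
      then show ?thesis
        using x by (intro regularizable_nonzero chart_img_open[OF ch] smooth_on_imp_continuous_on[OF F] c(1)) simp_all
    qed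
  qed
  obtain cc where cc: "\<And>p. cc p \<in> A" "\<And>p. p \<in> chart_dom (cc p)"
    using atlas_covers[OF A] by metis
  \<comment> \<open>Each point gets a neighbourhood in its chart on which local limits exist; the
    partition of unity is built from these sets and so does not involve \<open>h\<close>.\<close>
  have "\<exists>W. open W \<and> chart_map (cc p) p \<in> W \<and> W \<subseteq> chart_img (cc p) \<and>
     (\<forall>\<phi>. smooth_on (chart_img (cc p)) \<phi> \<longrightarrow> (\<forall>z\<in>chart_img (cc p) - W. \<phi> z = 0) \<longrightarrow>
       (\<exists>L. truncation_limit (chart_img (cc p)) (?F (cc p)) \<phi> L))" for p
    using reg[OF cc, of p] unfolding regularizable_def .
  then obtain W where W: "\<And>p. open (W p)" "\<And>p. chart_map (cc p) p \<in> W p" "\<And>p. W p \<subseteq> chart_img (cc p)"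
    and lim: "\<And>p \<phi>. smooth_on (chart_img (cc p)) \<phi> \<Longrightarrow> \<forall>z\<in>chart_img (cc p) - W p. \<phi> z = 0 \<Longrightarrow>
       \<exists>L. truncation_limit (chart_img (cc p)) (?F (cc p)) \<phi> L"
    by metis
  obtain N q \<rho> where \<rho>: "partition_of_unity A N (cc \<circ> q) \<rho>"
    and supp: "\<And>i x. i < N \<Longrightarrow> x \<in> chart_img (cc (q i)) - W (q i) \<Longrightarrow> \<rho> i (chart_inv (cc (q i)) x) = 0"
    by (rule ex_partition_of_unity[OF A comp cc W]) blast
  let ?c = "\<lambda>i. cc (q i)"
  let ?\<phi> = "\<lambda>i. \<rho> i \<circ> chart_inv (?c i)"
  have "\<exists>L. truncation_limit (chart_img (?c i)) (?F (?c i)) (?\<phi> i) L"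
    if i: "i < N" for i
  proof (rule lim)
    show "smooth_on (chart_img (?c i)) (?\<phi> i)"
      using \<rho> i cc(1) by (simp add: partition_of_unity_def smooth_fun_def)
    show "\<forall>z\<in>chart_img (?c i) - W (q i). ?\<phi> i z = 0"
      using supp[OF i] by simp
  qed
  then obtain L where L: "\<And>i. i < N \<Longrightarrow> truncation_limit (chart_img (?c i)) (?F (?c i)) (?\<phi> i) (L i)"
    by metis
  show ?thesis
  \<comment> \<open>The sum of the local limits is the witness, and \<open>h\<close> is introduced
    only after it: this order of quantifiers is the independence claimed.\<close>
  proof (intro exI[of _ "\<Sum>i<N. L i"] allI impI)
    fix h assume h: "smooth_fun A h" "\<forall>i\<in>{1..n}. vanishes_linearly A h (\<gamma> i)"
      "\<forall>p. p \<notin> (\<Union>i\<in>{1..n}. \<gamma> i) \<longrightarrow> h p \<noteq> 0"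
    have h_zero: "h p = 0 \<and> differential_nonzero A h p" if "p \<in> zero_set A \<pi>" for p
      using that h(2) unfolding assms(5) vanishes_linearly_def by blast
    have h_zero_iff: "h p = 0 \<longleftrightarrow> p \<in> zero_set A \<pi>" for p
      using h_zero h(3) unfolding assms(5) by blast
    define I where "I \<epsilon> = (\<Sum>i<N. LINT z:{z \<in> chart_img (?c i). \<bar>(h \<circ> chart_inv (?c i)) z\<bar> > \<epsilon>}|lborel.
        ?\<phi> i z / ?F (?c i) z)" for \<epsilon>
    have int: "has_form_integral A (inverse_form \<pi>) {p. \<bar>h p\<bar> > \<epsilon>} (I \<epsilon>)" if \<epsilon>: "\<epsilon> > 0" for \<epsilon>
    proof -
      have *: "set_integrable lebesgue (chart_map (?c i) ` (chart_dom (?c i) \<inter> {p. \<bar>h p\<bar> > \<epsilon>}))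
            (chart_density (?c i) (\<rho> i) (inverse_form \<pi>))"
        "set_lebesgue_integral lebesgue (chart_map (?c i) ` (chart_dom (?c i) \<inter> {p. \<bar>h p\<bar> > \<epsilon>}))
            (chart_density (?c i) (\<rho> i) (inverse_form \<pi>)) =
          (LINT z:{z \<in> chart_img (?c i). \<bar>(h \<circ> chart_inv (?c i)) z\<bar> > \<epsilon>}|lborel. ?\<phi> i z / ?F (?c i) z)"
        if i: "i < N" for i
      proof -
        have "chart_density (?c i) (\<rho> i) (inverse_form \<pi>) = (\<lambda>z. ?\<phi> i z / ?F (?c i) z)"
          by (simp add: chart_density_def inverse_form_def fun_eq_iff)
        then show "set_integrable lebesgue (chart_map (?c i) ` (chart_dom (?c i) \<inter> {p. \<bar>h p\<bar> > \<epsilon>}))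
            (chart_density (?c i) (\<rho> i) (inverse_form \<pi>))"
          "set_lebesgue_integral lebesgue (chart_map (?c i) ` (chart_dom (?c i) \<inter> {p. \<bar>h p\<bar> > \<epsilon>}))
            (chart_density (?c i) (\<rho> i) (inverse_form \<pi>)) =
          (LINT z:{z \<in> chart_img (?c i). \<bar>(h \<circ> chart_inv (?c i)) z\<bar> > \<epsilon>}|lborel. ?\<phi> i z / ?F (?c i) z)"
          using truncated_density_integrable[OF A comp \<pi> \<rho> i h(1) _ \<epsilon>] h_zero
            chart_truncation_image[OF atlas_is_chart[OF A cc(1)[of "q i"]], where h = h and \<epsilon> = \<epsilon>]
          by (simp_all only: o_apply)
      qed
      show ?thesis
        unfolding has_form_integral_alt
        using * \<rho> by (intro exI[of _ N] exI[of _ "cc \<circ> q"] exI[of _ \<rho>]) (simp add: I_def)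
    qed
    have op: "open {p. \<bar>h p\<bar> > \<epsilon>}" for \<epsilon>
      using smooth_fun_continuous[OF A h(1)] by (intro open_Collect_less continuous_intros) auto
    \<comment> \<open>Uniqueness of the integral identifies the value with the sum over the adapted
      partition.\<close>
    have "truncated_volume A h \<pi> \<epsilon> = I \<epsilon>" if "\<epsilon> > 0" for \<epsilon>
      unfolding truncated_volume_def
      by (rule form_integral_eq[OF A op _ int[OF that]]) (rule inverse_form_change_chart[OF A \<pi>])
    then have "\<forall>\<^sub>F \<epsilon> in at_right 0. I \<epsilon> = truncated_volume A h \<pi> \<epsilon>"
      by (intro eventually_mono[OF eventually_at_right_less[of 0]]) simp
    moreover have "(I \<longlongrightarrow> (\<Sum>i<N. L i)) (at_right 0)"
      unfolding I_def
    proof (intro tendsto_sum truncation_limitD[OF L])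
      fix i assume i: "i \<in> {..<N}"
      then show "i < N" by simp
      have ch: "is_chart (?c i)" by (rule atlas_is_chart[OF A cc(1)])
      show "smooth_on (chart_img (?c i)) (h \<circ> chart_inv (?c i))"
        using h(1) cc(1) by (simp add: smooth_fun_def)
      have zero_iff: "?F (?c i) z = 0 \<longleftrightarrow> chart_inv (?c i) z \<in> zero_set A \<pi>" if "z \<in> chart_img (?c i)" for z
        using zero_set_iff[OF \<pi> cc(1) chart_inv_in_dom[OF ch that]] by simp
      then show "(h \<circ> chart_inv (?c i)) z = 0 \<longleftrightarrow> ?F (?c i) z = 0" if "z \<in> chart_img (?c i)" for z
        using h_zero_iff that by simp
      show "frechet_derivative (h \<circ> chart_inv (?c i)) (at z) \<noteq> (\<lambda>v. 0)"
        if z: "z \<in> chart_img (?c i)" "?F (?c i) z = 0" for z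
      proof -
        from z have "differential_nonzero A h (chart_inv (?c i) z)"
          using zero_iff h_zero by blast
        then show "frechet_derivative (h \<circ> chart_inv (?c i)) (at z) \<noteq> (\<lambda>v. 0)"
          using cc(1) chart_inv_in_dom[OF ch z(1)] chart_map_inv[OF ch z(1)]
          unfolding differential_nonzero_def by metis
      qed
    qed
    ultimately have "(truncated_volume A h \<pi> \<longlongrightarrow> (\<Sum>i<N. L i)) (at_right 0)"
      by (rule Lim_transform_eventually[rotated])
    then show "(\<forall>\<epsilon>>0. form_integrable A (inverse_form \<pi>) {p. \<bar>h p\<bar> > \<epsilon>}) \<and>
           (truncated_volume A h \<pi> \<longlongrightarrow> (\<Sum>i<N. L i)) (at_right 0)"
      using int unfolding form_integrable_def by blast
  qed
qed

end
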